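(* Let $g_1,\dots,g_m\in\mathbb{R}[x]=\mathbb{R}[x_1,\dots,x_n]$ and suppose $S=\{x\in\mathbb{R}^n:\ g_1(x)\ge0,\dots,g_m(x)\ge0\}$ is compact, convex and has nonempty interior. Assume the $g_i$ are concave on $S$ and that the archimedean condition holds. Suppose that for each $i$, either the matrix polynomial $-\nabla^2g_i(x)$ is SOS, or $-\nabla^2g_i(u)\succ0$ for all $u\in\partial S_i\cap\partial S$, where $S_i=\{x\in\mathbb{R}^n:\ g_i(x)\ge0\}$. Then the PP-BDNR property holds for $S$, and there exists $N>0$ such that $S=\tilde\rho_N(\tilde S_N)$.
   Context: A symmetric matrix polynomial $P(x)$ of size $r\times r$ is SOS if $P(x)=W(x)^TW(x)$ for some (possibly nonsquare) matrix polynomial $W(x)$ with $r$ columns; a scalar polynomial is SOS in the case $r=1$. $\succ0$ / $\succeq0$ mean positive definite / semidefinite. $\partial$ denotes topological boundary. Put $g_0=1$ and $d_k=\lceil\deg(g_k)/2\rceil$ for $0\le k\le m$. Archimedean condition: there exist SOS polynomials $s_0,\dots,s_m$ and $R>0$ such that $R-\sum_{i=1}^nx_i^2=s_0(x)+s_1(x)g_1(x)+\cdots+s_m(x)g_m(x)$. PP-BDNR property (Putinar–Prestel's Bounded Degree Nonnegative Representation of affine polynomials): there exists $N>0$ such that for every $(a,b)\in\mathbb{R}^n\times\mathbb{R}$ with $a^Tx+b\ge0$ on $S$ there are SOS polynomials $\sigma_0,\dots,\sigma_m$ with $a^Tx+b=\sum_{k=0}^m\sigma_k(x)g_k(x)$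 and $\deg(\sigma_kg_k)\le2N$ for all $k$. Lifted LMI: let $[x^j]$ be the column vector of all monomials in $x$ of degree at most $j$. For an integer $N\ge\max_kd_k$, define symmetric matrices $A^{(k)}_\alpha$ by $g_k(x)[x^{N-d_k}][x^{N-d_k}]^T=\sum_{0\le|\alpha|\le2N}A^{(k)}_\alpha x^\alpha$. Let $e_i$ be the $i$-th unit vector. $\tilde S_N$ is the set of all $(x,y)$, with $x\in\mathbb{R}^n$ and $y=(y_\alpha)_{1<|\alpha|\le2N}$ real, satisfying $$A^{(k)}_0+\sum_{i=1}^nA^{(k)}_{e_i}x_i+\sum_{1<|\alpha|\le2N}A^{(k)}_\alpha y_\alpha\succeq0\quad\text{for all }0\le k\le m,$$ and $\tilde\rho_N(x,y)=x$ is the projection onto $x$-space. *)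

theory Defs
  imports "HOL-Analysis.Analysis" "HOL-Library.Poly_Mapping" "HOL-Library.FuncSet"
begin

subsection \<open>Real polynomials in the variables indexed by a finite type\<close>

type_synonym 'n monom = "'n \<Rightarrow>\<^sub>0 nat"
type_synonym 'n mpoly = "'n monom \<Rightarrow>\<^sub>0 real"

definition mdeg :: "'n::finite monom \<Rightarrow> nat" where
  "mdeg \<alpha> = (\<Sum>i\<in>UNIV. Poly_Mapping.lookup \<alpha> i)"

(* The zero polynomial gets degree 0; this is harmless since degrees only occur in upper bounds
   and in half_deg. *)
definition tdeg :: "'n::finite mpoly \<Rightarrow> nat" where
  "tdeg p = Max (insert 0 (mdeg ` Poly_Mapping.keys p))"

definition xpow :: "'n monom \<Rightarrow> 'n mpoly" where
  "xpow \<alpha> = Poly_Mapping.single \<alpha> 1"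

definition Const :: "real \<Rightarrow> 'n mpoly" where
  "Const c = Poly_Mapping.single 0 c"

definition Var :: "'n \<Rightarrow> 'n mpoly" where
  "Var i = xpow (Poly_Mapping.single i 1)"

definition peval :: "'n::finite mpoly \<Rightarrow> real^'n \<Rightarrow> real" where
  "peval p x = (\<Sum>\<alpha>\<in>Poly_Mapping.keys p. Poly_Mapping.lookup p \<alpha> * (\<Prod>i\<in>UNIV. (x $ i) ^ Poly_Mapping.lookup \<alpha> i))"

(* Where the exponent of i is 0, the subtraction truncates, but then the coefficient is 0. *)
definition partial_deriv :: "'n \<Rightarrow> 'n mpoly \<Rightarrow> 'n mpoly" where
  "partial_deriv i p =
     (\<Sum>\<alpha>\<in>Poly_Mapping.keys p. Poly_Mapping.single (\<alpha> - Poly_Mapping.single i 1) (real (Poly_Mapping.lookup \<alpha> i) * Poly_Mapping.lookup p \<alpha>))"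

definition hessian :: "'n::finite mpoly \<Rightarrow> 'n mpoly ^ 'n ^ 'n" where
  "hessian p = (\<chi> i j. partial_deriv i (partial_deriv j p))"

definition meval :: "'n::finite mpoly ^ 'r ^ 's \<Rightarrow> real^'n \<Rightarrow> real ^ 'r ^ 's" where
  "meval P x = (\<chi> i j. peval (P $ i $ j) x)"

subsection \<open>Sums of squares and definiteness\<close>

(* P = W^T W, where W has l rows, the k-th row being W k. The number of rows is existentially
   quantified and hence cannot be a type. *)
definition sos_matrix :: "'n mpoly ^ 'r ^ 'r \<Rightarrow> bool" where
  "sos_matrix P \<longleftrightarrow>
     (\<exists>(l::nat) (W :: nat \<Rightarrow> 'n mpoly ^ 'r). \<forall>i j. P $ i $ j = (\<Sum>k<l. W k $ i * W k $ j))"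

definition sos :: "'n mpoly \<Rightarrow> bool" where
  "sos p \<longleftrightarrow> sos_matrix (\<chi> i j. p :: 'n mpoly ^ 1 ^ 1)"

lemma sos_iff: "sos p \<longleftrightarrow> (\<exists>(l::nat) w. p = (\<Sum>k<l. w k * w k))"
proof
  assume "sos p"
  then obtain l :: nat and W :: "nat \<Rightarrow> 'a mpoly ^ 1" where "p = (\<Sum>k<l. W k $ 1 * W k $ 1)"
    unfolding sos_def sos_matrix_def by auto
  then show "\<exists>(l::nat) w. p = (\<Sum>k<l. w k * w k)" by (intro exI)
next
  assume "\<exists>(l::nat) w. p = (\<Sum>k<l. w k * w k)"
  then obtain l :: nat and w where "p = (\<Sum>k<l. w k * w k)" by blast
  then show "sos p"
    unfolding sos_def sos_matrix_def by (intro exI[of _ l] exI[of _ "\<lambda>k. \<chi> i. w k"]) simp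
qed

definition pos_def :: "real ^ 'r ^ 'r \<Rightarrow> bool" where
  "pos_def M \<longleftrightarrow> transpose M = M \<and> (\<forall>v. v \<noteq> 0 \<longrightarrow> v \<bullet> (M *v v) > 0)"

(* A matrix whose rows and columns are indexed by the finite set I. *)
definition pos_semidef_on :: "'i set \<Rightarrow> ('i \<Rightarrow> 'i \<Rightarrow> real) \<Rightarrow> bool" where
  "pos_semidef_on I M \<longleftrightarrow>
     (\<forall>\<beta>\<in>I. \<forall>\<gamma>\<in>I. M \<beta> \<gamma> = M \<gamma> \<beta>) \<and>
     (\<forall>v. (\<Sum>\<beta>\<in>I. \<Sum>\<gamma>\<in>I. v \<beta> * M \<beta> \<gamma> * v \<gamma>) \<ge> 0)"

subsection \<open>Basic closed semialgebraic sets and representations of affine polynomials\<close>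

definition with_one :: "(nat \<Rightarrow> 'n mpoly) \<Rightarrow> nat \<Rightarrow> 'n mpoly" where
  "with_one g k = (if k = 0 then 1 else g k)"

definition nonneg_set :: "'n::finite mpoly \<Rightarrow> (real^'n) set" where
  "nonneg_set p = {x. peval p x \<ge> 0}"

definition semialg_set :: "nat \<Rightarrow> (nat \<Rightarrow> 'n::finite mpoly) \<Rightarrow> (real^'n) set" where
  "semialg_set m g = {x. \<forall>i\<in>{1..m}. peval (g i) x \<ge> 0}"

definition archimedean :: "nat \<Rightarrow> (nat \<Rightarrow> 'n::finite mpoly) \<Rightarrow> bool" where
  "archimedean m g \<longleftrightarrow>
     (\<exists>s R. R > 0 \<and> (\<forall>k\<le>m. sos (s k)) \<and>
        Const R - (\<Sum>i\<in>UNIV. Var i ^ 2) = (\<Sum>k\<le>m. s k * with_one g k))"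

definition affine_poly :: "real^'n \<Rightarrow> real \<Rightarrow> 'n::finite mpoly" where
  "affine_poly a b = (\<Sum>i\<in>UNIV. Const (a $ i) * Var i) + Const b"

definition PP_BDNR :: "nat \<Rightarrow> (nat \<Rightarrow> 'n::finite mpoly) \<Rightarrow> bool" where
  "PP_BDNR m g \<longleftrightarrow>
     (\<exists>N::nat. N > 0 \<and>
        (\<forall>a b. (\<forall>x\<in>semialg_set m g. a \<bullet> x + b \<ge> 0) \<longrightarrow>
           (\<exists>\<sigma>. (\<forall>k\<le>m. sos (\<sigma> k) \<and> tdeg (\<sigma> k * with_one g k) \<le> 2 * N) \<and>
                affine_poly a b = (\<Sum>k\<le>m. \<sigma> k * with_one g k))))"

subsection \<open>The lifted linear matrix inequality\<close>

definition half_deg :: "(nat \<Rightarrow> 'n::finite mpoly) \<Rightarrow> nat \<Rightarrow> nat" where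
  "half_deg g k = nat \<lceil>real (tdeg (with_one g k)) / 2\<rceil>"

definition monoms_upto :: "nat \<Rightarrow> 'n::finite monom set" where
  "monoms_upto j = {\<alpha>. mdeg \<alpha> \<le> j}"

definition lift_indices :: "nat \<Rightarrow> 'n::finite monom set" where
  "lift_indices N = {\<alpha>. 1 < mdeg \<alpha> \<and> mdeg \<alpha> \<le> 2 * N}"

(* The (beta, gamma) entry of the coefficient matrix of x^alpha in
   g_k(x) [x^(N - d_k)] [x^(N - d_k)]^T, where beta and gamma range over the monomials of degree at
   most N - d_k, i.e. rows and columns are indexed by the monomials themselves. *)
definition lmi_coeff :: "(nat \<Rightarrow> 'n::finite mpoly) \<Rightarrow> nat \<Rightarrow> 'n monom \<Rightarrow> 'n monom \<Rightarrow> 'n monom \<Rightarrow> real" where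
  "lmi_coeff g k \<alpha> \<beta> \<gamma> = Poly_Mapping.lookup (with_one g k * xpow \<beta> * xpow \<gamma>) \<alpha>"

(* Only meant for N \<ge> half_deg g k for all k \<le> m, so that N - half_deg g k does not truncate. *)
definition lifted_set ::
    "nat \<Rightarrow> (nat \<Rightarrow> 'n::finite mpoly) \<Rightarrow> nat \<Rightarrow> ((real^'n) \<times> ('n monom \<Rightarrow> real)) set" where
  "lifted_set m g N = {(x, y). y \<in> lift_indices N \<rightarrow>\<^sub>E UNIV \<and>
     (\<forall>k\<le>m. pos_semidef_on (monoms_upto (N - half_deg g k))
        (\<lambda>\<beta> \<gamma>. lmi_coeff g k 0 \<beta> \<gamma>
             + (\<Sum>i\<in>UNIV. lmi_coeff g k (Poly_Mapping.single i 1) \<beta> \<gamma> * x $ i)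
             + (\<Sum>\<alpha>\<in>lift_indices N. lmi_coeff g k \<alpha> \<beta> \<gamma> * y \<alpha>)))}"

lemma finite_monoms_upto [simp]: "finite (monoms_upto j :: 'n::finite monom set)"
proof -
  have "Poly_Mapping.lookup ` monoms_upto j \<subseteq> (UNIV :: 'n set) \<rightarrow>\<^sub>E {..j}"
    by (auto simp: monoms_upto_def mdeg_def PiE_UNIV_domain
        intro: order_trans[OF member_le_sum[where f = "Poly_Mapping.lookup _" and A = UNIV]])
  then have "finite (Poly_Mapping.lookup ` (monoms_upto j :: 'n monom set))"
    by (rule finite_subset) (simp add: finite_PiE)
  then show ?thesis
    by (rule finite_imageD) (simp add: lookup_inject inj_on_def)
qed

lemma finite_lift_indices [simp]: "finite (lift_indices N :: 'n::finite monom set)"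
  by (rule finite_subset[OF _ finite_monoms_upto[of "2 * N"]])
    (auto simp: lift_indices_def monoms_upto_def)

lemma mdeg_add: "mdeg (\<alpha> + \<beta>) = mdeg \<alpha> + mdeg \<beta>"
  by (simp add: mdeg_def lookup_add sum.distrib)

lemma mdeg_le_tdeg: "\<alpha> \<in> Poly_Mapping.keys p \<Longrightarrow> mdeg \<alpha> \<le> tdeg p"
  by (simp add: tdeg_def)

lemma poly_eq_sum_xpow:
  assumes "finite A" "Poly_Mapping.keys p \<subseteq> A"
  shows "p = (\<Sum>\<alpha>\<in>A. Const (Poly_Mapping.lookup p \<alpha>) * xpow \<alpha>)"
proof (rule poly_mapping_eqI)
  fix \<beta>
  have "Poly_Mapping.lookup (\<Sum>\<alpha>\<in>A. Const (Poly_Mapping.lookup p \<alpha>) * xpow \<alpha>) \<beta>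
      = (\<Sum>\<alpha>\<in>A. if \<alpha> = \<beta> then Poly_Mapping.lookup p \<alpha> else 0)"
    by (simp add: lookup_sum Const_def xpow_def mult_single lookup_single when_def)
  also have "\<dots> = Poly_Mapping.lookup p \<beta>"
    using assms by (auto simp: in_keys_iff)
  finally show "Poly_Mapping.lookup p \<beta>
      = Poly_Mapping.lookup (\<Sum>\<alpha>\<in>A. Const (Poly_Mapping.lookup p \<alpha>) * xpow \<alpha>) \<beta>" ..
qed

lemma lmi_coeff_expansion:
  assumes "half_deg g k \<le> N" "\<beta> \<in> monoms_upto (N - half_deg g k)" "\<gamma> \<in> monoms_upto (N - half_deg g k)"
  shows "with_one g k * xpow \<beta> * xpow \<gamma>
    = (\<Sum>\<alpha>\<in>monoms_upto (2 * N). Const (lmi_coeff g k \<alpha> \<beta> \<gamma>) * xpow \<alpha>)"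
  unfolding lmi_coeff_def
proof (rule poly_eq_sum_xpow)
  have deg: "tdeg (with_one g k) \<le> 2 * half_deg g k"
    unfolding half_deg_def by linarith
  show "Poly_Mapping.keys (with_one g k * xpow \<beta> * xpow \<gamma>) \<subseteq> monoms_upto (2 * N)"
  proof
    fix \<alpha> assume \<alpha>: "\<alpha> \<in> Poly_Mapping.keys (with_one g k * xpow \<beta> * xpow \<gamma>)"
    have "with_one g k * xpow \<beta> * xpow \<gamma> = with_one g k * Poly_Mapping.single (\<beta> + \<gamma>) 1"
      by (simp add: xpow_def mult.assoc mult_single)
    with \<alpha> have "\<exists>\<delta>\<in>Poly_Mapping.keys (with_one g k). \<alpha> = \<delta> + (\<beta> + \<gamma>)"
      using keys_mult[of "with_one g k" "Poly_Mapping.single (\<beta> + \<gamma>) 1"] by auto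
    then obtain \<delta> where "\<delta> \<in> Poly_Mapping.keys (with_one g k)" "\<alpha> = \<delta> + (\<beta> + \<gamma>)"
      by blast
    moreover from this have "mdeg \<delta> \<le> 2 * half_deg g k"
      using deg mdeg_le_tdeg order_trans by blast
    ultimately show "\<alpha> \<in> monoms_upto (2 * N)"
      using assms by (simp add: monoms_upto_def mdeg_add)
  qed
qed simp

lemma peval_superset:
  assumes "finite A" "Poly_Mapping.keys p \<subseteq> A"
  shows "peval p x = (\<Sum>\<alpha>\<in>A. Poly_Mapping.lookup p \<alpha> * (\<Prod>i\<in>UNIV. (x $ i) ^ Poly_Mapping.lookup \<alpha> i))"
  unfolding peval_def using assms by (intro sum.mono_neutral_left) (auto simp: in_keys_iff)

lemma peval_add: "peval (p + q) x = peval p x + peval q x"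
proof -
  let ?A = "Poly_Mapping.keys p \<union> Poly_Mapping.keys q"
  have "Poly_Mapping.keys (p + q) \<subseteq> ?A" by (rule Poly_Mapping.keys_add)
  then show ?thesis
    by (simp add: peval_superset[of ?A] lookup_add sum.distrib algebra_simps)
qed

lemma peval_zero [simp]: "peval 0 x = 0"
  by (simp add: peval_def)

lemma peval_sum: "peval (\<Sum>a\<in>A. f a) x = (\<Sum>a\<in>A. peval (f a) x)"
  by (induction A rule: infinite_finite_induct) (simp_all add: peval_add)

lemma peval_single:
  "peval (Poly_Mapping.single \<alpha> c) x = c * (\<Prod>i\<in>UNIV. (x $ i) ^ Poly_Mapping.lookup \<alpha> i)"
  by (subst peval_superset[of "{\<alpha>}"]) (auto simp: lookup_single)

(* The formal partial derivative is the analytic one. *)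
lemma has_real_derivative_peval:
  "((\<lambda>t. peval p (x + t *\<^sub>R axis i 1)) has_real_derivative peval (partial_deriv i p) x) (at 0)"
proof -
  have mon: "((\<lambda>t. \<Prod>j\<in>UNIV. ((x + t *\<^sub>R axis i 1) $ j) ^ Poly_Mapping.lookup \<alpha> j) has_real_derivative
      real (Poly_Mapping.lookup \<alpha> i) *
        (\<Prod>j\<in>UNIV. (x $ j) ^ Poly_Mapping.lookup (\<alpha> - Poly_Mapping.single i 1) j)) (at 0)" for \<alpha>
  proof -
    let ?C = "\<Prod>j\<in>UNIV - {i}. (x $ j) ^ Poly_Mapping.lookup \<alpha> j"
    have l: "(\<Prod>j\<in>UNIV. ((x + t *\<^sub>R axis i 1) $ j) ^ Poly_Mapping.lookup \<alpha> j)
        = (x $ i + t) ^ Poly_Mapping.lookup \<alpha> i * ?C" for t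
      by (subst prod.remove[of _ i]) (auto simp: axis_def intro!: prod.cong)
    have r: "(\<Prod>j\<in>UNIV. (x $ j) ^ Poly_Mapping.lookup (\<alpha> - Poly_Mapping.single i 1) j)
        = (x $ i) ^ (Poly_Mapping.lookup \<alpha> i - 1) * ?C"
      by (subst prod.remove[of _ i]) (auto simp: lookup_minus lookup_single when_def intro!: prod.cong)
    show ?thesis
      unfolding l r by (auto intro!: derivative_eq_intros)
  qed
  show ?thesis
    unfolding partial_deriv_def peval_sum peval_single
    unfolding peval_def
    by (rule DERIV_sum) (use DERIV_cmult[OF mon] in \<open>simp add: mult_ac\<close>)
qed

end

theory Submission
  imports Defs
begin

text \<open>
  If \<open>a \<bullet> x + b\<close> is nonnegative on \<open>S\<close> and attains its minimum over \<open>S\<close> at \<open>u\<close>, then with Lagrange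
  multipliers \<open>\<nu> i\<close> it equals a nonnegative constant plus \<open>\<Sum>i. \<nu> i * (g i x + r i u x)\<close>, where
  \<open>r i u x = \<integral>\<^sub>0\<^sup>1 (1 - s) v\<^sup>T (- Hess (g i)) (u + s v) v ds\<close> with \<open>v = x - u\<close> is the Taylor remainder of
  the active constraint \<open>g i\<close> at \<open>u\<close>. So it suffices to put the remainders into the quadratic module
  with a degree bound that does not depend on \<open>u\<close>.

  If \<open>- Hess (g i)\<close> is a sum of squares, the integral of the squares is a sum of squares because its
  Gram matrix is positive semidefinite. Otherwise the matrix
  \<open>F u x = \<integral>\<^sub>0\<^sup>1 (1 - s) (- Hess (g i)) (u + s (x - u)) ds\<close> is positive definite for \<open>x \<in> S\<close> and \<open>u\<close> in a
  compact set, and one needs a uniform matrix version of Putinar's theorem. Subtracting a suitable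
  element of the quadratic module makes the form positive on a whole box; expanded in the Bernstein
  basis of the box to a high degree, it then has positive semidefinite coefficient matrices, and by
  the archimedean condition the Bernstein polynomials themselves lie in the quadratic module.

  For the lifted set, a point outside \<open>S\<close> is separated from \<open>S\<close> by an affine polynomial, whose bounded
  degree representation is mapped to a nonnegative number by the linear functional \<open>x\<^sup>\<alpha> \<mapsto> y \<alpha>\<close>.
\<close>

subsection \<open>Evaluation, degree and derivatives of polynomials\<close>

definition mval :: "'n::finite monom \<Rightarrow> real^'n \<Rightarrow> real" where
  "mval \<alpha> x = (\<Prod>i\<in>UNIV. (x $ i) ^ Poly_Mapping.lookup \<alpha> i)"

lemma mval_0 [simp]: "mval 0 x = 1"
  by (simp add: mval_def)

lemma mval_add: "mval (\<alpha> + \<beta>) x = mval \<alpha> x * mval \<beta> x"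
  by (simp add: mval_def lookup_add power_add prod.distrib)

lemma mval_single: "mval (Poly_Mapping.single i k) x = (x $ i) ^ k"
proof -
  have "mval (Poly_Mapping.single i k) x = (\<Prod>j\<in>UNIV. if j = i then (x $ i) ^ k else 1)"
    unfolding mval_def by (intro prod.cong) (auto simp: lookup_single when_def)
  then show ?thesis by simp
qed

lemma continuous_on_mval [continuous_intros]:
  "continuous_on A f \<Longrightarrow> continuous_on A (\<lambda>x. mval \<alpha> (f x))"
  unfolding mval_def by (intro continuous_intros)

lemma peval_mval: "peval p x = (\<Sum>\<alpha>\<in>Poly_Mapping.keys p. Poly_Mapping.lookup p \<alpha> * mval \<alpha> x)"
  by (simp add: peval_def mval_def)

lemma keys_subset_monoms: "tdeg p \<le> d \<Longrightarrow> Poly_Mapping.keys p \<subseteq> monoms_upto d"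
  using mdeg_le_tdeg by (force simp: monoms_upto_def)

lemma tdeg_leI: "Poly_Mapping.keys p \<subseteq> monoms_upto d \<Longrightarrow> tdeg p \<le> d"
  by (auto simp: tdeg_def monoms_upto_def)

lemma tdeg_le_iff: "tdeg p \<le> d \<longleftrightarrow> Poly_Mapping.keys p \<subseteq> monoms_upto d"
  using keys_subset_monoms tdeg_leI by blast

lemma peval_monoms_upto:
  "tdeg p \<le> d \<Longrightarrow> peval p x = (\<Sum>\<alpha>\<in>monoms_upto d. Poly_Mapping.lookup p \<alpha> * mval \<alpha> x)"
  unfolding mval_def by (rule peval_superset) (simp_all add: keys_subset_monoms)

lemma peval_single_mval: "peval (Poly_Mapping.single \<alpha> c) x = c * mval \<alpha> x"
  by (simp add: peval_single mval_def)

lemma peval_Const [simp]: "peval (Const c) x = c"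
  by (simp add: Const_def peval_single_mval)

lemma peval_Var [simp]: "peval (Var i) x = x $ i"
  by (simp add: Var_def xpow_def peval_single_mval mval_single)

lemma peval_xpow: "peval (xpow \<alpha>) x = mval \<alpha> x"
  by (simp add: xpow_def peval_single_mval)

lemma poly_single_sum: "p = (\<Sum>\<alpha>\<in>Poly_Mapping.keys p. Poly_Mapping.single \<alpha> (Poly_Mapping.lookup p \<alpha>))"
  by (rule poly_mapping_eqI) (auto simp: lookup_sum lookup_single when_def in_keys_iff)

lemma peval_mult: "peval (p * q) x = peval p x * peval q x"
proof -
  have "p * q = (\<Sum>\<alpha>\<in>Poly_Mapping.keys p. \<Sum>\<beta>\<in>Poly_Mapping.keys q.
      Poly_Mapping.single (\<alpha> + \<beta>) (Poly_Mapping.lookup p \<alpha> * Poly_Mapping.lookup q \<beta>))"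
    by (subst poly_single_sum[of p], subst poly_single_sum[of q])
      (simp add: sum_product mult_single)
  then have "peval (p * q) x = (\<Sum>\<alpha>\<in>Poly_Mapping.keys p. \<Sum>\<beta>\<in>Poly_Mapping.keys q.
      (Poly_Mapping.lookup p \<alpha> * Poly_Mapping.lookup q \<beta>) * (mval \<alpha> x * mval \<beta> x))"
    by (simp only: peval_sum peval_single_mval mval_add)
  then show ?thesis
    by (simp add: peval_mval sum_product mult_ac)
qed

lemma peval_uminus: "peval (- p) x = - peval p x"
proof -
  have "peval (- p) x + peval p x = 0" by (simp flip: peval_add)
  then show ?thesis by simp
qed

lemma peval_diff: "peval (p - q) x = peval p x - peval q x"
  using peval_add[of p "- q" x] by (simp add: peval_uminus)

lemma peval_1 [simp]: "peval 1 x = 1"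
  using peval_Const[of 1 x] by (simp add: Const_def)

lemma peval_power: "peval (p ^ k) x = peval p x ^ k"
  by (induction k) (simp_all add: peval_mult)

lemma continuous_on_peval [continuous_intros]:
  "continuous_on A f \<Longrightarrow> continuous_on A (\<lambda>x. peval p (f x))"
  unfolding peval_mval by (intro continuous_intros)

lemma tdeg_single: "tdeg (Poly_Mapping.single \<alpha> c) \<le> mdeg \<alpha>"
  by (simp add: tdeg_def)

lemma mdeg_0 [simp]: "mdeg 0 = 0"
  by (simp add: mdeg_def)

lemma tdeg_0 [simp]: "tdeg 0 = 0" and tdeg_Const [simp]: "tdeg (Const c) = 0"
  and tdeg_1 [simp]: "tdeg 1 = 0"
  using tdeg_single[of 0 c] by (simp_all add: tdeg_def Const_def)

lemma tdeg_add: "tdeg p \<le> d \<Longrightarrow> tdeg q \<le> d \<Longrightarrow> tdeg (p + q) \<le> d"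
  unfolding tdeg_le_iff using Poly_Mapping.keys_add[of p q] by blast

lemma tdeg_mult: "tdeg (p * q) \<le> tdeg p + tdeg q"
proof (rule tdeg_leI, rule subsetI)
  fix \<alpha> assume "\<alpha> \<in> Poly_Mapping.keys (p * q)"
  with keys_mult[of p q] obtain \<beta> \<gamma>
    where "\<beta> \<in> Poly_Mapping.keys p" "\<gamma> \<in> Poly_Mapping.keys q" "\<alpha> = \<beta> + \<gamma>" by blast
  then show "\<alpha> \<in> monoms_upto (tdeg p + tdeg q)"
    by (simp add: monoms_upto_def mdeg_add add_mono mdeg_le_tdeg)
qed

lemma mdeg_single [simp]: "mdeg (Poly_Mapping.single i k) = k"
proof -
  have "mdeg (Poly_Mapping.single i k) = (\<Sum>j\<in>UNIV. if j = i then k else 0)"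
    unfolding mdeg_def by (intro sum.cong) (auto simp: lookup_single when_def)
  then show ?thesis by simp
qed

lemma tdeg_Var: "tdeg (Var i) \<le> 1"
  using tdeg_single[of "Poly_Mapping.single i 1" 1] by (simp add: Var_def xpow_def)

text \<open>Monomials that contain the variable \<open>i\<close> remain distinct when its exponent
  is lowered, so at most one term of the defining sum reaches a given coefficient.\<close>

lemma lookup_partial_deriv:
  "Poly_Mapping.lookup (partial_deriv i p) \<beta>
    = real (Poly_Mapping.lookup \<beta> i + 1) * Poly_Mapping.lookup p (\<beta> + Poly_Mapping.single i 1)"
proof -
  let ?e = "Poly_Mapping.single i (1::nat)"
  \<comment> \<open>The second condition is needed because truncated subtraction leaves a monomial
    without the variable \<open>i\<close> unchanged.\<close>
  have *: "\<alpha> = \<beta> + ?e" if "\<alpha> - ?e = \<beta>" "Poly_Mapping.lookup \<alpha> i \<noteq> 0" for \<alpha>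
  proof (rule poly_mapping_eqI)
    fix j
    have "Poly_Mapping.lookup \<beta> j = Poly_Mapping.lookup \<alpha> j - Poly_Mapping.lookup ?e j"
      using that(1) by (metis lookup_minus)
    then show "Poly_Mapping.lookup \<alpha> j = Poly_Mapping.lookup (\<beta> + ?e) j"
      using that(2) by (cases "j = i") (simp_all add: lookup_add lookup_single)
  qed
  have "Poly_Mapping.lookup (partial_deriv i p) \<beta>
      = (\<Sum>\<alpha>\<in>Poly_Mapping.keys p. if \<alpha> = \<beta> + ?e
           then real (Poly_Mapping.lookup \<beta> i + 1) * Poly_Mapping.lookup p (\<beta> + ?e) else 0)"
    unfolding partial_deriv_def lookup_sum
  proof (intro sum.cong refl)
    fix \<alpha>
    show "Poly_Mapping.lookup (Poly_Mapping.single (\<alpha> - ?e)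
          (real (Poly_Mapping.lookup \<alpha> i) * Poly_Mapping.lookup p \<alpha>)) \<beta>
        = (if \<alpha> = \<beta> + ?e then real (Poly_Mapping.lookup \<beta> i + 1) * Poly_Mapping.lookup p (\<beta> + ?e) else 0)"
    proof (cases "\<alpha> = \<beta> + ?e")
      case True
      then show ?thesis by (simp add: lookup_add)
    next
      case False
      then have "\<alpha> - ?e \<noteq> \<beta> \<or> Poly_Mapping.lookup \<alpha> i = 0" using * by blast
      then show ?thesis using False by (elim disjE) (simp_all add: lookup_single_not_eq)
    qed
  qed
  then show ?thesis by (simp add: in_keys_iff)
qed

lemma tdeg_partial_deriv: "tdeg p \<le> Suc d \<Longrightarrow> tdeg (partial_deriv i p) \<le> d"
proof (rule tdeg_leI, rule subsetI)
  fix \<beta> assume p: "tdeg p \<le> Suc d" and "\<beta> \<in> Poly_Mapping.keys (partial_deriv i p)"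
  then have "\<beta> + Poly_Mapping.single i 1 \<in> Poly_Mapping.keys p"
    by (auto simp: in_keys_iff lookup_partial_deriv)
  from mdeg_le_tdeg[OF this] p show "\<beta> \<in> monoms_upto d"
    by (simp add: monoms_upto_def mdeg_add)
qed

lemma mdeg_eq_0_iff: "mdeg \<alpha> = 0 \<longleftrightarrow> \<alpha> = 0"
  by (auto simp: mdeg_def intro: poly_mapping_eqI)

lemma monom_nonzero_split:
  assumes "\<alpha> \<noteq> (0 :: 'n::finite monom)"
  obtains i \<beta> where "\<alpha> = \<beta> + Poly_Mapping.single i 1"
proof -
  obtain i where i: "Poly_Mapping.lookup \<alpha> i \<noteq> 0"
    using assms by (metis poly_mapping_eqI lookup_zero)
  have "\<alpha> = (\<alpha> - Poly_Mapping.single i 1) + Poly_Mapping.single i 1"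
    using i by (intro poly_mapping_eqI) (auto simp: lookup_add lookup_minus lookup_single when_def)
  then show thesis by (rule that)
qed

text \<open>Induction on the degree: the partial derivatives of \<open>p\<close> also vanish on
  \<open>U\<close>, hence are zero, and so \<open>p\<close> is constant.\<close>

lemma peval_zero_on_open:
  fixes p :: "'n::finite mpoly"
  assumes "open U" "U \<noteq> {}" "\<And>x. x \<in> U \<Longrightarrow> peval p x = 0"
  shows "p = 0"
  using assms
proof (induction "tdeg p" arbitrary: p rule: less_induct)
  case less
  have pd: "partial_deriv i p = 0" for i
  proof -
    have z: "peval (partial_deriv i p) x = 0" if x: "x \<in> U" for x
    proof -
      have "((\<lambda>t. x + t *\<^sub>R axis i 1) \<longlongrightarrow> x + 0 *\<^sub>R axis i 1) (at 0)"
        by (intro tendsto_intros)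
      then have "\<forall>\<^sub>F t in at 0. x + t *\<^sub>R axis i 1 \<in> U"
        using less.prems(1) x by (intro topological_tendstoD) auto
      then have "\<forall>\<^sub>F t in at 0. peval p (x + t *\<^sub>R axis i 1) = 0"
        by (rule eventually_mono) (use less.prems in auto)
      then have "((\<lambda>t. 0) has_real_derivative peval (partial_deriv i p) x) (at 0)"
        using has_field_derivative_cong_eventually[of "\<lambda>t. peval p (x + t *\<^sub>R axis i 1)" "\<lambda>t. 0" 0 UNIV]
          has_real_derivative_peval[of p x i] x less.prems(3) by simp
      moreover have "((\<lambda>t. 0) has_real_derivative 0) (at (0::real))" by simp
      ultimately show ?thesis by (rule DERIV_unique)
    qed
    show ?thesis
    proof (cases "tdeg p")
      \<comment> \<open>At degree zero there is no smaller degree to appeal to, but then no monomial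
        of \<open>p\<close> contains a variable.\<close>
      case 0
      then have "\<beta> + Poly_Mapping.single i 1 \<notin> Poly_Mapping.keys p" for \<beta>
        using mdeg_le_tdeg[of "\<beta> + Poly_Mapping.single i 1" p] by (auto simp: mdeg_add)
      then show ?thesis
        by (intro poly_mapping_eqI) (simp add: lookup_partial_deriv in_keys_iff)
    next
      case (Suc d)
      then have "tdeg (partial_deriv i p) < tdeg p" using tdeg_partial_deriv[of p d i] by simp
      then show ?thesis using less.hyps less.prems z by blast
    qed
  qed
  have nz: "Poly_Mapping.lookup p \<alpha> = 0" if "\<alpha> \<noteq> 0" for \<alpha>
  proof -
    obtain i \<beta> where "\<alpha> = \<beta> + Poly_Mapping.single i 1" using monom_nonzero_split \<open>\<alpha> \<noteq> 0\<close> .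
    then show ?thesis using lookup_partial_deriv[of i p \<beta>] pd by simp
  qed
  then have "p = Const (Poly_Mapping.lookup p 0)"
    by (intro poly_mapping_eqI) (auto simp: Const_def lookup_single when_def)
  moreover obtain x where "x \<in> U" using less.prems by blast
  ultimately have "Poly_Mapping.lookup p 0 = 0"
    using less.prems(3) peval_Const by metis
  with nz show ?case by (metis poly_mapping_eqI lookup_zero)
qed

text \<open>Allows the main argument to work with polynomial functions and to return to formal
  polynomials only at the end.\<close>

lemma peval_inject: "(\<And>x. peval p x = peval q x) \<Longrightarrow> p = q"
  using peval_zero_on_open[of UNIV "p - q"] by (simp add: peval_diff)

section \<open>Gradients, Hessian forms and Taylor's formula with integral remainder\<close>

definition grad :: "'n::finite mpoly \<Rightarrow> real^'n \<Rightarrow> real^'n" where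
  "grad p x = (\<chi> i. peval (partial_deriv i p) x)"

text \<open>Monomials are differentiable as products of coordinates. Their derivative need not be
  computed, since its values on the axes are the known partial derivatives.\<close>

lemma has_derivative_peval: "(peval p has_derivative (\<lambda>h. grad p x \<bullet> h)) (at x)"
proof -
  have "\<exists>D. (mval \<alpha> has_derivative D) (at x)" for \<alpha>
    unfolding mval_def by (rule exI) (rule derivative_intros bounded_linear.has_derivative[OF bounded_linear_vec_nth])+
  then obtain D where "\<And>\<alpha>. (mval \<alpha> has_derivative D \<alpha>) (at x)" by metis
  then have "((\<lambda>x. peval p x) has_derivative
      (\<lambda>h. \<Sum>\<alpha>\<in>Poly_Mapping.keys p. Poly_Mapping.lookup p \<alpha> * D \<alpha> h)) (at x)"
    unfolding peval_mval by (intro has_derivative_sum has_derivative_mult_right)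
  then obtain D where D: "(peval p has_derivative D) (at x)" by auto
  interpret D: bounded_linear D using D has_derivative_bounded_linear by blast
  have ax: "D (axis i 1) = peval (partial_deriv i p) x" for i
  proof -
    have "((\<lambda>t. peval p (x + t *\<^sub>R axis i 1)) has_derivative (\<lambda>t. D (t *\<^sub>R axis i 1))) (at 0)"
      by (rule has_derivative_compose[of "\<lambda>t. x + t *\<^sub>R axis i 1" "\<lambda>t. t *\<^sub>R axis i 1", simplified])
        (auto intro!: derivative_eq_intros D)
    then have "((\<lambda>t. peval p (x + t *\<^sub>R axis i 1)) has_real_derivative D (axis i 1)) (at 0)"
      by (simp add: has_field_derivative_def D.scaleR mult.commute[of _ "D _"])
    then show ?thesis using has_real_derivative_peval DERIV_unique by blast
  qed
  have "D h = grad p x \<bullet> h" for h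
  proof -
    have "D h = D (\<Sum>i\<in>UNIV. h $ i *\<^sub>R axis i 1)"
      by (rule arg_cong[of _ _ D]) (simp add: vec_eq_iff axis_def if_distrib cong: if_cong)
    also have "\<dots> = grad p x \<bullet> h"
      by (simp add: D.sum D.scaleR ax grad_def inner_vec_def mult.commute)
    finally show ?thesis .
  qed
  then have "D = (\<lambda>h. grad p x \<bullet> h)" by blast
  with D show ?thesis by simp
qed

lemma peval_line_deriv:
  "((\<lambda>s. peval p (u + s *\<^sub>R v)) has_real_derivative grad p (u + s *\<^sub>R v) \<bullet> v) (at s within A)"
proof -
  have "((\<lambda>s. peval p (u + s *\<^sub>R v)) has_derivative (\<lambda>t. grad p (u + s *\<^sub>R v) \<bullet> (t *\<^sub>R v))) (at s within A)"
    by (rule has_derivative_compose[of "\<lambda>s. u + s *\<^sub>R v" "\<lambda>t. t *\<^sub>R v"])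
      (auto intro!: derivative_eq_intros has_derivative_peval)
  then show ?thesis by (simp add: has_field_derivative_def mult.commute[of _ "grad p _ \<bullet> _"])
qed

text \<open>The quadratic form of minus the Hessian; the sign is chosen so that concavity makes it
  nonnegative.\<close>

definition hquad :: "'n::finite mpoly \<Rightarrow> real^'n \<Rightarrow> real^'n \<Rightarrow> real" where
  "hquad p x v = (\<Sum>i\<in>UNIV. \<Sum>j\<in>UNIV. v $ i * peval (- hessian p $ i $ j) x * v $ j)"

lemma hquad_pos_def: "pos_def (- meval (hessian p) x) \<Longrightarrow> v \<noteq> 0 \<Longrightarrow> hquad p x v > 0"
  by (force simp: pos_def_def hquad_def meval_def inner_vec_def matrix_vector_mult_def
      peval_uminus sum_distrib_left mult_ac sum_negf)

lemma continuous_on_hquad [continuous_intros]: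
  "continuous_on A f \<Longrightarrow> continuous_on A h \<Longrightarrow> continuous_on A (\<lambda>x. hquad p (f x) (h x))"
  unfolding hquad_def by (intro continuous_intros)

lemma grad_line_deriv:
  "((\<lambda>s. grad p (u + s *\<^sub>R v) \<bullet> v) has_real_derivative - hquad p (u + s *\<^sub>R v) v) (at s within A)"
proof -
  have "((\<lambda>s. \<Sum>j\<in>UNIV. peval (partial_deriv j p) (u + s *\<^sub>R v) * v $ j) has_real_derivative
      (\<Sum>j\<in>UNIV. (grad (partial_deriv j p) (u + s *\<^sub>R v) \<bullet> v) * v $ j)) (at s within A)"
    by (intro DERIV_sum DERIV_cmult_right peval_line_deriv)
  moreover have "(\<Sum>j\<in>UNIV. (grad (partial_deriv j p) x \<bullet> v) * v $ j) = - hquad p x v" for x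
    by (subst hquad_def, subst sum.swap)
      (simp add: grad_def inner_vec_def hessian_def peval_uminus sum_distrib_left sum_distrib_right sum_negf mult_ac)
  ultimately show ?thesis by (simp add: grad_def inner_vec_def)
qed

text \<open>Taylor's formula of order two for the restriction of \<open>p\<close> to the segment
  from \<open>u\<close> to \<open>x\<close>, with all signs reversed because \<open>hquad\<close> is
  the negated second derivative.\<close>

lemma taylor_integral:
  "((\<lambda>s. (1 - s) * hquad p (u + s *\<^sub>R (x - u)) (x - u)) has_integral
     peval p u + grad p u \<bullet> (x - u) - peval p x) {0..1}"
proof -
  define v where "v = x - u"
  define D where "D k s = (if k = 0 then peval p (u + s *\<^sub>R v)
      else if k = 1 then grad p (u + s *\<^sub>R v) \<bullet> v else - hquad p (u + s *\<^sub>R v) v)" for k :: nat and s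
  have "((\<lambda>s. ((1 - s) ^ (2 - 1) / fact (2 - 1)) *\<^sub>R D 2 s) has_integral
      D 0 1 - (\<Sum>i<2. ((1 - 0) ^ i / fact i) *\<^sub>R D i 0)) {0..1}"
  proof (rule Taylor_has_integral)
    fix k s assume "k < (2::nat)"
    then consider "k = 0" | "k = 1" by linarith
    then show "(D k has_vector_derivative D (Suc k) s) (at s within {0..1})"
    proof cases
      case 1
      then show ?thesis
        unfolding D_def using peval_line_deriv[of p u v s "{0..1}"]
        by (simp add: has_real_derivative_iff_has_vector_derivative)
    next
      case 2
      then show ?thesis
        unfolding D_def using grad_line_deriv[of p u v s "{0..1}"]
        by (simp add: has_real_derivative_iff_has_vector_derivative)
    qed
  qed (simp_all add: D_def)
  from has_integral_neg[OF this] show ?thesis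
    by (simp add: D_def v_def numeral_2_eq_2 algebra_simps)
qed

section \<open>Polynomial functions of bounded degree\<close>

definition polyf :: "nat \<Rightarrow> (real^'n::finite \<Rightarrow> real) \<Rightarrow> bool" where
  "polyf d f \<longleftrightarrow> (\<exists>p. tdeg p \<le> d \<and> f = peval p)"

lemma polyf_peval: "tdeg p \<le> d \<Longrightarrow> polyf d (peval p)"
  by (auto simp: polyf_def)

lemma polyf_mono: "polyf d f \<Longrightarrow> d \<le> e \<Longrightarrow> polyf e f"
  unfolding polyf_def using le_trans by blast

lemma polyf_const: "polyf d (\<lambda>x. c)"
  unfolding polyf_def by (rule exI[of _ "Const c"]) auto

lemma polyf_coord: "1 \<le> d \<Longrightarrow> polyf d (\<lambda>x. x $ i)"
  unfolding polyf_def using tdeg_Var[of i] by (intro exI[of _ "Var i"]) (auto intro: le_trans)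

lemma polyf_mval: "mdeg \<alpha> \<le> d \<Longrightarrow> polyf d (mval \<alpha>)"
  unfolding polyf_def using tdeg_single[of \<alpha> 1]
  by (intro exI[of _ "xpow \<alpha>"]) (auto simp: peval_single_mval fun_eq_iff xpow_def intro: le_trans)

lemma polyf_add: "polyf d f \<Longrightarrow> polyf d g \<Longrightarrow> polyf d (\<lambda>x. f x + g x)"
  unfolding polyf_def
proof (elim exE conjE)
  fix p q assume "tdeg p \<le> d" "tdeg q \<le> d" "f = peval p" "g = peval q"
  then show "\<exists>r. tdeg r \<le> d \<and> (\<lambda>x. f x + g x) = peval r"
    by (intro exI[of _ "p + q"]) (simp add: tdeg_add peval_add fun_eq_iff)
qed

lemma polyf_mult: "polyf d f \<Longrightarrow> polyf e g \<Longrightarrow> polyf (d + e) (\<lambda>x. f x * g x)"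
  unfolding polyf_def
proof (elim exE conjE)
  fix p q assume "tdeg p \<le> d" "tdeg q \<le> e" "f = peval p" "g = peval q"
  then show "\<exists>r. tdeg r \<le> d + e \<and> (\<lambda>x. f x * g x) = peval r"
    using tdeg_mult[of p q] by (intro exI[of _ "p * q"]) (auto simp: peval_mult fun_eq_iff)
qed

lemma polyf_cmult: "polyf d f \<Longrightarrow> polyf d (\<lambda>x. c * f x)"
  using polyf_mult[OF polyf_const[of 0 c]] by simp

lemma polyf_diff: "polyf d f \<Longrightarrow> polyf d g \<Longrightarrow> polyf d (\<lambda>x. f x - g x)"
  using polyf_add[of d f "\<lambda>x. (- 1) * g x"] polyf_cmult[of d g "- 1"] by simp

lemma polyf_power: "polyf d f \<Longrightarrow> polyf (k * d) (\<lambda>x. f x ^ k)"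
  by (induction k) (auto intro: polyf_const polyf_mult)

lemma polyf_sum: "(\<And>a. a \<in> A \<Longrightarrow> polyf d (f a)) \<Longrightarrow> polyf d (\<lambda>x. \<Sum>a\<in>A. f a x)"
  by (induction A rule: infinite_finite_induct) (auto intro: polyf_const polyf_add)

subsection \<open>Truncated quadratic modules\<close>

text \<open>The truncated quadratic module generated by \<open>H\<close>. The bound \<open>N\<close>
  restricts the degree of the square root \<open>w\<close>, not of the products; sums of squares
  belong to it once \<open>H\<close> contains the constant 1.\<close>

inductive qm :: "(real^'n::finite \<Rightarrow> real) set \<Rightarrow> nat \<Rightarrow> (real^'n \<Rightarrow> real) \<Rightarrow> bool"
  for H :: "(real^'n \<Rightarrow> real) set" and N :: nat where
  zero: "qm H N (\<lambda>x. 0)"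
| step: "qm H N f \<Longrightarrow> h \<in> H \<Longrightarrow> polyf N w \<Longrightarrow> qm H N (\<lambda>x. f x + (w x)\<^sup>2 * h x)"

lemma qm_add: "qm H N f \<Longrightarrow> qm H N g \<Longrightarrow> qm H N (\<lambda>x. g x + f x)"
proof (induction rule: qm.induct)
  case (step f h w)
  then show ?case using qm.step[OF step.IH] by (simp add: add.assoc)
qed simp

lemma qm_sum: "(\<And>a. a \<in> A \<Longrightarrow> qm H N (f a)) \<Longrightarrow> qm H N (\<lambda>x. \<Sum>a\<in>A. f a x)"
  by (induction A rule: infinite_finite_induct) (simp_all add: qm.zero qm_add)

lemma qm_mono: "qm H N f \<Longrightarrow> N \<le> N' \<Longrightarrow> qm H N' f"
  by (induction rule: qm.induct) (auto intro: qm.intros polyf_mono)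

lemma qm_weighted: "h \<in> H \<Longrightarrow> polyf N w \<Longrightarrow> qm H N (\<lambda>x. (w x)\<^sup>2 * h x)"
  using qm.step[OF qm.zero] by simp

lemma qm_gen: "h \<in> H \<Longrightarrow> qm H N h"
  using qm_weighted[of h H N "\<lambda>x. 1"] by (simp add: polyf_const)

lemma qm_square: "(\<lambda>x. 1) \<in> H \<Longrightarrow> polyf N w \<Longrightarrow> qm H N (\<lambda>x. (w x)\<^sup>2)"
  using qm_weighted[of "\<lambda>x. 1"] by simp

lemma qm_mult_square: "qm H N f \<Longrightarrow> polyf d w \<Longrightarrow> qm H (d + N) (\<lambda>x. (w x)\<^sup>2 * f x)"
proof (induction rule: qm.induct)
  case (step f h v)
  then have "qm H (d + N) (\<lambda>x. (w x)\<^sup>2 * f x + (w x * v x)\<^sup>2 * h x)"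
    by (intro qm.step polyf_mult) auto
  then show ?case by (simp add: algebra_simps)
qed (simp add: qm.zero)

lemma qm_scale: "qm H N f \<Longrightarrow> 0 \<le> c \<Longrightarrow> qm H N (\<lambda>x. c * f x)"
  using qm_mult_square[of H N f 0 "\<lambda>x. sqrt c"] by (simp add: polyf_const)

lemma qm_const: "(\<lambda>x. 1) \<in> H \<Longrightarrow> 0 \<le> c \<Longrightarrow> qm H N (\<lambda>x. c)"
  using qm_scale[OF qm_gen[of "\<lambda>x. 1" H]] by simp

lemma qm_polyf: "qm H N f \<Longrightarrow> (\<And>h. h \<in> H \<Longrightarrow> polyf e h) \<Longrightarrow> polyf (2 * N + e) f"
proof (induction rule: qm.induct)
  case (step f h w)
  then show ?case
    using polyf_mult[OF polyf_power[of N w 2] step.prems[OF \<open>h \<in> H\<close>]]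
    by (intro polyf_add) simp_all
qed (rule polyf_const)

text \<open>Transitivity of generation, at the cost of adding the degree bounds. It carries results
  for the ball polynomial alone over to the module of the constraints.\<close>

lemma qm_subst_gens:
  assumes "qm H N f" "\<And>h. h \<in> H \<Longrightarrow> qm H' N' h"
  shows "qm H' (N + N') f"
  using assms
proof (induction rule: qm.induct)
  case (step f h w)
  then show ?case using qm_add[OF qm_mult_square[of H' N' h N w]] by simp
qed (rule qm.zero)

text \<open>A quadratic module with a single generator is closed under multiplication, since the
  square of the generator is a square.\<close>

lemma qm_single_mult:
  fixes p :: "real^'n::finite \<Rightarrow> real"
  assumes "qm {\<lambda>x. 1, p} N f" "qm {\<lambda>x. 1, p} N' f'" "polyf e p"
  shows "qm {\<lambda>x. 1, p} (N + N' + e) (\<lambda>x. f x * f' x)"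
  using assms(1)
proof (induction rule: qm.induct)
  case (step f h w)
  have "qm {\<lambda>x. 1, p} (N' + e) (\<lambda>x. p x * f' x)"
    using assms(2)
  proof (induction rule: qm.induct)
    case (step f h w)
    have "qm {\<lambda>x. 1, p} (N' + e) (\<lambda>x. (w x)\<^sup>2 * (p x * h x))"
    proof (cases "h = p")
      case True
      \<comment> \<open>The factor \<open>p\<close> turns the generator \<open>p\<close> into
        \<open>p * p\<close>, which joins the square and raises the degree of its root by
        \<open>e\<close>.\<close>
      have "qm {\<lambda>x. 1, p} (N' + e) (\<lambda>x. (w x * p x)\<^sup>2 * 1)"
        using polyf_mult[OF step.hyps(3) assms(3)] by (intro qm_weighted) auto
      then show ?thesis by (simp add: True power_mult_distrib power2_eq_square mult_ac)
    next
      case False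
      then have "h = (\<lambda>x. 1)" using step.hyps by auto
      then show ?thesis using step.hyps(3) by (auto intro!: qm_weighted elim: polyf_mono)
    qed
    from qm_add[OF this step.IH] show ?case by (simp add: algebra_simps)
  qed (simp add: qm.zero)
  moreover have "qm {\<lambda>x. 1, p} (N' + e) f'" using assms(2) by (rule qm_mono) simp
  ultimately have "qm {\<lambda>x. 1, p} (N' + e) (\<lambda>x. h x * f' x)" using step.hyps by auto
  from qm_mult_square[OF this step.hyps(3)] step.IH
  have "qm {\<lambda>x. 1, p} (N + N' + e) (\<lambda>x. f x * f' x + (w x)\<^sup>2 * (h x * f' x))"
    by (intro qm_add) (simp_all add: add.assoc)
  then show ?case by (simp add: algebra_simps)
qed (simp add: qm.zero)

subsection \<open>Positive semidefinite forms as sums of squares\<close>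

text \<open>Induction by completing the square in one variable, as in a Cholesky decomposition; the
  remaining variables carry the Schur complement, which is again positive semidefinite.\<close>

lemma psd_form_squares_sym:
  fixes M :: "'i \<Rightarrow> 'i \<Rightarrow> real"
  assumes "finite I" "\<And>\<beta> \<gamma>. M \<beta> \<gamma> = M \<gamma> \<beta>"
    "\<And>v. (\<Sum>\<beta>\<in>I. \<Sum>\<gamma>\<in>I. v \<beta> * M \<beta> \<gamma> * v \<gamma>) \<ge> 0"
  shows "\<exists>L. \<forall>v. (\<Sum>\<beta>\<in>I. \<Sum>\<gamma>\<in>I. v \<beta> * M \<beta> \<gamma> * v \<gamma>) = (\<Sum>t\<in>I. (\<Sum>\<beta>\<in>I. L t \<beta> * v \<beta>)\<^sup>2)"
  using assms
proof (induction I arbitrary: M rule: finite_induct)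
  case (insert a I)
  define Q where "Q M v = (\<Sum>\<beta>\<in>I. \<Sum>\<gamma>\<in>I. v \<beta> * M \<beta> \<gamma> * v \<gamma>)" for M :: "'i \<Rightarrow> 'i \<Rightarrow> real" and v
  define l where "l v = (\<Sum>\<beta>\<in>I. M a \<beta> * v \<beta>)" for v
  have upd: "Q M (v(a := s)) = Q M v" "l (v(a := s)) = l v" for M v s
    unfolding Q_def l_def using insert.hyps(2) by (auto intro!: sum.cong)
  have split: "(\<Sum>\<beta>\<in>insert a I. \<Sum>\<gamma>\<in>insert a I. v \<beta> * M \<beta> \<gamma> * v \<gamma>)
      = M a a * (v a)\<^sup>2 + 2 * v a * l v + Q M v" for v
    using insert.hyps insert.prems(1)
    by (simp add: sum.distrib Q_def l_def sum_distrib_left power2_eq_square mult_ac)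
  have nonneg: "M a a * s\<^sup>2 + 2 * s * l v + Q M v \<ge> 0" for s v
    using insert.prems(2)[of "v(a := s)"] unfolding split upd by simp
  have Maa: "M a a \<ge> 0"
    using nonneg[of 1 "\<lambda>_. 0"] by (simp add: l_def Q_def)
  \<comment> \<open>The Schur complement of the pivot \<open>M a a\<close>. If the pivot is 0,
    division by zero yields 0 and \<open>M'\<close> is \<open>M\<close>.\<close>
  define M' where "M' \<beta> \<gamma> = M \<beta> \<gamma> - M a \<beta> * M a \<gamma> / M a a" for \<beta> \<gamma>
  have M': "Q M' v = Q M v - (l v)\<^sup>2 / M a a" for v
  proof -
    have "(l v)\<^sup>2 / M a a = (\<Sum>\<beta>\<in>I. \<Sum>\<gamma>\<in>I. v \<beta> * (M a \<beta> * M a \<gamma> / M a a) * v \<gamma>)"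
      by (simp add: l_def power2_eq_square sum_product sum_divide_distrib mult_ac)
    then show ?thesis
      by (simp add: Q_def M'_def algebra_simps sum_subtractf)
  qed
  have compl: "M a a * s\<^sup>2 + 2 * s * l v + Q M v = (sqrt (M a a) * s + l v / sqrt (M a a))\<^sup>2 + Q M' v" for s v
  proof (cases "M a a = 0")
    case True
    \<comment> \<open>With a zero pivot the form is affine in \<open>s\<close>; a nonzero slope
      would give the value -1 at the chosen \<open>s\<close>.\<close>
    have "l v = 0"
    proof (rule ccontr)
      assume "l v \<noteq> 0"
      then show False
        using nonneg[of "- (Q M v + 1) / (2 * l v)" v] True by (simp add: field_simps)
    qed
    then show ?thesis using True M' by simp
  next
    case False
    with Maa have "(sqrt (M a a))\<^sup>2 = M a a" "sqrt (M a a) > 0" by simp_all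
    then show ?thesis
      by (simp add: M' power2_sum power_mult_distrib power_divide)
  qed
  have "Q M' v \<ge> 0" for v
  proof (cases "M a a = 0")
    case True
    then show ?thesis using nonneg[of 0 v] M'[of v] by simp
  next
    case False
    \<comment> \<open>At \<open>- l v / M a a\<close> the completed square vanishes and only
      \<open>Q M' v\<close> remains.\<close>
    then show ?thesis
      using nonneg[of "- l v / M a a" v] unfolding compl using Maa
      by (simp add: real_div_sqrt field_simps)
  qed
  then obtain L where L: "\<And>v. Q M' v = (\<Sum>t\<in>I. (\<Sum>\<beta>\<in>I. L t \<beta> * v \<beta>)\<^sup>2)"
    using insert.IH[of M'] insert.prems(1) unfolding Q_def M'_def by (auto simp: mult.commute)
  define L' where "L' t \<beta> = (if t = a then (if \<beta> = a then sqrt (M a a) else M a \<beta> / sqrt (M a a))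
      else if \<beta> = a then 0 else L t \<beta>)" for t \<beta>
  have "(\<Sum>\<beta>\<in>insert a I. L' t \<beta> * v \<beta>) = (\<Sum>\<beta>\<in>I. L t \<beta> * v \<beta>)" if "t \<in> I" for t v
    using insert.hyps that by (auto simp: L'_def intro!: sum.cong)
  moreover have "(\<Sum>\<beta>\<in>insert a I. L' a \<beta> * v \<beta>) = sqrt (M a a) * v a + l v / sqrt (M a a)" for v
    using insert.hyps by (auto simp: L'_def l_def sum_divide_distrib intro!: sum.cong)
  ultimately have fin: "(\<Sum>t\<in>insert a I. (\<Sum>\<beta>\<in>insert a I. L' t \<beta> * v \<beta>)\<^sup>2)
      = (sqrt (M a a) * v a + l v / sqrt (M a a))\<^sup>2 + Q M' v" for v
    using insert.hyps L by simp
  show ?case by (rule exI[of _ L']) (simp add: split compl fin del: sum.insert)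
qed simp

text \<open>The form sees only the symmetric part of its matrix.\<close>

lemma psd_form_squares:
  fixes M :: "'i \<Rightarrow> 'i \<Rightarrow> real"
  assumes "finite I" "\<And>v. (\<Sum>\<beta>\<in>I. \<Sum>\<gamma>\<in>I. v \<beta> * M \<beta> \<gamma> * v \<gamma>) \<ge> 0"
  shows "\<exists>L. \<forall>v. (\<Sum>\<beta>\<in>I. \<Sum>\<gamma>\<in>I. v \<beta> * M \<beta> \<gamma> * v \<gamma>) = (\<Sum>t\<in>I. (\<Sum>\<beta>\<in>I. L t \<beta> * v \<beta>)\<^sup>2)"
proof -
  define M' where "M' \<beta> \<gamma> = (M \<beta> \<gamma> + M \<gamma> \<beta>) / 2" for \<beta> \<gamma>
  have eq: "(\<Sum>\<beta>\<in>I. \<Sum>\<gamma>\<in>I. v \<beta> * M' \<beta> \<gamma> * v \<gamma>) = (\<Sum>\<beta>\<in>I. \<Sum>\<gamma>\<in>I. v \<beta> * M \<beta> \<gamma> * v \<gamma>)" for v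
  proof -
    have "(\<Sum>\<beta>\<in>I. \<Sum>\<gamma>\<in>I. v \<beta> * M \<gamma> \<beta> * v \<gamma>) = (\<Sum>\<beta>\<in>I. \<Sum>\<gamma>\<in>I. v \<beta> * M \<beta> \<gamma> * v \<gamma>)"
      by (subst sum.swap) (simp add: mult_ac)
    moreover have "(\<Sum>\<beta>\<in>I. \<Sum>\<gamma>\<in>I. v \<beta> * M' \<beta> \<gamma> * v \<gamma>)
        = ((\<Sum>\<beta>\<in>I. \<Sum>\<gamma>\<in>I. v \<beta> * M \<beta> \<gamma> * v \<gamma>) + (\<Sum>\<beta>\<in>I. \<Sum>\<gamma>\<in>I. v \<beta> * M \<gamma> \<beta> * v \<gamma>)) / 2"
    proof -
      have "v \<beta> * M' \<beta> \<gamma> * v \<gamma> = v \<beta> * M \<beta> \<gamma> * v \<gamma> / 2 + v \<beta> * M \<gamma> \<beta> * v \<gamma> / 2" for \<beta> \<gamma>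
        by (simp add: M'_def field_simps)
      then show ?thesis
        by (simp only: sum.distrib add_divide_distrib sum_divide_distrib)
    qed
    ultimately show ?thesis by simp
  qed
  have "M' \<beta> \<gamma> = M' \<gamma> \<beta>" for \<beta> \<gamma> by (simp add: M'_def add.commute)
  from psd_form_squares_sym[of I M', OF assms(1) this] assms(2) show ?thesis
    unfolding eq by blast
qed

text \<open>The integral is a quadratic form in the monomials, so finitely many squares replace the
  integral of squares, and their degree does not depend on the coefficient functions.\<close>

lemma qm_integral_square:
  fixes c :: "'n::finite monom \<Rightarrow> real \<Rightarrow> real"
  assumes "\<And>\<alpha>. continuous_on {0..1} (c \<alpha>)" "(\<lambda>x. 1) \<in> H"
  shows "qm H d (\<lambda>x. integral {0..1} (\<lambda>s. (1 - s) * (\<Sum>\<alpha>\<in>monoms_upto d. c \<alpha> s * mval \<alpha> x)\<^sup>2))"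
proof -
  let ?I = "monoms_upto d :: 'n monom set"
  define M where "M \<alpha> \<beta> = integral {0..1} (\<lambda>s. (1 - s) * (c \<alpha> s * c \<beta> s))" for \<alpha> \<beta>
  have intg: "(\<lambda>s. (1 - s) * (c \<alpha> s * c \<beta> s)) integrable_on {0..1}" for \<alpha> \<beta>
    by (intro integrable_continuous_interval continuous_intros assms)
  \<comment> \<open>Here \<open>v\<close> is arbitrary rather than a vector of monomial values,
    since semidefiniteness must hold on all vectors.\<close>
  have form: "integral {0..1} (\<lambda>s. (1 - s) * (\<Sum>\<alpha>\<in>?I. c \<alpha> s * v \<alpha>)\<^sup>2)
      = (\<Sum>\<alpha>\<in>?I. \<Sum>\<beta>\<in>?I. v \<alpha> * M \<alpha> \<beta> * v \<beta>)" for v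
  proof -
    have "(\<lambda>s. (1 - s) * (\<Sum>\<alpha>\<in>?I. c \<alpha> s * v \<alpha>)\<^sup>2)
        = (\<lambda>s. \<Sum>\<alpha>\<in>?I. \<Sum>\<beta>\<in>?I. (v \<alpha> * v \<beta>) * ((1 - s) * (c \<alpha> s * c \<beta> s)))"
      by (rule ext) (simp add: power2_eq_square sum_product sum_distrib_left mult_ac)
    then have "integral {0..1} (\<lambda>s. (1 - s) * (\<Sum>\<alpha>\<in>?I. c \<alpha> s * v \<alpha>)\<^sup>2)
        = (\<Sum>\<alpha>\<in>?I. \<Sum>\<beta>\<in>?I. (v \<alpha> * v \<beta>) * M \<alpha> \<beta>)"
      using intg by (simp add: M_def integral_sum integrable_sum integrable_on_mult_right)
    then show ?thesis by (simp add: mult_ac)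
  qed
  have "(\<Sum>\<alpha>\<in>?I. \<Sum>\<beta>\<in>?I. v \<alpha> * M \<alpha> \<beta> * v \<beta>) \<ge> 0" for v
    unfolding form[symmetric]
    by (intro integral_nonneg integrable_continuous_interval continuous_intros assms) simp
  from psd_form_squares[OF finite_monoms_upto this] obtain L where
    L: "\<And>v. (\<Sum>\<alpha>\<in>?I. \<Sum>\<beta>\<in>?I. v \<alpha> * M \<alpha> \<beta> * v \<beta>) = (\<Sum>t\<in>?I. (\<Sum>\<alpha>\<in>?I. L t \<alpha> * v \<alpha>)\<^sup>2)"
    by blast
  show ?thesis
    unfolding form L
    by (intro qm_sum qm_square[OF assms(2)] polyf_sum polyf_cmult polyf_mval)
      (simp add: monoms_upto_def)
qed

subsection \<open>Polynomials depending continuously on a parameter\<close>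

text \<open>Continuity of the coefficients gives bounds for them that are uniform over compact sets
  of parameters.\<close>

definition pfam :: "nat \<Rightarrow> ('p::topological_space \<Rightarrow> real^'n::finite \<Rightarrow> real) \<Rightarrow> bool" where
  "pfam d f \<longleftrightarrow> (\<exists>c. (\<forall>\<alpha>. continuous_on UNIV (c \<alpha>)) \<and>
     (\<forall>t x. f t x = (\<Sum>\<alpha>\<in>monoms_upto d. c \<alpha> t * mval \<alpha> x)))"

lemma pfamE:
  assumes "pfam d f"
  obtains c where "\<And>\<alpha>. continuous_on UNIV (c \<alpha>)"
    "\<And>t x. f t x = (\<Sum>\<alpha>\<in>monoms_upto d. c \<alpha> t * mval \<alpha> x)"
  using assms by (auto simp: pfam_def)

lemma pfam_term:
  assumes "continuous_on UNIV c" "mdeg \<alpha> \<le> d"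
  shows "pfam d (\<lambda>t x. c t * mval \<alpha> x)"
proof -
  have "(\<Sum>\<beta>\<in>monoms_upto d. (if \<beta> = \<alpha> then c t else 0) * mval \<beta> x) = c t * mval \<alpha> x" for t x
  proof -
    have "(\<Sum>\<beta>\<in>monoms_upto d. (if \<beta> = \<alpha> then c t else 0) * mval \<beta> x)
        = (\<Sum>\<beta>\<in>monoms_upto d. if \<beta> = \<alpha> then c t * mval \<alpha> x else 0)"
      by (intro sum.cong) auto
    moreover have "\<alpha> \<in> monoms_upto d" using assms(2) by (simp add: monoms_upto_def)
    ultimately show ?thesis by simp
  qed
  moreover have "continuous_on UNIV (\<lambda>t. if \<beta> = \<alpha> then c t else 0)" for \<beta>
    using assms(1) by (cases "\<beta> = \<alpha>") auto
  ultimately show ?thesis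
    unfolding pfam_def by (intro exI[of _ "\<lambda>\<beta> t. if \<beta> = \<alpha> then c t else 0"]) auto
qed

lemma pfam_const: "continuous_on UNIV c \<Longrightarrow> pfam d (\<lambda>t x. c t)"
  using pfam_term[of c 0 d] by simp

lemma pfam_add: "pfam d f \<Longrightarrow> pfam d g \<Longrightarrow> pfam d (\<lambda>t x. f t x + g t x)"
proof (elim pfamE)
  fix c c' assume "\<And>\<alpha>. continuous_on UNIV (c \<alpha>)" "\<And>t x. f t x = (\<Sum>\<alpha>\<in>monoms_upto d. c \<alpha> t * mval \<alpha> x)"
    "\<And>\<alpha>. continuous_on UNIV (c' \<alpha>)" "\<And>t x. g t x = (\<Sum>\<alpha>\<in>monoms_upto d. c' \<alpha> t * mval \<alpha> x)"
  then show ?thesis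
    unfolding pfam_def
    by (intro exI[of _ "\<lambda>\<alpha> t. c \<alpha> t + c' \<alpha> t"])
      (auto intro!: continuous_intros simp: sum.distrib algebra_simps)
qed

lemma pfam_sum: "(\<And>a. a \<in> A \<Longrightarrow> pfam d (f a)) \<Longrightarrow> pfam d (\<lambda>t x. \<Sum>a\<in>A. f a t x)"
  by (induction A rule: infinite_finite_induct) (auto intro: pfam_add pfam_const)

lemma pfam_mult:
  assumes "pfam d f" "pfam e g" shows "pfam (d + e) (\<lambda>t x. f t x * g t x)"
proof -
  obtain c where c: "\<And>\<alpha>. continuous_on UNIV (c \<alpha>)" "\<And>t x. f t x = (\<Sum>\<alpha>\<in>monoms_upto d. c \<alpha> t * mval \<alpha> x)"
    using assms(1) unfolding pfam_def by blast
  obtain c' where c': "\<And>\<alpha>. continuous_on UNIV (c' \<alpha>)" "\<And>t x. g t x = (\<Sum>\<alpha>\<in>monoms_upto e. c' \<alpha> t * mval \<alpha> x)"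
    using assms(2) unfolding pfam_def by blast
  have "(\<lambda>t x. f t x * g t x)
      = (\<lambda>t x. \<Sum>\<alpha>\<in>monoms_upto d. \<Sum>\<beta>\<in>monoms_upto e. (c \<alpha> t * c' \<beta> t) * mval (\<alpha> + \<beta>) x)"
    by (simp only: c(2) c'(2) sum_product mval_add) (simp only: mult_ac)
  moreover have "pfam (d + e) (\<lambda>t x. \<Sum>\<alpha>\<in>monoms_upto d. \<Sum>\<beta>\<in>monoms_upto e. (c \<alpha> t * c' \<beta> t) * mval (\<alpha> + \<beta>) x)"
    by (intro pfam_sum pfam_term continuous_intros c(1) c'(1))
      (simp add: monoms_upto_def mdeg_add add_mono)
  ultimately show ?thesis by simp
qed

lemma pfam_mono: "pfam d f \<Longrightarrow> d \<le> e \<Longrightarrow> pfam e f"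
  using pfam_mult[of d f "e - d" "\<lambda>t x. 1"] by (simp add: pfam_const)

lemma pfam_cmult: "continuous_on UNIV c \<Longrightarrow> pfam d f \<Longrightarrow> pfam d (\<lambda>t x. c t * f t x)"
  using pfam_mult[OF pfam_const[of c 0]] by simp

lemma pfam_power: "pfam d f \<Longrightarrow> pfam (k * d) (\<lambda>t x. f t x ^ k)"
  by (induction k) (auto intro: pfam_const pfam_mult)

lemma pfam_prod: "(\<And>a. a \<in> A \<Longrightarrow> pfam (d a) (f a)) \<Longrightarrow> pfam (\<Sum>a\<in>A. d a) (\<lambda>t x. \<Prod>a\<in>A. f a t x)"
  by (induction A rule: infinite_finite_induct) (auto intro: pfam_mult pfam_const)

lemma pfam_polyf_const: "polyf d f \<Longrightarrow> pfam d (\<lambda>t. f)"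
proof -
  assume "polyf d f"
  then obtain p where "tdeg p \<le> d" "f = peval p" by (auto simp: polyf_def)
  then show ?thesis
    unfolding pfam_def by (intro exI[of _ "\<lambda>\<alpha> t. Poly_Mapping.lookup p \<alpha>"]) (auto simp: peval_monoms_upto)
qed

lemma pfam_reparam: "pfam d f \<Longrightarrow> continuous_on UNIV h \<Longrightarrow> pfam d (\<lambda>t. f (h t))"
proof (elim pfamE)
  fix c assume c: "\<And>\<alpha>. continuous_on UNIV (c \<alpha>)" "\<And>t x. f t x = (\<Sum>\<alpha>\<in>monoms_upto d. c \<alpha> t * mval \<alpha> x)"
    and h: "continuous_on UNIV h"
  have "continuous_on UNIV (\<lambda>t. c \<alpha> (h t))" for \<alpha>
    using continuous_on_compose2[OF c(1) h] by simp
  with c(2) show ?thesis unfolding pfam_def by (intro exI[of _ "\<lambda>\<alpha> t. c \<alpha> (h t)"]) auto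
qed

text \<open>Coordinates are replaced by functions of degree at most one, so no monomial gains
  degree. This covers the affine change to the unit box and the points of a segment.\<close>

lemma pfam_subst:
  assumes "pfam d f" "\<And>i. pfam 1 (l i)"
  shows "pfam d (\<lambda>t x. f t (\<chi> i. l i t x))"
proof -
  obtain c where c: "\<And>\<alpha>. continuous_on UNIV (c \<alpha>)" "\<And>t x. f t x = (\<Sum>\<alpha>\<in>monoms_upto d. c \<alpha> t * mval \<alpha> x)"
    using assms(1) unfolding pfam_def by blast
  have "pfam d (\<lambda>t x. mval \<alpha> (\<chi> i. l i t x))" if "\<alpha> \<in> monoms_upto d" for \<alpha>
  proof -
    have "pfam (\<Sum>i\<in>UNIV. Poly_Mapping.lookup \<alpha> i * 1) (\<lambda>t x. \<Prod>i\<in>UNIV. l i t x ^ Poly_Mapping.lookup \<alpha> i)"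
      by (intro pfam_prod pfam_power assms(2))
    moreover have "(\<Sum>i\<in>UNIV. Poly_Mapping.lookup \<alpha> i * 1) \<le> d"
      using that by (simp add: monoms_upto_def mdeg_def)
    ultimately show ?thesis unfolding mval_def by (simp add: pfam_mono)
  qed
  then show ?thesis unfolding c(2) by (intro pfam_sum pfam_cmult c(1))
qed

lemma continuous_on_pfam:
  assumes "pfam d f" "continuous_on A t" "continuous_on A x"
  shows "continuous_on A (\<lambda>z. f (t z) (x z))"
proof -
  obtain c where c: "\<And>\<alpha>. continuous_on UNIV (c \<alpha>)" "\<And>t x. f t x = (\<Sum>\<alpha>\<in>monoms_upto d. c \<alpha> t * mval \<alpha> x)"
    using assms(1) unfolding pfam_def by blast
  have "continuous_on A (\<lambda>z. c \<alpha> (t z))" for \<alpha>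
    by (rule continuous_on_compose2[OF c(1) assms(2)]) simp
  then show ?thesis unfolding c(2) by (intro continuous_intros assms(3))
qed

subsection \<open>Bernstein expansions on the unit box\<close>

text \<open>For \<open>j\<close> at most \<open>N\<close> this is
  \<open>(\<nu> choose j) / (N choose j)\<close>, the coefficient of \<open>y ^ j\<close> at index
  \<open>\<nu>\<close> of the Bernstein basis of degree \<open>N\<close>.\<close>

definition ffratio :: "nat \<Rightarrow> nat \<Rightarrow> nat \<Rightarrow> real" where
  "ffratio N \<nu> j = (\<Prod>i<j. (real \<nu> - real i) / (real N - real i))"

text \<open>Multiplying a Bernstein polynomial of degree \<open>M\<close> by \<open>y\<close> gives
  a multiple of the one of degree \<open>M + 1\<close> with the next index, so the induction on the
  power must let \<open>N\<close> vary.\<close>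

lemma power_Bernstein:
  "j \<le> N \<Longrightarrow> y ^ j = (\<Sum>\<nu>\<le>N. ffratio N \<nu> j * Bernstein N \<nu> y)"
proof (induction j arbitrary: N)
  case 0
  then show ?case by (simp add: ffratio_def)
next
  case (Suc j)
  then obtain M where M: "N = Suc M" "j \<le> M" by (cases N) auto
  have shift: "ffratio N (Suc \<nu>) (Suc j) = (real \<nu> + 1) / (real M + 1) * ffratio M \<nu> j" for \<nu>
    unfolding ffratio_def M(1) prod.lessThan_Suc_shift by (simp add: add.commute)
  have bern: "y * Bernstein M \<nu> y = (real \<nu> + 1) / (real M + 1) * Bernstein N (Suc \<nu>) y" for \<nu>
  proof -
    have "real (Suc \<nu>) * real (N choose Suc \<nu>) = real N * real (M choose \<nu>)"
      unfolding M(1) using arg_cong[OF Suc_times_binomial_eq[of M \<nu>], of real]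
      by (simp only: of_nat_mult mult.commute)
    then have "real (M choose \<nu>) = (real \<nu> + 1) / (real M + 1) * real (N choose Suc \<nu>)"
      by (simp add: M(1) field_simps del: binomial_Suc_Suc)
    then show ?thesis by (simp add: Bernstein_def M(1) del: binomial_Suc_Suc)
  qed
  have "y ^ Suc j = (\<Sum>\<nu>\<le>M. ffratio M \<nu> j * (y * Bernstein M \<nu> y))"
    using Suc.IH[OF M(2)] by (simp add: sum_distrib_left mult_ac)
  also have "\<dots> = (\<Sum>\<nu>\<le>M. ffratio N (Suc \<nu>) (Suc j) * Bernstein N (Suc \<nu>) y)"
    unfolding bern shift by (simp add: mult_ac)
  also have "\<dots> = (\<Sum>\<nu>\<le>N. ffratio N \<nu> (Suc j) * Bernstein N \<nu> y)"
  proof -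
    \<comment> \<open>The shifted sum starts at index 1; the coefficient at index 0 vanishes because
      its first factor does.\<close>
    have "ffratio N 0 (Suc j) = 0" unfolding ffratio_def prod.lessThan_Suc_shift by simp
    then show ?thesis unfolding M(1) sum.atMost_Suc_shift by simp
  qed
  finally show ?case .
qed

text \<open>The factors have absolute value at most 1, so replacing each of them by
  \<open>\<nu> / N\<close> changes the product by at most the sum of the changes, each of which is
  at most \<open>d / (N - d)\<close>.\<close>

lemma ffratio_bounds:
  assumes "2 * d < N" "\<nu> \<le> N" "j \<le> d"
  shows "\<bar>ffratio N \<nu> j\<bar> \<le> 1" "\<bar>ffratio N \<nu> j - (real \<nu> / real N) ^ j\<bar> \<le> (real d)\<^sup>2 / (real N - real d)"
proof -
  have le1: "\<bar>(real \<nu> - real i) / (real N - real i)\<bar> \<le> 1" if "i < j" for i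
  proof -
    \<comment> \<open>This covers negative numerators: for \<open>\<nu> < i\<close> their absolute
      value is at most \<open>i\<close>, which is less than \<open>N - i\<close>.\<close>
    have "2 * i < N" using that assms by linarith
    then show ?thesis using assms(2) by (simp add: abs_le_iff field_simps)
  qed
  then have "norm (\<Prod>i<j. (real \<nu> - real i) / (real N - real i)) \<le> (\<Prod>i<j. 1)"
    unfolding prod_norm[symmetric] by (intro prod_mono) auto
  then show "\<bar>ffratio N \<nu> j\<bar> \<le> 1" by (simp add: ffratio_def)
  have "norm ((\<Prod>i<j. (real \<nu> - real i) / (real N - real i)) - (\<Prod>i<j. real \<nu> / real N))
      \<le> (\<Sum>i<j. norm ((real \<nu> - real i) / (real N - real i) - real \<nu> / real N))"
    using le1 assms by (intro norm_prod_diff) auto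
  also have "\<dots> \<le> (\<Sum>i<j. real d / (real N - real d))"
  proof (rule sum_mono)
    fix i assume "i \<in> {..<j}"
    then have i: "2 * i < N" "i \<le> d" "0 < real N - real d" "real N - real d \<le> real N - real i"
      using assms by auto
    have "(real \<nu> - real i) / (real N - real i) - real \<nu> / real N
        = - (real i / (real N - real i)) * ((real N - real \<nu>) / real N)"
      using i by (simp add: field_simps)
    then have "norm ((real \<nu> - real i) / (real N - real i) - real \<nu> / real N)
        = (real i / (real N - real i)) * ((real N - real \<nu>) / real N)"
      using i assms by (simp add: abs_mult)
    also have "\<dots> \<le> (real d / (real N - real d)) * 1"
      using i assms by (intro mult_mono frac_le) auto
    finally show "norm ((real \<nu> - real i) / (real N - real i) - real \<nu> / real N) \<le> real d / (real N - real d)"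
      by simp
  qed
  also have "\<dots> \<le> real d * (real d / (real N - real d))"
    using assms by (simp add: mult_right_mono divide_right_mono)
  finally show "\<bar>ffratio N \<nu> j - (real \<nu> / real N) ^ j\<bar> \<le> (real d)\<^sup>2 / (real N - real d)"
    by (simp add: ffratio_def power2_eq_square)
qed

definition bprod :: "nat \<Rightarrow> ('n \<Rightarrow> nat) \<Rightarrow> real^'n::finite \<Rightarrow> real" where
  "bprod N \<nu> y = (\<Prod>i\<in>UNIV. Bernstein N (\<nu> i) (y $ i))"

text \<open>The coordinates of a monomial in the tensor product Bernstein basis
  \<open>bprod N\<close>.\<close>

definition bcoef :: "nat \<Rightarrow> ('n::finite \<Rightarrow> nat) \<Rightarrow> 'n monom \<Rightarrow> real" where
  "bcoef N \<nu> \<alpha> = (\<Prod>i\<in>UNIV. ffratio N (\<nu> i) (Poly_Mapping.lookup \<alpha> i))"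

lemma lookup_le_mdeg: "Poly_Mapping.lookup \<alpha> i \<le> mdeg \<alpha>"
  unfolding mdeg_def by (rule member_le_sum) auto

lemma mval_bprod:
  assumes "mdeg \<alpha> \<le> N"
  shows "mval \<alpha> y = (\<Sum>\<nu>\<in>UNIV \<rightarrow>\<^sub>E {..N}. bcoef N \<nu> \<alpha> * bprod N \<nu> y)"
proof -
  have "mval \<alpha> y = (\<Prod>i\<in>UNIV. \<Sum>\<nu>\<le>N. ffratio N \<nu> (Poly_Mapping.lookup \<alpha> i) * Bernstein N \<nu> (y $ i))"
    unfolding mval_def
    by (intro prod.cong refl power_Bernstein) (use assms lookup_le_mdeg le_trans in blast)
  also have "\<dots> = (\<Sum>\<nu>\<in>UNIV \<rightarrow>\<^sub>E {..N}. bcoef N \<nu> \<alpha> * bprod N \<nu> y)"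
    by (subst prod_sum_PiE) (auto simp: bcoef_def bprod_def prod.distrib)
  finally show ?thesis .
qed

text \<open>For bounded degree the Bernstein coefficients differ from the values at the grid points
  by an error of order \<open>1 / N\<close>, uniformly in the grid point.\<close>

lemma bcoef_near:
  assumes "2 * d < N" "\<nu> \<in> (UNIV :: 'n::finite set) \<rightarrow>\<^sub>E {..N}" "mdeg \<alpha> \<le> d"
  shows "\<bar>bcoef N \<nu> \<alpha> - mval \<alpha> (\<chi> i. real (\<nu> i) / real N)\<bar>
    \<le> real CARD('n) * ((real d)\<^sup>2 / (real N - real d))"
proof -
  have \<nu>: "\<nu> i \<le> N" for i using assms(2) by auto
  have l: "Poly_Mapping.lookup \<alpha> i \<le> d" for i using lookup_le_mdeg assms(3) le_trans by blast
  have "norm (bcoef N \<nu> \<alpha> - mval \<alpha> (\<chi> i. real (\<nu> i) / real N))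
      \<le> (\<Sum>i\<in>UNIV. norm (ffratio N (\<nu> i) (Poly_Mapping.lookup \<alpha> i)
            - (real (\<nu> i) / real N) ^ Poly_Mapping.lookup \<alpha> i))"
    unfolding bcoef_def mval_def vec_lambda_beta
  proof (rule norm_prod_diff)
    fix i
    show "norm (ffratio N (\<nu> i) (Poly_Mapping.lookup \<alpha> i)) \<le> 1"
      using ffratio_bounds(1)[OF assms(1) \<nu> l] by simp
    show "norm ((real (\<nu> i) / real N) ^ Poly_Mapping.lookup \<alpha> i) \<le> 1"
      unfolding norm_power using \<nu>[of i] assms(1) by (intro power_le_one) auto
  qed
  also have "\<dots> \<le> (\<Sum>i\<in>(UNIV::'n set). (real d)\<^sup>2 / (real N - real d))"
    using ffratio_bounds(2)[OF assms(1) \<nu> l] by (intro sum_mono) simp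
  finally show ?thesis by simp
qed

text \<open>The values at the grid points are at least \<open>\<eta>\<close>, and for large
  \<open>N\<close> the coefficients are close enough to them. The order of quantifiers matters:
  \<open>N\<close> depends only on \<open>\<eta>\<close>, \<open>d\<close> and \<open>C\<close>, not
  on the polynomial.\<close>

lemma Bernstein_coefficients_nonneg:
  assumes "\<eta> > 0"
  obtains N where "2 * d < N"
    "\<And>(c :: 'n::finite monom \<Rightarrow> real) \<nu>. \<lbrakk>\<And>\<alpha>. \<alpha> \<in> monoms_upto d \<Longrightarrow> \<bar>c \<alpha>\<bar> \<le> C;
      \<And>y. y \<in> cbox 0 1 \<Longrightarrow> (\<Sum>\<alpha>\<in>monoms_upto d. c \<alpha> * mval \<alpha> y) \<ge> \<eta>;
      \<nu> \<in> UNIV \<rightarrow>\<^sub>E {..N}\<rbrakk> \<Longrightarrow> (\<Sum>\<alpha>\<in>monoms_upto d. c \<alpha> * bcoef N \<nu> \<alpha>) \<ge> 0"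
proof -
  let ?I = "monoms_upto d :: 'n monom set"
  define E where "E N = real CARD('n) * ((real d)\<^sup>2 / (real N - real d))" for N
  \<comment> \<open>\<open>A / (N - d)\<close> is the total error of all terms when the coefficients
    are bounded by \<open>C\<close>.\<close>
  define A where "A = real (card ?I) * \<bar>C\<bar> * (real CARD('n) * (real d)\<^sup>2)"
  obtain N where N: "real N > real (2 * d) + A / \<eta>" using reals_Archimedean2 by blast
  have A0: "A \<ge> 0" by (simp add: A_def)
  then have dN: "2 * d < N" using N assms by (smt (verit) divide_nonneg_pos of_nat_less_iff)
  have "A / \<eta> < real N - real d" using N by simp
  then have AN: "A / (real N - real d) \<le> \<eta>"
    using dN assms by (simp add: field_simps)
  have "(\<Sum>\<alpha>\<in>?I. c \<alpha> * bcoef N \<nu> \<alpha>) \<ge> 0"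
    if c: "\<And>\<alpha>. \<alpha> \<in> ?I \<Longrightarrow> \<bar>c \<alpha>\<bar> \<le> C" and
      pos: "\<And>y. y \<in> cbox 0 1 \<Longrightarrow> (\<Sum>\<alpha>\<in>?I. c \<alpha> * mval \<alpha> y) \<ge> \<eta>" and
      \<nu>: "\<nu> \<in> UNIV \<rightarrow>\<^sub>E {..N}" for c :: "'n monom \<Rightarrow> real" and \<nu>
  proof -
    define y :: "real^'n" where "y = (\<chi> i. real (\<nu> i) / real N)"
    have "\<nu> i \<le> N" for i using \<nu> by auto
    then have "y \<in> cbox 0 1" using dN by (auto simp: y_def mem_box_cart)
    then have "\<eta> \<le> (\<Sum>\<alpha>\<in>?I. c \<alpha> * mval \<alpha> y)" by (rule pos)
    moreover have "(\<Sum>\<alpha>\<in>?I. c \<alpha> * mval \<alpha> y) - (\<Sum>\<alpha>\<in>?I. c \<alpha> * bcoef N \<nu> \<alpha>) \<le> A / (real N - real d)"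
    proof -
      have "(\<Sum>\<alpha>\<in>?I. c \<alpha> * mval \<alpha> y) - (\<Sum>\<alpha>\<in>?I. c \<alpha> * bcoef N \<nu> \<alpha>)
          = (\<Sum>\<alpha>\<in>?I. c \<alpha> * (mval \<alpha> y - bcoef N \<nu> \<alpha>))"
        by (simp add: algebra_simps sum_subtractf)
      also have "\<dots> \<le> (\<Sum>\<alpha>\<in>?I. \<bar>C\<bar> * E N)"
      proof (rule sum_mono)
        fix \<alpha> assume \<alpha>: "\<alpha> \<in> ?I"
        have "\<bar>mval \<alpha> y - bcoef N \<nu> \<alpha>\<bar> \<le> E N"
          using bcoef_near[OF dN \<nu>, of \<alpha>] \<alpha> by (simp add: E_def y_def monoms_upto_def abs_minus_commute)
        moreover have "\<bar>c \<alpha>\<bar> \<le> \<bar>C\<bar>" using c[OF \<alpha>] by simp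
        ultimately have "\<bar>c \<alpha>\<bar> * \<bar>mval \<alpha> y - bcoef N \<nu> \<alpha>\<bar> \<le> \<bar>C\<bar> * E N"
          by (intro mult_mono) auto
        then show "c \<alpha> * (mval \<alpha> y - bcoef N \<nu> \<alpha>) \<le> \<bar>C\<bar> * E N"
          by (simp flip: abs_mult)
      qed
      also have "\<dots> = A / (real N - real d)" by (simp add: A_def E_def)
      finally show ?thesis .
    qed
    ultimately show ?thesis using AN by linarith
  qed
  with dN that show thesis by blast
qed

subsection \<open>The archimedean quadratic module\<close>

definition gens :: "nat \<Rightarrow> (nat \<Rightarrow> 'n::finite mpoly) \<Rightarrow> (real^'n \<Rightarrow> real) set" where
  "gens m g = (\<lambda>k. peval (with_one g k)) ` {..m}"

lemma one_in_gens [simp]: "(\<lambda>x. 1) \<in> gens m g"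
  unfolding gens_def by (rule image_eqI[of _ _ 0]) (auto simp: with_one_def fun_eq_iff)

lemma g_in_gens: "k \<in> {1..m} \<Longrightarrow> peval (g k) \<in> gens m g"
  unfolding gens_def by (rule image_eqI[of _ _ k]) (auto simp: with_one_def)

lemma gens_polyf: "\<exists>e. \<forall>h\<in>gens m g. polyf e h"
proof -
  have "polyf (\<Sum>k\<le>m. tdeg (with_one g k)) (peval (with_one g k))" if "k \<le> m" for k
    using that by (intro polyf_peval member_le_sum) auto
  then show ?thesis by (auto simp: gens_def)
qed

lemma qm_uniform:
  assumes "finite A" "\<And>a. a \<in> A \<Longrightarrow> \<exists>N. qm H N (f a)"
  shows "\<exists>N. \<forall>a\<in>A. qm H N (f a)"
proof -
  obtain N where N: "\<And>a. a \<in> A \<Longrightarrow> qm H (N a) (f a)" using assms(2) by metis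
  have "qm H (\<Sum>a\<in>A. N a) (f a)" if "a \<in> A" for a
    using N[OF that] by (rule qm_mono) (use that assms(1) in \<open>auto intro: member_le_sum\<close>)
  then show ?thesis by blast
qed

lemma archimedean_ball:
  fixes g :: "nat \<Rightarrow> 'n::finite mpoly"
  assumes "archimedean m g"
  obtains R N where "R > 0" "qm (gens m g) N (\<lambda>x. R - (\<Sum>i\<in>UNIV. (x $ i)\<^sup>2))"
proof -
  obtain s R where R: "R > 0" and s: "\<And>k. k \<le> m \<Longrightarrow> sos (s k)"
    and eq: "Const R - (\<Sum>i\<in>UNIV. Var i ^ 2) = (\<Sum>k\<le>m. s k * with_one g k)"
    using assms by (auto simp: archimedean_def)
  have "\<exists>N. qm (gens m g) N (\<lambda>x. peval (s k) x * peval (with_one g k) x)" if k: "k \<in> {..m}" for k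
  proof -
    obtain l :: nat and w where w: "s k = (\<Sum>j<l. w j * w j)" using s[of k] k unfolding sos_iff by auto
    have "qm (gens m g) (\<Sum>j<l. tdeg (w j)) (\<lambda>x. \<Sum>j<l. (peval (w j) x)\<^sup>2 * peval (with_one g k) x)"
      using k by (intro qm_sum qm_weighted polyf_peval member_le_sum) (auto simp: gens_def)
    then show ?thesis
      by (intro exI[of _ "\<Sum>j<l. tdeg (w j)"])
        (simp add: w peval_sum peval_mult sum_distrib_right power2_eq_square)
  qed
  then have "\<exists>N. \<forall>k\<in>{..m}. qm (gens m g) N (\<lambda>x. peval (s k) x * peval (with_one g k) x)"
    by (intro qm_uniform) auto
  then obtain N where "\<And>k. k \<in> {..m} \<Longrightarrow> qm (gens m g) N (\<lambda>x. peval (s k) x * peval (with_one g k) x)"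
    by blast
  then have "qm (gens m g) N (\<lambda>x. \<Sum>k\<le>m. peval (s k) x * peval (with_one g k) x)"
    by (intro qm_sum) auto
  moreover have "(\<Sum>k\<le>m. peval (s k) x * peval (with_one g k) x) = R - (\<Sum>i\<in>UNIV. (x $ i)\<^sup>2)" for x
    using arg_cong[OF eq, of "\<lambda>p. peval p x"] by (simp add: peval_diff peval_sum peval_mult peval_power)
  ultimately show thesis using R that by simp
qed

text \<open>Since \<open>\<sigma>\<close> is 1 or -1, the function is half the sum of
  \<open>(1 + \<sigma> * x $ i)\<^sup>2\<close>, \<open>p x\<close> and the squares of the other
  coordinates.\<close>

lemma qm_coordinate_bound:
  fixes p :: "real^'n::finite \<Rightarrow> real"
  assumes "p = (\<lambda>x. R - (\<Sum>i\<in>UNIV. (x $ i)\<^sup>2))" "\<sigma>\<^sup>2 = 1"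
  shows "qm {\<lambda>x. 1, p} 1 (\<lambda>x. (R + 1) / 2 + \<sigma> * x $ i)"
proof -
  have "qm {\<lambda>x. 1, p} 1 (\<lambda>x. (1 / 2) * ((1 + \<sigma> * x $ i)\<^sup>2 + (p x + (\<Sum>j\<in>UNIV - {i}. (x $ j)\<^sup>2))))"
    by (intro qm_scale qm_add[where f = "\<lambda>x. p x + _ x"] qm_add[where g = p] qm_sum qm_square qm_gen
        polyf_add polyf_const polyf_cmult polyf_coord) auto
  moreover have "(1 / 2) * ((1 + \<sigma> * x $ i)\<^sup>2 + (p x + (\<Sum>j\<in>UNIV - {i}. (x $ j)\<^sup>2))) = (R + 1) / 2 + \<sigma> * x $ i" for x
  proof -
    have "(\<Sum>i\<in>UNIV. (x $ i)\<^sup>2) = (x $ i)\<^sup>2 + (\<Sum>j\<in>UNIV - {i}. (x $ j)\<^sup>2)"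
      by (rule sum.remove) auto
    then show ?thesis using assms by (simp add: power2_sum power_mult_distrib field_simps)
  qed
  ultimately show ?thesis by (simp only:)
qed

lemma qm_single_prod:
  assumes "finite A" "\<And>a. a \<in> A \<Longrightarrow> \<exists>N. qm {\<lambda>x. 1, p} N (f a)" "polyf e p"
  shows "\<exists>N. qm {\<lambda>x. 1, p} N (\<lambda>x. \<Prod>a\<in>A. f a x)"
  using assms(1,2)
proof (induction A rule: finite_induct)
  case empty
  then show ?case by (auto intro!: exI qm_gen)
next
  case (insert a A)
  then show ?case using qm_single_mult[OF _ _ assms(3)] by fastforce
qed

text \<open>The factors of a Bernstein polynomial of the box with sides from \<open>- L\<close> to
  \<open>L\<close> lie in the module of the ball polynomial alone. Having one generator, that module
  is closed under products, and the archimedean condition places it inside the module of the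
  constraints.\<close>

lemma bprod_in_qm:
  fixes g :: "nat \<Rightarrow> 'n::finite mpoly"
  assumes "archimedean m g"
  obtains L where "L > 0"
    "\<And>K \<nu>. \<exists>N. qm (gens m g) N (\<lambda>x. bprod K \<nu> (\<chi> i. (x $ i + L) / (2 * L)))"
proof -
  obtain R N0 where R: "R > 0" "qm (gens m g) N0 (\<lambda>x. R - (\<Sum>i\<in>UNIV. (x $ i)\<^sup>2))"
    using archimedean_ball[OF assms] .
  define p where "p = (\<lambda>x::real^'n. R - (\<Sum>i\<in>UNIV. (x $ i)\<^sup>2))"
  \<comment> \<open>The bound on every coordinate provided by
    \<open>qm_coordinate_bound\<close>.\<close>
  define L where "L = (R + 1) / 2"
  have L: "L > 0" using R by (simp add: L_def)
  have pp: "polyf (2 * 1) p"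
    unfolding p_def by (intro polyf_diff polyf_const polyf_sum polyf_power polyf_coord) simp
  have coord: "qm {\<lambda>x. 1, p} 1 (\<lambda>x. 1 / (2 * L) * (L + \<sigma> * x $ i))" if "\<sigma>\<^sup>2 = 1" for i \<sigma>
    using qm_scale[OF qm_coordinate_bound[OF p_def that], of "1 / (2 * L)"] L unfolding L_def by simp
  have up: "qm {\<lambda>x. 1, p} 1 (\<lambda>x. (x $ i + L) / (2 * L))" for i
    using coord[of 1 i] by (simp add: add.commute)
  have down: "qm {\<lambda>x. 1, p} 1 (\<lambda>x. 1 - (x $ i + L) / (2 * L))" for i
  proof -
    have "1 / (2 * L) * (L + (- 1) * t) = 1 - (t + L) / (2 * L)" for t :: real
      using L by (simp add: field_simps)
    then show ?thesis using coord[of "- 1" i] by (simp only:) simp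
  qed
  have pow: "\<exists>N. qm {\<lambda>x. 1, p} N (\<lambda>x. f x ^ k)" if "qm {\<lambda>x. 1, p} 1 f" for f k
    using qm_single_prod[of "{..<k}" p "\<lambda>_. f"] that pp by auto
  have bern: "\<exists>N. qm {\<lambda>x. 1, p} N (\<lambda>x. Bernstein K k ((x $ i + L) / (2 * L)))" for K k i
  proof -
    obtain N1 N2 where
      "qm {\<lambda>x. 1, p} N1 (\<lambda>x. ((x $ i + L) / (2 * L)) ^ k)"
      "qm {\<lambda>x. 1, p} N2 (\<lambda>x. (1 - (x $ i + L) / (2 * L)) ^ (K - k))"
      using pow[OF up] pow[OF down] by blast
    from qm_scale[OF qm_single_mult[OF this pp], of "real (K choose k)"]
    show ?thesis unfolding Bernstein_def by (auto simp: mult.assoc)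
  qed
  have "\<exists>N. qm (gens m g) N (\<lambda>x. bprod K \<nu> (\<chi> i. (x $ i + L) / (2 * L)))" for K \<nu>
  proof -
    have "\<exists>N. qm {\<lambda>x. 1, p} N (\<lambda>x. \<Prod>i\<in>UNIV. Bernstein K (\<nu> i) ((x $ i + L) / (2 * L)))"
      by (rule qm_single_prod[OF _ _ pp]) (use bern in auto)
    then obtain N where "qm {\<lambda>x. 1, p} N (\<lambda>x. \<Prod>i\<in>UNIV. Bernstein K (\<nu> i) ((x $ i + L) / (2 * L)))"
      by blast
    then have "qm (gens m g) (N + N0) (\<lambda>x. \<Prod>i\<in>UNIV. Bernstein K (\<nu> i) ((x $ i + L) / (2 * L)))"
      by (rule qm_subst_gens) (use R(2) in \<open>auto simp: p_def intro: qm_gen\<close>)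
    then show ?thesis by (auto simp: bprod_def)
  qed
  with L that show thesis by blast
qed

section \<open>Extending positivity from the semialgebraic set to a compact set\<close>

lemma penalty_upper:
  fixes t :: real
  assumes "-1 \<le> t" "t \<le> 1" "n > 0" "even n"
  shows "t * (1 - t) ^ n \<le> 1 / n"
proof (cases "t \<ge> 0")
  case True
  have "n * (t * (1 - t) ^ n) \<le> (1 + n * t) * (1 - t) ^ n"
    using assms by (simp add: algebra_simps)
  \<comment> \<open>Bernoulli's inequality replaces \<open>1 + n * t\<close> by
    \<open>(1 + t) ^ n\<close>, which combines with the other power to
    \<open>(1 - t\<^sup>2) ^ n\<close>.\<close>
  also have "\<dots> \<le> (1 + t) ^ n * (1 - t) ^ n"
    using Bernoulli_inequality[of t n] assms by (intro mult_right_mono) auto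
  also have "\<dots> = (1 - t\<^sup>2) ^ n" by (simp add: power_mult_distrib[symmetric] power2_eq_square algebra_simps)
  also have "\<dots> \<le> 1" using assms True by (intro power_le_one) (auto simp: abs_square_le_1)
  finally show ?thesis using assms by (simp add: field_simps)
next
  case False
  then have "t * (1 - t) ^ n \<le> 0" by (simp add: mult_nonpos_nonneg)
  then show ?thesis using assms by (smt (verit) divide_nonneg_nonneg of_nat_0_le_iff)
qed

text \<open>By Bernoulli's inequality for \<open>1 + \<mu>\<close>, the penalty of a violated
  constraint grows at least linearly in \<open>n\<close>.\<close>

lemma penalty_lower:
  fixes t :: real
  assumes "t \<le> - \<mu>" "\<mu> \<ge> 0"
  shows "t * (1 - t) ^ n \<le> - (n * \<mu>\<^sup>2)"
proof -
  have "1 + n * \<mu> \<le> (1 + \<mu>) ^ n" using Bernoulli_inequality[of \<mu> n] assms by simp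
  also have "\<dots> \<le> (1 - t) ^ n" using assms by (intro power_mono) auto
  finally have "\<mu> * (1 + n * \<mu>) \<le> - t * (1 - t) ^ n" using assms by (intro mult_mono) auto
  moreover have "n * \<mu>\<^sup>2 \<le> \<mu> * (1 + n * \<mu>)" using assms by (simp add: power2_eq_square algebra_simps)
  ultimately show ?thesis by linarith
qed

text \<open>The functions \<open>g (1 - g)\<^sup>2\<^sup>J\<close> (with \<open>g\<close> scaled to \<open>\<bar>g\<bar> \<le> 1\<close>) are small where \<open>g\<close> is
  nonnegative and very negative where \<open>g\<close> is; subtracting them extends positivity from the
  semialgebraic set to a whole compact set.\<close>

lemma positive_after_penalty:
  fixes g :: "nat \<Rightarrow> 'n::finite mpoly" and f :: "'t::topological_space \<Rightarrow> real^'n \<Rightarrow> real"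
  assumes K: "compact K" and B: "compact B" and f: "continuous_on (K \<times> B) (\<lambda>(t, x). f t x)"
    and pos: "\<And>t x. t \<in> K \<Longrightarrow> x \<in> B \<Longrightarrow> x \<in> semialg_set m g \<Longrightarrow> f t x > 0"
  obtains q N \<eta> where "qm (gens m g) N q" "\<eta> > 0" "\<And>t x. t \<in> K \<Longrightarrow> x \<in> B \<Longrightarrow> f t x - q x \<ge> \<eta>"
proof (cases "K \<times> B = {}")
  case True
  then show thesis by (intro that[of 0 "\<lambda>x. 0" 1] qm.zero) auto
next
  case False
  have KB: "compact (K \<times> B)" using K B by (rule compact_Times)
  obtain M where M: "\<And>t x. t \<in> K \<Longrightarrow> x \<in> B \<Longrightarrow> \<bar>f t x\<bar> \<le> M"
    using compact_imp_bounded[OF compact_continuous_image[OF f KB]]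
    by (fastforce simp: bounded_iff)
  have "\<exists>G. \<forall>x\<in>B. \<bar>peval (g k) x\<bar> \<le> G" for k
    using compact_imp_bounded[OF compact_continuous_image[OF _ B, of "peval (g k)"]]
      continuous_on_peval[OF continuous_on_id, of B "g k"]
    by (fastforce simp: bounded_iff)
  then obtain G0 where G0: "\<And>k x. x \<in> B \<Longrightarrow> \<bar>peval (g k) x\<bar> \<le> G0 k" by metis
  \<comment> \<open>A common bound for all constraints on \<open>B\<close>; the summand 1 makes it
    positive in every case.\<close>
  define G where "G = 1 + (\<Sum>k=1..m. \<bar>G0 k\<bar>)"
  have Gp: "G > 0" by (simp add: G_def sum_nonneg add_pos_nonneg)
  define h where "h k x = peval (g k) x / G" for k x
  have h1: "\<bar>h k x\<bar> \<le> 1" if "k \<in> {1..m}" "x \<in> B" for k x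
  proof -
    have "\<bar>peval (g k) x\<bar> \<le> \<bar>G0 k\<bar>" using G0[OF that(2), of k] by linarith
    also have "\<dots> \<le> G" unfolding G_def using member_le_sum[of k "{1..m}" "\<lambda>k. \<bar>G0 k\<bar>"] that(1) by simp
    finally show ?thesis using Gp by (simp add: h_def abs_le_iff field_simps)
  qed
  \<comment> \<open>Positive on all of \<open>K \<times> B\<close>: on the semialgebraic set by the
    first term, elsewhere by a violated constraint. Its minimum \<open>\<epsilon>\<close> over this
    compact set is therefore positive.\<close>
  define \<phi> where "\<phi> z = max (f (fst z) (snd z)) 0 + (\<Sum>k=1..m. max (- h k (snd z)) 0)" for z
  have "continuous_on (K \<times> B) \<phi>"
    unfolding \<phi>_def h_def using f Gp
    by (intro continuous_intros) (auto simp: case_prod_unfold)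
  then obtain z0 where z0: "z0 \<in> K \<times> B" "\<And>z. z \<in> K \<times> B \<Longrightarrow> \<phi> z0 \<le> \<phi> z"
    using continuous_attains_inf[OF KB False] by blast
  define \<epsilon> where "\<epsilon> = \<phi> z0"
  have \<epsilon>: "\<epsilon> > 0"
  proof (cases "snd z0 \<in> semialg_set m g")
    case True
    then have "f (fst z0) (snd z0) > 0" using pos z0(1) by auto
    then show ?thesis unfolding \<epsilon>_def \<phi>_def by (intro add_pos_nonneg sum_nonneg) auto
  next
    case False
    then obtain k where k: "k \<in> {1..m}" "peval (g k) (snd z0) < 0" by (auto simp: semialg_set_def not_le)
    then have "max (- h k (snd z0)) 0 > 0" using Gp by (simp add: h_def divide_neg_pos)
    also have "max (- h k (snd z0)) 0 \<le> (\<Sum>k=1..m. max (- h k (snd z0)) 0)"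
      using k(1) by (intro member_le_sum) auto
    finally show ?thesis unfolding \<epsilon>_def \<phi>_def by (intro add_nonneg_pos) auto
  qed
  \<comment> \<open>If every \<open>h k x\<close> is at least \<open>- \<mu>\<close>, the violations
    add up to at most \<open>\<epsilon> / 2\<close>; so where \<open>f\<close> is below
    \<open>\<epsilon> / 2\<close>, some constraint is violated by more than
    \<open>\<mu>\<close>.\<close>
  define \<mu> where "\<mu> = \<epsilon> / (2 * (real m + 1))"
  have \<mu>: "\<mu> > 0" using \<epsilon> by (simp add: \<mu>_def)
  \<comment> \<open>The summands make \<open>J\<close> positive, keep the upper bounds of all
    penalties together within \<open>\<epsilon> / 4\<close>, and let one violated constraint
    outweigh the bound \<open>M\<close> of \<open>f\<close>.\<close>
  obtain J where J: "real J > 1 + 2 * real m / \<epsilon> + (\<bar>M\<bar> + \<epsilon> / 2) / (2 * \<mu>\<^sup>2)"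
    using reals_Archimedean2 by blast
  have J0: "J > 0" and J1: "real m / real (2 * J) \<le> \<epsilon> / 4" and J2: "real (2 * J) * \<mu>\<^sup>2 \<ge> \<bar>M\<bar> + \<epsilon> / 2"
  proof -
    have p: "2 * real m / \<epsilon> \<ge> 0" "(\<bar>M\<bar> + \<epsilon> / 2) / (2 * \<mu>\<^sup>2) \<ge> 0" using \<epsilon> \<mu> by simp_all
    then have "real J > 0" using J by linarith
    then show J0: "J > 0" by simp
    have "2 * real m / \<epsilon> \<le> real J" using J p by linarith
    then show "real m / real (2 * J) \<le> \<epsilon> / 4" using \<epsilon> J0 by (simp add: field_simps)
    have "(\<bar>M\<bar> + \<epsilon> / 2) / (2 * \<mu>\<^sup>2) \<le> real J" using J p by linarith
    then have "\<bar>M\<bar> + \<epsilon> / 2 \<le> real J * (2 * \<mu>\<^sup>2)" using \<mu> by (simp add: pos_divide_le_eq)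
    then show "real (2 * J) * \<mu>\<^sup>2 \<ge> \<bar>M\<bar> + \<epsilon> / 2" by (simp add: mult_ac)
  qed
  define q where "q x = (\<Sum>k=1..m. h k x * (1 - h k x) ^ (2 * J))" for x
  have hp: "polyf (tdeg (g k)) (h k)" for k
    unfolding h_def using polyf_cmult[OF polyf_peval[OF le_refl], of "g k" "1 / G"] by simp
  have "qm (gens m g) (\<Sum>k=1..m. J * tdeg (g k)) (\<lambda>x. \<Sum>k=1..m. (1 / G) * (((1 - h k x) ^ J)\<^sup>2 * peval (g k) x))"
  proof (intro qm_sum qm_scale)
    fix k assume k: "k \<in> {1..m}"
    have "polyf (J * tdeg (g k)) (\<lambda>x. (1 - h k x) ^ J)"
      by (intro polyf_power polyf_diff polyf_const hp)
    then have "polyf (\<Sum>k=1..m. J * tdeg (g k)) (\<lambda>x. (1 - h k x) ^ J)"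
      by (rule polyf_mono) (use k in \<open>auto intro: member_le_sum\<close>)
    then show "qm (gens m g) (\<Sum>k=1..m. J * tdeg (g k)) (\<lambda>x. ((1 - h k x) ^ J)\<^sup>2 * peval (g k) x)"
      by (rule qm_weighted[OF g_in_gens[OF k]])
  qed (use Gp in simp)
  then have 1: "qm (gens m g) (\<Sum>k=1..m. J * tdeg (g k)) q"
    unfolding q_def by (simp add: h_def power_mult[symmetric] mult_ac)
  have 2: "f t x - q x \<ge> \<epsilon> / 4" if "t \<in> K" "x \<in> B" for t x
  proof -
    have up: "h k x * (1 - h k x) ^ (2 * J) \<le> 1 / real (2 * J)" if "k \<in> {1..m}" for k
      using penalty_upper[of "h k x" "2 * J"] h1[OF that \<open>x \<in> B\<close>] J0 by (simp add: abs_le_iff)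
    show ?thesis
    proof (cases "f t x \<ge> \<epsilon> / 2")
      case True
      have "q x \<le> (\<Sum>k=1..m. 1 / real (2 * J))" unfolding q_def by (intro sum_mono up)
      also have "\<dots> \<le> \<epsilon> / 4" using J1 by simp
      finally show ?thesis using True by linarith
    next
      case False
      have "\<exists>k\<in>{1..m}. h k x < - \<mu>"
      proof (rule ccontr)
        assume "\<not> (\<exists>k\<in>{1..m}. h k x < - \<mu>)"
        then have "(\<Sum>k=1..m. max (- h k x) 0) \<le> (\<Sum>k=1..m. \<mu>)"
          using \<mu> by (intro sum_mono) (auto simp: not_less minus_le_iff)
        also have "\<dots> \<le> \<epsilon> / 2" using \<epsilon> by (simp add: \<mu>_def field_simps)
        finally have "\<phi> (t, x) < \<epsilon>" using False \<epsilon> by (simp add: \<phi>_def)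
        then show False using z0(2)[of "(t, x)"] that by (simp add: \<epsilon>_def)
      qed
      then obtain k where k: "k \<in> {1..m}" "h k x < - \<mu>" by blast
      have "q x = h k x * (1 - h k x) ^ (2 * J) + (\<Sum>k\<in>{1..m} - {k}. h k x * (1 - h k x) ^ (2 * J))"
        unfolding q_def using k(1) by (intro sum.remove) auto
      also have "\<dots> \<le> - (real (2 * J) * \<mu>\<^sup>2) + (\<Sum>k\<in>{1..m} - {k}. 1 / real (2 * J))"
        using k \<mu> by (intro add_mono penalty_lower sum_mono up) auto
      also have "(\<Sum>k\<in>{1..m} - {k}. 1 / real (2 * J)) \<le> (\<Sum>k=1..m. 1 / real (2 * J))"
        by (intro sum_mono2) auto
      also have "\<dots> \<le> \<epsilon> / 4" using J1 by simp
      finally show ?thesis using J2 M[OF that] by linarith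
    qed
  qed
  show thesis using that[OF 1 _ 2] \<epsilon> by simp
qed

text \<open>Where the uniformity comes from: \<open>q\<close>, the Bernstein degree and the finitely
  many bounds for the Bernstein polynomials are fixed before \<open>t\<close> and \<open>w\<close>.
  Only the constants \<open>Q\<close> in the square roots depend on \<open>t\<close>, and these
  roots have degree at most 1 because the \<open>w i\<close> have.\<close>

lemma uniform_form_representation:
  fixes F :: "'t::t2_space \<Rightarrow> 'n \<Rightarrow> 'n \<Rightarrow> real^'n::finite \<Rightarrow> real"
  assumes arch: "archimedean m g" and K: "compact K"
    and F: "\<And>i j. pfam d (\<lambda>t. F t i j)"
    and pos: "\<And>t x v. t \<in> K \<Longrightarrow> x \<in> semialg_set m g \<Longrightarrow> v \<noteq> 0 \<Longrightarrow>
      (\<Sum>i\<in>UNIV. \<Sum>j\<in>UNIV. v $ i * F t i j x * v $ j) > 0"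
  shows "\<exists>N. \<forall>t\<in>K. \<forall>w. (\<forall>i. polyf 1 (w i)) \<longrightarrow>
      qm (gens m g) N (\<lambda>x. \<Sum>i\<in>UNIV. \<Sum>j\<in>UNIV. w i x * F t i j x * w j x)"
proof -
  obtain L where L: "L > 0"
    "\<And>N \<nu>. \<exists>N'. qm (gens m g) N' (\<lambda>x. bprod N \<nu> (\<chi> i. (x $ i + L) / (2 * L)))"
    by (rule bprod_in_qm[OF arch]) blast
  define A :: "real^'n \<Rightarrow> real^'n" where "A y = (\<chi> i. 2 * L * y $ i - L)" for y
  define A' :: "real^'n \<Rightarrow> real^'n" where "A' x = (\<chi> i. (x $ i + L) / (2 * L))" for x
  have AA': "A (A' x) = x" for x
    using L(1) by (simp add: A_def A'_def vec_eq_iff)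
  define B where "B = A ` cbox 0 1"
  have B: "compact B"
    unfolding B_def A_def by (intro compact_continuous_image continuous_intros compact_cbox)
  define f where "f z x = (\<Sum>i\<in>UNIV. \<Sum>j\<in>UNIV. (snd z $ i * snd z $ j) * F (fst z) i j x)"
    for z :: "'t \<times> (real^'n)" and x
  have Ff: "pfam d (\<lambda>z. F (fst z) i j)" for i j
    by (rule pfam_reparam[OF F]) (intro continuous_intros)
  have f: "pfam d f"
    unfolding f_def by (intro pfam_sum pfam_cmult Ff continuous_intros)
  \<comment> \<open>The direction of the form joins the parameters, so that the scalar lemma applies
    on a compact set; unit vectors suffice by homogeneity.\<close>
  define K' where "K' = K \<times> sphere (0::real^'n) 1"
  have K': "compact K'" unfolding K'_def by (intro compact_Times K compact_sphere)
  have f1: "continuous_on (K' \<times> B) (\<lambda>(z, x). f z x)"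
    unfolding case_prod_unfold by (intro continuous_on_pfam[OF f] continuous_intros)
  have f2: "f z x > 0" if "z \<in> K'" "x \<in> semialg_set m g" for z x
    using pos[of "fst z" x "snd z"] that by (force simp: f_def K'_def mult_ac)
  obtain q N1 \<eta> where q: "qm (gens m g) N1 q" and \<eta>: "\<eta> > 0"
    and fq: "\<And>z x. z \<in> K' \<Longrightarrow> x \<in> B \<Longrightarrow> f z x - q x \<ge> \<eta>"
    by (rule positive_after_penalty[OF K' B f1 f2]) blast+
  obtain e0 where "\<forall>h\<in>gens m g. polyf e0 h" using gens_polyf by blast
  then obtain e where e: "polyf e q" using qm_polyf[OF q] by blast
  define D where "D = max d e"
  \<comment> \<open>On unit vectors, subtracting \<open>q\<close> from the form means subtracting
    \<open>q\<close> times the identity matrix. The map \<open>A\<close> transfers everything to the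
    unit box.\<close>
  define G where "G t i j = (\<lambda>y. F t i j (A y) - (if i = j then q (A y) else 0))" for t i j
  have G: "pfam D (\<lambda>t. G t i j)" for i j
  proof -
    have l: "pfam 1 (\<lambda>t y. 2 * L * y $ i - L)" for i and t :: 't
      by (intro pfam_polyf_const polyf_diff polyf_cmult polyf_coord polyf_const) simp
    have "pfam d (\<lambda>t y. F t i j (A y))" unfolding A_def by (intro pfam_subst F l)
    moreover have "pfam e (\<lambda>t::'t. \<lambda>y. q (A y))"
      unfolding A_def by (intro pfam_subst[where f = "\<lambda>t. q"] pfam_polyf_const e l)
    then have "pfam e (\<lambda>t::'t. \<lambda>y. (if i = j then - 1 else 0) * q (A y))"
      by (intro pfam_cmult) auto
    ultimately have "pfam D (\<lambda>t y. F t i j (A y) + (if i = j then - 1 else 0) * q (A y))"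
      unfolding D_def by (intro pfam_add) (erule pfam_mono, simp)+
    then show ?thesis by (cases "i = j") (simp_all add: G_def)
  qed
  then have "\<exists>C. (\<forall>\<alpha>. continuous_on UNIV (C \<alpha>)) \<and>
      (\<forall>t y. G t i j y = (\<Sum>\<alpha>\<in>monoms_upto D. C \<alpha> t * mval \<alpha> y))" for i j
    unfolding pfam_def by blast
  then obtain C where Cc: "\<And>i j \<alpha>. continuous_on UNIV (C i j \<alpha>)"
    and C: "\<And>i j t y. G t i j y = (\<Sum>\<alpha>\<in>monoms_upto D. C i j \<alpha> t * mval \<alpha> y)" by metis
  \<comment> \<open>The coefficients of the scalar polynomial obtained from the matrix
    \<open>G\<close> and the direction \<open>snd z\<close>.\<close>
  define c where "c z \<alpha> = (\<Sum>i\<in>UNIV. \<Sum>j\<in>UNIV. snd z $ i * snd z $ j * C i j \<alpha> (fst z))"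
    for z :: "'t \<times> (real^'n)" and \<alpha>
  have "\<exists>M. \<forall>z\<in>K'. \<bar>c z \<alpha>\<bar> \<le> M" for \<alpha>
  proof -
    have "continuous_on K' (\<lambda>z. C i j \<alpha> (fst z))" for i j
      by (rule continuous_on_compose2[OF Cc continuous_on_fst[OF continuous_on_id]]) simp
    then have "continuous_on K' (\<lambda>z. c z \<alpha>)"
      unfolding c_def by (intro continuous_intros)
    from compact_imp_bounded[OF compact_continuous_image[OF this K']] show ?thesis
      by (fastforce simp: bounded_iff)
  qed
  then obtain M0 where M0: "\<And>z \<alpha>. z \<in> K' \<Longrightarrow> \<bar>c z \<alpha>\<bar> \<le> M0 \<alpha>" by metis
  define M where "M = (\<Sum>\<alpha>\<in>monoms_upto D. \<bar>M0 \<alpha>\<bar>)"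
  have M: "\<bar>c z \<alpha>\<bar> \<le> M" if "z \<in> K'" "\<alpha> \<in> monoms_upto D" for z \<alpha>
  proof -
    have "\<bar>c z \<alpha>\<bar> \<le> \<bar>M0 \<alpha>\<bar>" using M0[OF that(1), of \<alpha>] by linarith
    also have "\<dots> \<le> M" unfolding M_def using that(2) by (intro member_le_sum) auto
    finally show ?thesis .
  qed
  have csum: "(\<Sum>\<alpha>\<in>monoms_upto D. c z \<alpha> * b \<alpha>)
      = (\<Sum>i\<in>UNIV. \<Sum>j\<in>UNIV. snd z $ i * (\<Sum>\<alpha>\<in>monoms_upto D. C i j \<alpha> (fst z) * b \<alpha>) * snd z $ j)" for z b
  proof -
    have "(\<Sum>\<alpha>\<in>monoms_upto D. c z \<alpha> * b \<alpha>)
        = (\<Sum>\<alpha>\<in>monoms_upto D. \<Sum>i\<in>UNIV. \<Sum>j\<in>UNIV. snd z $ i * C i j \<alpha> (fst z) * b \<alpha> * snd z $ j)"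
      by (simp add: c_def sum_distrib_left sum_distrib_right mult_ac)
    also have "\<dots> = (\<Sum>i\<in>UNIV. \<Sum>j\<in>UNIV. \<Sum>\<alpha>\<in>monoms_upto D. snd z $ i * C i j \<alpha> (fst z) * b \<alpha> * snd z $ j)"
      by (subst sum.swap, intro sum.cong refl, subst sum.swap, rule refl)
    finally show ?thesis by (simp add: sum_distrib_left sum_distrib_right mult_ac)
  qed
  have quadG: "(\<Sum>i\<in>UNIV. \<Sum>j\<in>UNIV. v i * G t i j y * v j)
      = (\<Sum>i\<in>UNIV. \<Sum>j\<in>UNIV. v i * F t i j (A y) * v j) - q (A y) * (\<Sum>i\<in>UNIV. (v i)\<^sup>2)" for t v y
  proof -
    have "v i * G t i j y * v j = v i * F t i j (A y) * v j - (if i = j then q (A y) * (v i)\<^sup>2 else 0)" for i j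
      by (simp add: G_def algebra_simps power2_eq_square)
    then show ?thesis by (simp add: sum_subtractf sum_distrib_left)
  qed
  obtain N where N: "2 * D < N"
    and coef: "\<And>(c :: 'n monom \<Rightarrow> real) \<nu>. \<lbrakk>\<And>\<alpha>. \<alpha> \<in> monoms_upto D \<Longrightarrow> \<bar>c \<alpha>\<bar> \<le> M;
      \<And>y. y \<in> cbox 0 1 \<Longrightarrow> (\<Sum>\<alpha>\<in>monoms_upto D. c \<alpha> * mval \<alpha> y) \<ge> \<eta>;
      \<nu> \<in> UNIV \<rightarrow>\<^sub>E {..N}\<rbrakk> \<Longrightarrow> (\<Sum>\<alpha>\<in>monoms_upto D. c \<alpha> * bcoef N \<nu> \<alpha>) \<ge> 0"
    using Bernstein_coefficients_nonneg[OF \<eta>, of D M] by blast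
  let ?V = "UNIV \<rightarrow>\<^sub>E {..N} :: ('n \<Rightarrow> nat) set"
  \<comment> \<open>The matrix coefficient of \<open>G t\<close> at the basis polynomial
    \<open>bprod N \<nu>\<close>.\<close>
  define E where "E \<nu> t i j = (\<Sum>\<alpha>\<in>monoms_upto D. C i j \<alpha> t * bcoef N \<nu> \<alpha>)" for \<nu> t i j
  have Epos: "(\<Sum>i\<in>UNIV. \<Sum>j\<in>UNIV. v i * E \<nu> t i j * v j) \<ge> 0" if "t \<in> K" "\<nu> \<in> ?V" for v \<nu> t
  proof -
    have unit: "(\<Sum>i\<in>UNIV. \<Sum>j\<in>UNIV. u $ i * E \<nu> t i j * u $ j) \<ge> 0" if u: "norm u = 1" for u :: "real^'n"
    proof -
      have z: "(t, u) \<in> K'" using \<open>t \<in> K\<close> u by (simp add: K'_def)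
      have "(\<Sum>\<alpha>\<in>monoms_upto D. c (t, u) \<alpha> * bcoef N \<nu> \<alpha>) \<ge> 0"
      proof (rule coef)
        fix y :: "real^'n" assume y: "y \<in> cbox 0 1"
        have "(\<Sum>i\<in>UNIV. (u $ i)\<^sup>2) = 1"
          using u by (simp add: norm_eq_sqrt_inner inner_vec_def power2_eq_square)
        then have "(\<Sum>\<alpha>\<in>monoms_upto D. c (t, u) \<alpha> * mval \<alpha> y) = f (t, u) (A y) - q (A y)"
          unfolding csum fst_conv snd_conv C[symmetric] quadG by (simp add: f_def mult_ac)
        then show "(\<Sum>\<alpha>\<in>monoms_upto D. c (t, u) \<alpha> * mval \<alpha> y) \<ge> \<eta>"
          using fq[OF z, of "A y"] y by (simp add: B_def)
      qed (use M[OF z] \<open>\<nu> \<in> ?V\<close> in auto)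
      then show ?thesis by (simp add: csum E_def)
    qed
    define u :: "real^'n" where "u = (\<chi> i. v i)"
    show ?thesis
    proof (cases "u = 0")
      case True
      then have "v i = 0" for i by (simp add: u_def vec_eq_iff)
      then show ?thesis by simp
    next
      case False
      have "0 \<le> (norm u)\<^sup>2 * (\<Sum>i\<in>UNIV. \<Sum>j\<in>UNIV. (u /\<^sub>R norm u) $ i * E \<nu> t i j * (u /\<^sub>R norm u) $ j)"
        using False by (intro mult_nonneg_nonneg unit) auto
      also have "\<dots> = (\<Sum>i\<in>UNIV. \<Sum>j\<in>UNIV. v i * E \<nu> t i j * v j)"
        using False by (simp add: sum_distrib_left u_def power2_eq_square field_simps)
      finally show ?thesis .
    qed
  qed
  have "\<exists>N'. \<forall>\<nu>\<in>?V. qm (gens m g) N' (\<lambda>x. bprod N \<nu> (A' x))"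
    unfolding A'_def by (intro qm_uniform finite_PiE L(2)) auto
  then obtain N2 where N2: "\<And>\<nu>. \<nu> \<in> ?V \<Longrightarrow> qm (gens m g) N2 (\<lambda>x. bprod N \<nu> (A' x))" by blast
  have "qm (gens m g) (1 + N1 + N2) (\<lambda>x. \<Sum>i\<in>UNIV. \<Sum>j\<in>UNIV. w i x * F t i j x * w j x)"
    if t: "t \<in> K" and w: "\<And>i. polyf 1 (w i)" for t w
  proof -
    have "\<forall>\<nu>\<in>?V. \<exists>Q :: 'n \<Rightarrow> 'n \<Rightarrow> real. \<forall>v. (\<Sum>i\<in>UNIV. \<Sum>j\<in>UNIV. v i * E \<nu> t i j * v j)
        = (\<Sum>k\<in>UNIV. (\<Sum>i\<in>UNIV. Q k i * v i)\<^sup>2)"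
      by (intro ballI psd_form_squares finite_class.finite_UNIV Epos[OF t])
    from bchoice[OF this] obtain Q :: "('n \<Rightarrow> nat) \<Rightarrow> 'n \<Rightarrow> 'n \<Rightarrow> real"
      where Q: "\<And>\<nu> v. \<nu> \<in> ?V \<Longrightarrow> (\<Sum>i\<in>UNIV. \<Sum>j\<in>UNIV. v i * E \<nu> t i j * v j)
        = (\<Sum>k\<in>UNIV. (\<Sum>i\<in>UNIV. Q \<nu> k i * v i)\<^sup>2)"
      by blast
    have GE: "G t i j y = (\<Sum>\<nu>\<in>?V. E \<nu> t i j * bprod N \<nu> y)" for i j y
    proof -
      have "G t i j y = (\<Sum>\<alpha>\<in>monoms_upto D. \<Sum>\<nu>\<in>?V. C i j \<alpha> t * (bcoef N \<nu> \<alpha> * bprod N \<nu> y))"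
        unfolding C sum_distrib_left[symmetric]
        using N by (intro sum.cong refl arg_cong2[of _ _ _ _ "(*)"] mval_bprod) (simp add: monoms_upto_def)
      also have "\<dots> = (\<Sum>\<nu>\<in>?V. E \<nu> t i j * bprod N \<nu> y)"
        by (subst sum.swap) (simp add: E_def sum_distrib_left sum_distrib_right mult_ac)
      finally show ?thesis .
    qed
    \<comment> \<open>The first sum restores the subtracted multiple of the identity; in the second,
      the squares come from the semidefinite matrices \<open>E \<nu> t\<close>.\<close>
    have eq: "(\<Sum>i\<in>UNIV. \<Sum>j\<in>UNIV. w i x * F t i j x * w j x)
        = (\<Sum>i\<in>UNIV. (w i x)\<^sup>2 * q x) + (\<Sum>\<nu>\<in>?V. \<Sum>k\<in>UNIV. (\<Sum>i\<in>UNIV. Q \<nu> k i * w i x)\<^sup>2 * bprod N \<nu> (A' x))" for x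
    proof -
      have "(\<Sum>i\<in>UNIV. \<Sum>j\<in>UNIV. w i x * G t i j (A' x) * w j x)
          = (\<Sum>i\<in>UNIV. \<Sum>j\<in>UNIV. \<Sum>\<nu>\<in>?V. w i x * E \<nu> t i j * w j x * bprod N \<nu> (A' x))"
        unfolding GE by (simp add: sum_distrib_left sum_distrib_right mult_ac)
      also have "\<dots> = (\<Sum>\<nu>\<in>?V. \<Sum>i\<in>UNIV. \<Sum>j\<in>UNIV. w i x * E \<nu> t i j * w j x * bprod N \<nu> (A' x))"
        by (subst (2) sum.swap, intro sum.cong refl, subst sum.swap, rule refl)
      also have "\<dots> = (\<Sum>\<nu>\<in>?V. (\<Sum>i\<in>UNIV. \<Sum>j\<in>UNIV. w i x * E \<nu> t i j * w j x) * bprod N \<nu> (A' x))"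
        by (simp only: sum_distrib_right)
      also have "\<dots> = (\<Sum>\<nu>\<in>?V. \<Sum>k\<in>UNIV. (\<Sum>i\<in>UNIV. Q \<nu> k i * w i x)\<^sup>2 * bprod N \<nu> (A' x))"
        by (intro sum.cong refl) (simp only: Q[of _ "\<lambda>i. w i x"] sum_distrib_right)
      finally show ?thesis
        unfolding quadG AA' by (simp add: sum_distrib_left mult_ac)
    qed
    have 1: "qm (gens m g) (1 + N1 + N2) (\<lambda>x. \<Sum>i\<in>UNIV. (w i x)\<^sup>2 * q x)"
      by (intro qm_sum qm_mono[OF qm_mult_square[OF q w]]) simp
    have *: "qm (gens m g) (1 + N2) (\<lambda>x. (\<Sum>i\<in>UNIV. Q \<nu> k i * w i x)\<^sup>2 * bprod N \<nu> (A' x))"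
      if "\<nu> \<in> ?V" for \<nu> k
      by (intro qm_mult_square N2 that polyf_sum polyf_cmult w)
    have 2: "qm (gens m g) (1 + N1 + N2)
        (\<lambda>x. \<Sum>\<nu>\<in>?V. \<Sum>k\<in>UNIV. (\<Sum>i\<in>UNIV. Q \<nu> k i * w i x)\<^sup>2 * bprod N \<nu> (A' x))"
      by (intro qm_sum qm_mono[OF *]) auto
    show ?thesis unfolding eq by (rule qm_add[OF 2 1])
  qed
  then show ?thesis by blast
qed

subsection \<open>Taylor remainders of concave polynomials\<close>

text \<open>The height of the tangent at \<open>u\<close> above the graph at \<open>x\<close>, the
  quantity that concavity makes nonnegative.\<close>

definition remainder :: "'n::finite mpoly \<Rightarrow> real^'n \<Rightarrow> real^'n \<Rightarrow> real" where
  "remainder p u x = peval p u + grad p u \<bullet> (x - u) - peval p x"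

lemma remainder_integral:
  "remainder p u x = integral {0..1} (\<lambda>s. (1 - s) * hquad p (u + s *\<^sub>R (x - u)) (x - u))"
  unfolding remainder_def by (rule integral_unique[OF taylor_integral, symmetric])

text \<open>Positivity at 0 alone suffices because the weight \<open>1 - s\<close> does not vanish
  there. In the application the Hessian is known to be definite only at the base point of the
  segment.\<close>

lemma weighted_integral_pos:
  fixes \<psi> :: "real \<Rightarrow> real"
  assumes "continuous_on {0..1} \<psi>" "\<And>s. s \<in> {0..1} \<Longrightarrow> \<psi> s \<ge> 0" "\<psi> 0 > 0"
  shows "integral {0..1} (\<lambda>s. (1 - s) * \<psi> s) > 0"
proof -
  have c: "continuous_on {0..1} (\<lambda>s. (1 - s) * \<psi> s)" by (intro continuous_intros assms)
  have nn: "(1 - s) * \<psi> s \<ge> 0" if "s \<in> {0..1}" for s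
    using assms(2)[OF that] that by simp
  have "integral {0..1} (\<lambda>s. (1 - s) * \<psi> s) \<noteq> 0"
  proof
    assume "integral {0..1} (\<lambda>s. (1 - s) * \<psi> s) = 0"
    moreover have "(integral {0..1} (\<lambda>s. (1 - s) * \<psi> s) = 0) = (\<forall>s\<in>{0..1}. (1 - s) * \<psi> s = 0)"
      by (rule integral_eq_0_iff[OF c _ nn]) simp
    ultimately have "(1 - 0) * \<psi> 0 = 0" by (metis atLeastAtMost_iff le_numeral_extra(3) zero_le_one)
    then have "\<psi> 0 = 0" by simp
    then show False using assms(3) by simp
  qed
  moreover have "integral {0..1} (\<lambda>s. (1 - s) * \<psi> s) \<ge> 0"
    by (intro integral_nonneg integrable_continuous_interval c nn)
  ultimately show ?thesis by linarith
qed

lemma hquad_scale: "hquad p x (c *\<^sub>R v) = c\<^sup>2 * hquad p x v"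
  by (simp add: hquad_def sum_distrib_left power2_eq_square mult_ac)

lemma concave_on_midpoint:
  assumes "concave_on S f" "x \<in> S" "y \<in> S"
  shows "f ((1 / 2) *\<^sub>R x + (1 / 2) *\<^sub>R y) \<ge> (1 / 2) * f x + (1 / 2) * f y"
proof -
  have "\<forall>x\<in>S. \<forall>y\<in>S. \<forall>u\<ge>0. \<forall>v\<ge>0. u + v = 1 \<longrightarrow> u * f x + v * f y \<le> f (u *\<^sub>R x + v *\<^sub>R y)"
    using assms(1) unfolding concave_on_iff by blast
  from this[rule_format, OF assms(2,3), of "1 / 2" "1 / 2"] show ?thesis by simp
qed

text \<open>At an interior point a negative value would persist on a ball and make the remainders at
  two opposite points negative, against concavity at their midpoint. Boundary points follow by
  continuity, \<open>S\<close> being in the closure of its interior.\<close>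

lemma concave_imp_hquad_nonneg:
  fixes p :: "'n::finite mpoly"
  assumes conc: "concave_on S (peval p)" and S: "convex S" "interior S \<noteq> {}" and z: "z \<in> S"
  shows "hquad p z v \<ge> 0"
proof -
  have int: "hquad p z v \<ge> 0" if z: "z \<in> interior S" for z
  proof (rule ccontr)
    assume neg: "\<not> hquad p z v \<ge> 0"
    have "open {y. hquad p y v < 0}"
      by (intro open_Collect_less continuous_intros)
    then have "open ({y. hquad p y v < 0} \<inter> interior S)" by blast
    then obtain r where r: "r > 0" "ball z r \<subseteq> {y. hquad p y v < 0} \<inter> interior S"
      using open_contains_ball neg z by (metis (mono_tags, lifting) IntI mem_Collect_eq not_le)
    \<comment> \<open>Keeps \<open>z + t *\<^sub>R v\<close> inside the ball for
      \<open>\<bar>t\<bar>\<close> up to \<open>e\<close>.\<close>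
    define e where "e = r / (2 * (norm v + 1))"
    have n1: "norm v + 1 > 0" by (simp add: add_nonneg_pos)
    then have e: "e > 0" "e * norm v < r"
      using r(1) by (simp_all add: e_def field_simps add_nonneg_pos)
    have inb: "z + t *\<^sub>R v \<in> ball z r" if "\<bar>t\<bar> \<le> e" for t
    proof -
      have "\<bar>t\<bar> * norm v \<le> e * norm v" using that by (intro mult_right_mono) auto
      then show ?thesis using e by (simp add: dist_norm)
    qed
    have rem: "remainder p z (z + c *\<^sub>R v) < 0" if c: "\<bar>c\<bar> = e" for c
    proof -
      have "integral {0..1} (\<lambda>s. (1 - s) * - hquad p (z + s *\<^sub>R (c *\<^sub>R v)) (c *\<^sub>R v)) > 0"
      proof (rule weighted_integral_pos)
        have lt: "hquad p (z + s *\<^sub>R (c *\<^sub>R v)) (c *\<^sub>R v) < 0" if "s \<in> {0..1}" for s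
        proof -
          have "\<bar>s * c\<bar> \<le> e" using that c e mult_right_mono[of s 1 e] by (auto simp: abs_mult)
          then have "hquad p (z + s *\<^sub>R (c *\<^sub>R v)) v < 0" using inb[of "s * c"] r(2) by auto
          then show ?thesis using c e by (simp add: hquad_scale mult_pos_neg)
        qed
        then show "- hquad p (z + s *\<^sub>R (c *\<^sub>R v)) (c *\<^sub>R v) \<ge> 0" if "s \<in> {0..1}" for s
          using that by (simp add: less_imp_le)
        show "- hquad p (z + 0 *\<^sub>R (c *\<^sub>R v)) (c *\<^sub>R v) > 0" using lt[of 0] by simp
      qed (intro continuous_intros)
      then show ?thesis by (simp add: remainder_integral)
    qed
    have "z + e *\<^sub>R v \<in> S" "z + (- e) *\<^sub>R v \<in> S"
      using subsetD[OF r(2) inb[of e]] subsetD[OF r(2) inb[of "- e"]] e interior_subset[of S] by auto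
    then have "peval p ((1 / 2) *\<^sub>R (z + e *\<^sub>R v) + (1 / 2) *\<^sub>R (z + (- e) *\<^sub>R v))
        \<ge> (1 / 2) * peval p (z + e *\<^sub>R v) + (1 / 2) * peval p (z + (- e) *\<^sub>R v)"
      by (rule concave_on_midpoint[OF conc])
    moreover have "(1 / 2) *\<^sub>R (z + e *\<^sub>R v) + (1 / 2) *\<^sub>R (z + (- e) *\<^sub>R v) = z"
      by (simp add: algebra_simps flip: scaleR_add_left)
    ultimately have "2 * peval p z \<ge> peval p (z + e *\<^sub>R v) + peval p (z + (- e) *\<^sub>R v)" by simp
    \<comment> \<open>The gradient terms cancel when the two remainders are added.\<close>
    moreover have "grad p z \<bullet> (z + (- e) *\<^sub>R v - z) = - (grad p z \<bullet> (z + e *\<^sub>R v - z))" by simp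
    ultimately show False
      using rem[of e] rem[of "- e"] e unfolding remainder_def by simp
  qed
  have "closed {z. hquad p z v \<ge> 0}" by (intro closed_Collect_le continuous_intros)
  then have "closure (interior S) \<subseteq> {z. hquad p z v \<ge> 0}"
    using int by (intro closure_minimal) auto
  then show ?thesis
    using convex_closure_interior[OF S] closure_subset[of S] z by blast
qed

lemma segment_in_convex:
  "convex S \<Longrightarrow> u \<in> S \<Longrightarrow> x \<in> S \<Longrightarrow> s \<in> {0..1} \<Longrightarrow> u + s *\<^sub>R (x - u) \<in> S"
  using convexD_alt[of S u x s] by (simp add: algebra_simps)

lemma remainder_nonneg:
  assumes "concave_on S (peval p)" "convex S" "interior S \<noteq> {}" "u \<in> S" "x \<in> S"
  shows "remainder p u x \<ge> 0"
  unfolding remainder_integral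
proof (intro integral_nonneg integrable_continuous_interval continuous_intros)
  fix s :: real assume "s \<in> {0..1}"
  then show "0 \<le> (1 - s) * hquad p (u + s *\<^sub>R (x - u)) (x - u)"
    using assms by (intro mult_nonneg_nonneg concave_imp_hquad_nonneg segment_in_convex) auto
qed

text \<open>Reflection at \<open>z\<close> maps a ball around it to itself. Concavity and a zero at
  \<open>z\<close> force \<open>p\<close> to vanish at each point and its reflection, hence on the
  ball, hence as a polynomial.\<close>

lemma concave_pos_interior:
  fixes p :: "'n::finite mpoly"
  assumes conc: "concave_on S (peval p)" and nn: "\<And>x. x \<in> S \<Longrightarrow> peval p x \<ge> 0"
    and z: "z \<in> interior S" and "p \<noteq> 0"
  shows "peval p z > 0"
proof (rule ccontr)
  assume "\<not> peval p z > 0"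
  then have z0: "peval p z = 0" using nn z interior_subset by fastforce
  obtain r where r: "r > 0" "ball z r \<subseteq> S" using z by (auto simp: mem_interior)
  have "peval p x = 0" if x: "x \<in> ball z r" for x
  proof -
    have y: "2 *\<^sub>R z - x \<in> ball z r"
      using x by (simp add: dist_norm norm_minus_commute algebra_simps scaleR_2)
    have "peval p ((1 / 2) *\<^sub>R x + (1 / 2) *\<^sub>R (2 *\<^sub>R z - x))
        \<ge> (1 / 2) * peval p x + (1 / 2) * peval p (2 *\<^sub>R z - x)"
      by (rule concave_on_midpoint[OF conc subsetD[OF r(2) x] subsetD[OF r(2) y]])
    moreover have "(1 / 2) *\<^sub>R x + (1 / 2) *\<^sub>R (2 *\<^sub>R z - x) = z"
      by (simp add: algebra_simps)
    ultimately show ?thesis using nn[OF subsetD[OF r(2) x]] nn[OF subsetD[OF r(2) y]] z0 by simp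
  qed
  then have "p = 0" using peval_zero_on_open[of "ball z r" p] r(1) by auto
  with \<open>p \<noteq> 0\<close> show False by simp
qed

text \<open>The parameter is the pair of the base point and the position on the segment.\<close>

lemma pfam_segment:
  assumes "tdeg p \<le> d"
  shows "pfam d (\<lambda>z x. peval p (fst z + snd z *\<^sub>R (x - fst z)))"
proof -
  have "pfam 1 (\<lambda>z x. (1 - snd z) * (fst z $ i) + snd z * (x $ i))" for i :: 'a
    by (intro pfam_add pfam_const pfam_cmult pfam_polyf_const polyf_coord continuous_intros) simp
  then have "pfam d (\<lambda>z x. peval p (\<chi> i. (1 - snd z) * (fst z $ i) + snd z * (x $ i)))"
    by (intro pfam_subst[where f = "\<lambda>z. peval p"] pfam_polyf_const polyf_peval assms)
  moreover have "(\<chi> i. (1 - snd z) * (fst z $ i) + snd z * (x $ i)) = fst z + snd z *\<^sub>R (x - fst z)"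
    for z :: "(real^'a) \<times> real" and x
    by (simp add: vec_eq_iff algebra_simps)
  ultimately show ?thesis by simp
qed

text \<open>With a factorisation of minus the Hessian, the integrand is a weighted sum of squares of
  polynomials in \<open>x\<close>. Here \<open>e\<close> bounds the degrees of the entries of
  \<open>W\<close> and the factor \<open>x - u\<close> adds one, so the bound holds for every
  \<open>u\<close>.\<close>

lemma sos_hessian_remainder:
  fixes p :: "'n::finite mpoly"
  assumes "sos_matrix (- hessian p)" "(\<lambda>x. 1) \<in> H"
  shows "\<exists>N. \<forall>u. qm H N (remainder p u)"
proof -
  obtain l :: nat and W :: "nat \<Rightarrow> 'n mpoly ^ 'n"
    where W: "\<And>i j. - hessian p $ i $ j = (\<Sum>k<l. W k $ i * W k $ j)"
    using assms(1) unfolding sos_matrix_def by auto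
  have hq: "hquad p z v = (\<Sum>k<l. (\<Sum>i\<in>UNIV. peval (W k $ i) z * v $ i)\<^sup>2)" for z v
  proof -
    have "hquad p z v = (\<Sum>i\<in>UNIV. \<Sum>j\<in>UNIV. \<Sum>k<l. (peval (W k $ i) z * v $ i) * (peval (W k $ j) z * v $ j))"
      unfolding hquad_def using W
      by (simp add: peval_sum peval_mult sum_distrib_left sum_distrib_right mult_ac)
    also have "\<dots> = (\<Sum>k<l. \<Sum>i\<in>UNIV. \<Sum>j\<in>UNIV. (peval (W k $ i) z * v $ i) * (peval (W k $ j) z * v $ j))"
      by (subst (2) sum.swap, intro sum.cong refl, subst sum.swap, rule refl)
    finally show ?thesis by (simp only: power2_eq_square sum_product)
  qed
  define e where "e = (\<Sum>k<l. \<Sum>i\<in>UNIV. tdeg (W k $ i))"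
  have We: "tdeg (W k $ i) \<le> e" if "k < l" for k i
  proof -
    have "tdeg (W k $ i) \<le> (\<Sum>i\<in>UNIV. tdeg (W k $ i))" by (rule member_le_sum) auto
    also have "\<dots> \<le> e" unfolding e_def using that by (intro member_le_sum) auto
    finally show ?thesis .
  qed
  define w where "w k z x = (\<Sum>i\<in>UNIV. peval (W k $ i) (fst z + snd z *\<^sub>R (x - fst z)) * (x $ i - fst z $ i))"
    for k and z :: "(real^'n) \<times> real" and x
  have "pfam (e + 1) (w k)" if "k < l" for k
  proof -
    have "pfam 1 (\<lambda>z x. x $ i + (- fst z $ i))" for i :: 'n and z :: "(real^'n) \<times> real"
      by (intro pfam_add pfam_const pfam_polyf_const polyf_coord continuous_intros) simp
    then have "pfam 1 (\<lambda>(z :: (real^'n) \<times> real) x. x $ i - fst z $ i)" for i :: 'n by simp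
    then show ?thesis
      unfolding w_def by (intro pfam_sum pfam_mult pfam_segment We that)
  qed
  then have "\<forall>k\<in>{..<l}. \<exists>c. (\<forall>\<alpha>. continuous_on UNIV (c \<alpha>)) \<and>
      (\<forall>z x. w k z x = (\<Sum>\<alpha>\<in>monoms_upto (e + 1). c \<alpha> z * mval \<alpha> x))"
    unfolding pfam_def by blast
  from bchoice[OF this] obtain c where c: "\<And>k \<alpha>. k < l \<Longrightarrow> continuous_on UNIV (c k \<alpha>)"
    "\<And>k z x. k < l \<Longrightarrow> w k z x = (\<Sum>\<alpha>\<in>monoms_upto (e + 1). c k \<alpha> z * mval \<alpha> x)" by blast
  have "qm H (e + 1) (remainder p u)" for u
  proof -
    have cu: "continuous_on {0..1} (\<lambda>s. c k \<alpha> (u, s))" if "k < l" for k \<alpha>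
      by (rule continuous_on_compose2[OF c(1)[OF that]]) (auto intro!: continuous_intros)
    have "remainder p u x = (\<Sum>k<l. integral {0..1}
        (\<lambda>s. (1 - s) * (\<Sum>\<alpha>\<in>monoms_upto (e + 1). c k \<alpha> (u, s) * mval \<alpha> x)\<^sup>2))" for x
    proof -
      have "remainder p u x = integral {0..1} (\<lambda>s. \<Sum>k<l. (1 - s) * (w k (u, s) x)\<^sup>2)"
        by (simp add: remainder_integral hq w_def sum_distrib_left)
      also have "\<dots> = integral {0..1} (\<lambda>s. \<Sum>k<l. (1 - s) * (\<Sum>\<alpha>\<in>monoms_upto (e + 1). c k \<alpha> (u, s) * mval \<alpha> x)\<^sup>2)"
        using c(2) by simp
      also have "\<dots> = (\<Sum>k<l. integral {0..1}
          (\<lambda>s. (1 - s) * (\<Sum>\<alpha>\<in>monoms_upto (e + 1). c k \<alpha> (u, s) * mval \<alpha> x)\<^sup>2))"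
        by (intro integral_sum integrable_continuous_interval continuous_intros cu) auto
      finally show ?thesis .
    qed
    then have "remainder p u = (\<lambda>x. \<Sum>k<l. integral {0..1}
        (\<lambda>s. (1 - s) * (\<Sum>\<alpha>\<in>monoms_upto (e + 1). c k \<alpha> (u, s) * mval \<alpha> x)\<^sup>2))" by blast
    then show ?thesis
      by (simp only:) (intro qm_sum qm_integral_square cu assms(2); simp)
  qed
  then show ?thesis by blast
qed

text \<open>The remainder is a quadratic form in \<open>x - u\<close> whose matrix \<open>F\<close>
  integrates minus the Hessian over the segment. That matrix is positive definite for
  \<open>x\<close> in \<open>S\<close>: by concavity the integrand is nonnegative, and at
  \<open>u\<close> it is positive. The entries of \<open>x - u\<close> serve as the
  \<open>w i\<close> of \<open>uniform_form_representation\<close>.\<close>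

lemma posdef_hessian_remainder:
  fixes g :: "nat \<Rightarrow> 'n::finite mpoly"
  assumes arch: "archimedean m g" and S: "S = semialg_set m g" "convex S" "interior S \<noteq> {}"
    and conc: "concave_on S (peval p)" and K: "compact K" "K \<subseteq> S"
    and pd: "\<And>u. u \<in> K \<Longrightarrow> pos_def (- meval (hessian p) u)"
  shows "\<exists>N. \<forall>u\<in>K. qm (gens m g) N (remainder p u)"
proof -
  define P where "P i j = - hessian p $ i $ j" for i j
  define d where "d = (\<Sum>i\<in>UNIV. \<Sum>j\<in>UNIV. tdeg (P i j))"
  have Pd: "tdeg (P i j) \<le> d" for i j
  proof -
    have "tdeg (P i j) \<le> (\<Sum>j\<in>UNIV. tdeg (P i j))" by (rule member_le_sum) auto
    also have "\<dots> \<le> d" unfolding d_def by (intro member_le_sum) auto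
    finally show ?thesis .
  qed
  define F where "F u i j x = integral {0..1} (\<lambda>s. (1 - s) * peval (P i j) (u + s *\<^sub>R (x - u)))" for u i j x
  have F: "pfam d (\<lambda>u. F u i j)" for i j
  proof -
    obtain c where c: "\<And>\<alpha>. continuous_on UNIV (c \<alpha>)"
      "\<And>(z :: (real^'n) \<times> real) x. peval (P i j) (fst z + snd z *\<^sub>R (x - fst z)) = (\<Sum>\<alpha>\<in>monoms_upto d. c \<alpha> z * mval \<alpha> x)"
      using pfam_segment[OF Pd, of i j] unfolding pfam_def by blast
    have cu: "continuous_on {0..1} (\<lambda>s. c \<alpha> (u, s))" for u \<alpha>
      by (rule continuous_on_compose2[OF c(1)]) (auto intro!: continuous_intros)
    have "F u i j x = (\<Sum>\<alpha>\<in>monoms_upto d. integral {0..1} (\<lambda>s. (1 - s) * c \<alpha> (u, s)) * mval \<alpha> x)" for u x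
    proof -
      have "F u i j x = integral {0..1} (\<lambda>s. \<Sum>\<alpha>\<in>monoms_upto d. ((1 - s) * c \<alpha> (u, s)) * mval \<alpha> x)"
        unfolding F_def using c(2)[of "(u, _)" x] by (simp add: sum_distrib_left mult_ac)
      also have "\<dots> = (\<Sum>\<alpha>\<in>monoms_upto d. integral {0..1} (\<lambda>s. ((1 - s) * c \<alpha> (u, s)) * mval \<alpha> x))"
        by (intro integral_sum integrable_continuous_interval continuous_intros cu) auto
      finally show ?thesis by simp
    qed
    moreover have "continuous_on UNIV (\<lambda>u. integral (cbox 0 1) (\<lambda>s. (1 - s) * c \<alpha> (u, s)))" for \<alpha>
    proof (rule integral_continuous_on_param)
      have "continuous_on (UNIV \<times> cbox 0 1) (c \<alpha>)" using c(1) continuous_on_subset by blast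
      then show "continuous_on (UNIV \<times> cbox 0 1) (\<lambda>(u, s). (1 - s) * c \<alpha> (u, s))"
        unfolding case_prod_unfold by (auto intro!: continuous_intros)
    qed
    ultimately show ?thesis
      unfolding pfam_def by (intro exI[of _ "\<lambda>\<alpha> u. integral {0..1} (\<lambda>s. (1 - s) * c \<alpha> (u, s))"]) simp
  qed
  have form: "(\<Sum>i\<in>UNIV. \<Sum>j\<in>UNIV. v $ i * F u i j x * v $ j)
      = integral {0..1} (\<lambda>s. (1 - s) * hquad p (u + s *\<^sub>R (x - u)) v)" for u x v
  proof -
    have "integral {0..1} (\<lambda>s. (1 - s) * hquad p (u + s *\<^sub>R (x - u)) v)
        = integral {0..1} (\<lambda>s. \<Sum>i\<in>UNIV. \<Sum>j\<in>UNIV. (v $ i * v $ j) * ((1 - s) * peval (P i j) (u + s *\<^sub>R (x - u))))"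
      unfolding hquad_def P_def by (simp add: sum_distrib_left mult_ac)
    also have "\<dots> = (\<Sum>i\<in>UNIV. \<Sum>j\<in>UNIV. integral {0..1} (\<lambda>s. (v $ i * v $ j) * ((1 - s) * peval (P i j) (u + s *\<^sub>R (x - u)))))"
      by (subst integral_sum, simp, intro integrable_continuous_interval continuous_intros,
          intro sum.cong refl integral_sum integrable_continuous_interval continuous_intros) simp
    also have "\<dots> = (\<Sum>i\<in>UNIV. \<Sum>j\<in>UNIV. v $ i * F u i j x * v $ j)"
      by (simp add: F_def mult_ac)
    finally show ?thesis ..
  qed
  have "\<exists>N. \<forall>u\<in>K. \<forall>w. (\<forall>i. polyf 1 (w i)) \<longrightarrow>
      qm (gens m g) N (\<lambda>x. \<Sum>i\<in>UNIV. \<Sum>j\<in>UNIV. w i x * F u i j x * w j x)"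
  proof (rule uniform_form_representation[OF arch K(1) F])
    fix u x v :: "real^'n" assume u: "u \<in> K" and x: "x \<in> semialg_set m g" and v: "v \<noteq> 0"
    have uS: "u \<in> S" and xS: "x \<in> S" using u x K S by auto
    show "(\<Sum>i\<in>UNIV. \<Sum>j\<in>UNIV. v $ i * F u i j x * v $ j) > 0"
      unfolding form
    proof (rule weighted_integral_pos)
      show "hquad p (u + s *\<^sub>R (x - u)) v \<ge> 0" if "s \<in> {0..1}" for s
        by (rule concave_imp_hquad_nonneg[OF conc S(2,3) segment_in_convex[OF S(2) uS xS that]])
      show "hquad p (u + 0 *\<^sub>R (x - u)) v > 0"
        using hquad_pos_def[OF pd[OF u] v] by simp
    qed (intro continuous_intros)
  qed
  then obtain N where N: "\<And>u w. u \<in> K \<Longrightarrow> (\<And>i. polyf 1 (w i)) \<Longrightarrow>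
      qm (gens m g) N (\<lambda>x. \<Sum>i\<in>UNIV. \<Sum>j\<in>UNIV. w i x * F u i j x * w j x)" by blast
  have "qm (gens m g) N (remainder p u)" if "u \<in> K" for u
  proof -
    have "remainder p u x = (\<Sum>i\<in>UNIV. \<Sum>j\<in>UNIV. (x $ i - u $ i) * F u i j x * (x $ j - u $ j))" for x
      using form[of "x - u" u x] by (simp add: remainder_integral)
    then have "remainder p u = (\<lambda>x. \<Sum>i\<in>UNIV. \<Sum>j\<in>UNIV. (x $ i - u $ i) * F u i j x * (x $ j - u $ j))"
      by blast
    then show ?thesis
      by (simp only:) (intro N[OF that, of "\<lambda>i x. x $ i - u $ i"] polyf_diff polyf_const polyf_coord; simp)
  qed
  then show ?thesis by blast
qed

subsection \<open>Lagrange multipliers\<close>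

text \<open>If 0 were outside the convex hull of \<open>- a\<close> and the active gradients, a
  separating direction would decrease the objective and increase all active constraints, against
  minimality. The Slater point \<open>x0\<close> then shows that \<open>- a\<close> has positive
  weight. Zero polynomials are kept out of \<open>I\<close> because their gradients vanish.\<close>

lemma lagrange_multipliers:
  fixes g :: "nat \<Rightarrow> 'n::finite mpoly"
  assumes S: "S = semialg_set m g" "convex S" and x0: "x0 \<in> interior S"
    and conc: "\<And>i. i \<in> {1..m} \<Longrightarrow> concave_on S (peval (g i))"
    and u: "u \<in> S" and min: "\<And>x. x \<in> S \<Longrightarrow> a \<bullet> u \<le> a \<bullet> x"
    and I: "I = {i \<in> {1..m}. g i \<noteq> 0 \<and> peval (g i) u = 0}"
  obtains \<nu> where "\<And>i. i \<in> I \<Longrightarrow> \<nu> i \<ge> (0::real)" "a = (\<Sum>i\<in>I. \<nu> i *\<^sub>R grad (g i) u)"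
proof -
  define f where "f i = grad (g i) u" for i
  have finI: "finite I" by (simp add: I)
  \<comment> \<open>By concavity the tangent at \<open>u\<close>, where the constraint is 0, lies
    above its positive value at \<open>x0\<close>.\<close>
  have slater: "f i \<bullet> (x0 - u) > 0" if i: "i \<in> I" for i
  proof -
    have im: "i \<in> {1..m}" "g i \<noteq> 0" "peval (g i) u = 0" using i I by auto
    have nn: "peval (g i) x \<ge> 0" if "x \<in> S" for x
      using that S(1) im(1) by (simp add: semialg_set_def)
    have "peval (g i) x0 > 0"
      by (rule concave_pos_interior[OF conc[OF im(1)] nn x0 im(2)])
    moreover have "remainder (g i) u x0 \<ge> 0"
      using x0 interior_subset by (intro remainder_nonneg[OF conc[OF im(1)] S(2) _ u]) auto
    ultimately show ?thesis using im by (simp add: remainder_def f_def)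
  qed
  define V where "V = convex hull (insert (- a) (f ` I))"
  have V: "convex V" "closed V"
    unfolding V_def using finI by (auto intro!: compact_imp_closed finite_imp_compact_convex_hull)
  have "0 \<in> V"
  proof (rule ccontr)
    assume "0 \<notin> V"
    then obtain d b where b: "0 < b" "\<And>x. x \<in> V \<Longrightarrow> b < d \<bullet> x"
      using separating_hyperplane_closed_0[OF V] by blast
    have "d \<bullet> (- a) > 0" using b(1) b(2)[of "- a"] by (force simp: V_def intro: hull_inc)
    then have da: "a \<bullet> d < 0" by (simp add: inner_commute)
    have df: "f i \<bullet> d > 0" if "i \<in> I" for i
      using b(1) b(2)[of "f i"] that by (force simp: V_def inner_commute intro: hull_inc)
    have "\<forall>\<^sub>F t in at_right 0. peval (g i) (u + t *\<^sub>R d) \<ge> 0" if i: "i \<in> {1..m}" for i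
    proof -
      consider "g i = 0" | "i \<in> I" | "peval (g i) u > 0"
        using i u S unfolding I semialg_set_def by fastforce
      then show ?thesis
      proof cases
        case 2
        have "((\<lambda>t. peval (g i) (u + t *\<^sub>R d)) has_real_derivative grad (g i) (u + 0 *\<^sub>R d) \<bullet> d) (at 0)"
          by (rule peval_line_deriv)
        then obtain e where e: "e > 0" "\<And>h. h > 0 \<Longrightarrow> h < e \<Longrightarrow> peval (g i) u < peval (g i) (u + h *\<^sub>R d)"
          using DERIV_pos_inc_right df[OF 2] unfolding f_def by fastforce
        have "\<forall>t>0. t < e \<longrightarrow> peval (g i) (u + t *\<^sub>R d) \<ge> 0"
          using e(2) 2 by (force simp: I)
        with e(1) show ?thesis unfolding eventually_at_right_field by blast
      next
        case 3
        have "((\<lambda>t. peval (g i) (u + t *\<^sub>R d)) \<longlongrightarrow> peval (g i) (u + 0 *\<^sub>R d)) (at_right 0)"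
          by (intro isCont_tendsto_compose[where g = "peval (g i)"] tendsto_intros
              has_derivative_continuous[OF has_derivative_peval])
        then have "\<forall>\<^sub>F t in at_right 0. peval (g i) (u + t *\<^sub>R d) > 0"
          using 3 by (intro order_tendstoD(1)) auto
        then show ?thesis by (rule eventually_mono) simp
      qed simp
    qed
    then have "\<forall>\<^sub>F t in at_right 0. \<forall>i\<in>{1..m}. peval (g i) (u + t *\<^sub>R d) \<ge> 0"
      by (intro eventually_ball_finite) auto
    then have "\<forall>\<^sub>F t in at_right (0::real). t > 0 \<and> u + t *\<^sub>R d \<in> S"
      using eventually_at_right_less by eventually_elim (simp add: S(1) semialg_set_def)
    then obtain t :: real where t: "t > 0" "u + t *\<^sub>R d \<in> S"
      using eventually_happens'[OF trivial_limit_at_right_real] by blast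
    have "t * (a \<bullet> d) < 0" using t(1) da by (rule mult_pos_neg)
    with min[OF t(2)] show False by (simp add: inner_add_right)
  qed
  then have "\<exists>\<mu>. (\<forall>x\<in>insert (- a) (f ` I). 0 \<le> \<mu> x) \<and> sum \<mu> (insert (- a) (f ` I)) = 1
      \<and> (\<Sum>x\<in>insert (- a) (f ` I). \<mu> x *\<^sub>R x) = 0"
    unfolding V_def using finI by (subst (asm) convex_hull_finite) auto
  then obtain v \<mu> where v: "v \<ge> 0" and \<mu>: "\<And>x. x \<in> f ` I \<Longrightarrow> 0 \<le> \<mu> x"
    and s1: "sum \<mu> (f ` I) = 1 - v" and s2: "(\<Sum>x\<in>f ` I. \<mu> x *\<^sub>R x) = v *\<^sub>R a"
    using convex_hull_finite_step[of "f ` I" "- a" 1 0] finI by auto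
  \<comment> \<open>With weight 0 for \<open>- a\<close>, the active gradients alone would combine
    to 0; pairing with \<open>x0 - u\<close> excludes this.\<close>
  have "v \<noteq> 0"
  proof
    assume v0: "v = 0"
    have "(\<Sum>x\<in>f ` I. \<mu> x * (x \<bullet> (x0 - u))) = (\<Sum>x\<in>f ` I. \<mu> x *\<^sub>R x) \<bullet> (x0 - u)"
      by (simp add: inner_sum_left)
    then have "(\<Sum>x\<in>f ` I. \<mu> x * (x \<bullet> (x0 - u))) = 0" using s2 v0 by simp
    then have "\<forall>x\<in>f ` I. \<mu> x * (x \<bullet> (x0 - u)) = 0"
      using finI \<mu> slater by (subst (asm) sum_nonneg_eq_0_iff) (auto intro!: mult_nonneg_nonneg intro: less_imp_le[OF slater])
    then have "\<forall>x\<in>f ` I. \<mu> x = 0" using slater by force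
    then have "sum \<mu> (f ` I) = 0" by (rule sum.neutral)
    then show False using s1 v0 by simp
  qed
  with v have v: "v > 0" by simp
  \<comment> \<open>The hull is indexed by gradients as vectors. Constraints sharing a gradient
    divide its weight equally, and \<open>c i\<close> counts them.\<close>
  define c where "c i = real (card {j \<in> I. f j = f i})" for i
  define \<nu> where "\<nu> i = \<mu> (f i) / v / c i" for i
  have "(\<Sum>i\<in>I. \<nu> i *\<^sub>R f i) = (\<Sum>x\<in>f ` I. \<Sum>i\<in>{i \<in> I. f i = x}. \<nu> i *\<^sub>R f i)"
    by (rule sum.image_gen[OF finI])
  also have "\<dots> = (\<Sum>x\<in>f ` I. (\<mu> x / v) *\<^sub>R x)"
  proof (rule sum.cong[OF refl])
    fix x assume x: "x \<in> f ` I"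
    have "card {j \<in> I. f j = x} > 0" using x finI by (auto simp: card_gt_0_iff)
    moreover have "(\<Sum>i\<in>{i \<in> I. f i = x}. \<nu> i *\<^sub>R f i)
        = (\<Sum>i\<in>{i \<in> I. f i = x}. (\<mu> x / v / real (card {j \<in> I. f j = x})) *\<^sub>R x)"
      by (intro sum.cong) (auto simp: \<nu>_def c_def)
    ultimately show "(\<Sum>i\<in>{i \<in> I. f i = x}. \<nu> i *\<^sub>R f i) = (\<mu> x / v) *\<^sub>R x"
      by (simp only: sum_constant_scaleR) (simp add: field_simps)
  qed
  also have "\<dots> = (1 / v) *\<^sub>R (\<Sum>x\<in>f ` I. \<mu> x *\<^sub>R x)"
    by (simp add: scaleR_sum_right)
  also have "\<dots> = a" using v by (simp add: s2)
  finally have "a = (\<Sum>i\<in>I. \<nu> i *\<^sub>R grad (g i) u)" by (simp add: f_def)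
  moreover have "\<nu> i \<ge> 0" if "i \<in> I" for i
    using \<mu>[of "f i"] that v by (simp add: \<nu>_def c_def)
  ultimately show thesis using that by blast
qed

text \<open>Links the multiplier rule to the definiteness hypothesis, which speaks of boundary
  points only. A concave nonnegative constraint is positive inside \<open>S\<close>, and moving from
  \<open>u\<close> away from \<open>x0\<close> makes it negative, so \<open>u\<close> is interior to
  neither set.\<close>

lemma active_point_in_frontiers:
  fixes g :: "nat \<Rightarrow> 'n::finite mpoly"
  assumes S: "S = semialg_set m g" "convex S" and x0: "x0 \<in> interior S"
    and i: "i \<in> {1..m}" and conc: "concave_on S (peval (g i))"
    and nz: "g i \<noteq> 0" and u: "u \<in> S" "peval (g i) u = 0"
  shows "u \<in> frontier (nonneg_set (g i)) \<inter> frontier S"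
proof -
  have nn: "x \<in> S \<Longrightarrow> peval (g i) x \<ge> 0" for x using S i by (auto simp: semialg_set_def)
  have "u \<notin> interior S" using concave_pos_interior[OF conc nn _ nz, of u] u by auto
  then have "u \<in> frontier S" using u(1) closure_subset by (auto simp: frontier_def)
  have "u \<notin> interior (nonneg_set (g i))"
  proof
    assume "u \<in> interior (nonneg_set (g i))"
    then obtain r where r: "r > 0" "ball u r \<subseteq> nonneg_set (g i)" by (auto simp: mem_interior)
    define v where "v = x0 - u"
    have "peval (g i) x0 > 0" using concave_pos_interior[OF conc nn x0 nz] .
    moreover have "remainder (g i) u x0 \<ge> 0"
      using x0 interior_subset by (intro remainder_nonneg[OF conc S(2) _ u(1)]) auto
    ultimately have "grad (g i) (u + 0 *\<^sub>R v) \<bullet> v > 0" using u by (simp add: remainder_def v_def)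
    from DERIV_pos_inc_left[OF peval_line_deriv this] obtain e
      where e: "e > 0" "\<And>h. h > 0 \<Longrightarrow> h < e \<Longrightarrow> peval (g i) (u + (0 - h) *\<^sub>R v) < 0"
      using u by auto
    \<comment> \<open>Small enough for the derivative estimate and for staying in the ball.\<close>
    define h where "h = min (e / 2) (r / (2 * (norm v + 1)))"
    have n1: "norm v + 1 > 0" by (simp add: add_nonneg_pos)
    have h: "h > 0" "h < e" using e(1) r(1) n1 by (auto simp: h_def)
    have "h * norm v \<le> r / (2 * (norm v + 1)) * norm v" by (intro mult_right_mono) (auto simp: h_def)
    also have "\<dots> < r" using r(1) n1 by (simp add: field_simps add_nonneg_pos)
    finally have "u + (0 - h) *\<^sub>R v \<in> ball u r" using h(1) by (simp add: dist_norm)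
    from subsetD[OF r(2) this] e(2)[OF h] show False by (simp add: nonneg_set_def)
  qed
  then have "u \<in> frontier (nonneg_set (g i))"
    using u(2) closure_subset[of "nonneg_set (g i)"] by (auto simp: frontier_def nonneg_set_def)
  with \<open>u \<in> frontier S\<close> show ?thesis by blast
qed

section \<open>Representation of nonnegative affine polynomials with a uniform degree bound\<close>

lemma affine_in_qm:
  fixes g :: "nat \<Rightarrow> 'n::finite mpoly"
  assumes S_def: "S = semialg_set m g"
    and comp: "compact S" and conv: "convex S" and int: "interior S \<noteq> {}"
    and conc: "\<And>i. i \<in> {1..m} \<Longrightarrow> concave_on S (peval (g i))"
    and arch: "archimedean m g"
    and hess: "\<And>i. i \<in> {1..m} \<Longrightarrow> sos_matrix (- hessian (g i)) \<or>
           (\<forall>u \<in> frontier (nonneg_set (g i)) \<inter> frontier S. pos_def (- meval (hessian (g i)) u))"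
  shows "\<exists>N. \<forall>a b. (\<forall>x\<in>S. a \<bullet> x + b \<ge> 0) \<longrightarrow> qm (gens m g) N (\<lambda>x. a \<bullet> x + b)"
proof -
  obtain x0 where x0: "x0 \<in> interior S" using int by blast
  have "\<exists>N. \<forall>u. u \<in> S \<and> g i \<noteq> 0 \<and> peval (g i) u = 0 \<longrightarrow> qm (gens m g) N (remainder (g i) u)"
    if i: "i \<in> {1..m}" for i
    using hess[OF i]
  proof
    assume "sos_matrix (- hessian (g i))"
    then show ?thesis using sos_hessian_remainder[OF _ one_in_gens] by blast
  next
    assume pd: "\<forall>u \<in> frontier (nonneg_set (g i)) \<inter> frontier S. pos_def (- meval (hessian (g i)) u)"
    let ?K = "frontier (nonneg_set (g i)) \<inter> frontier S"
    have "compact ?K" using comp by (intro closed_Int_compact compact_frontier) simp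
    moreover have "?K \<subseteq> S" using comp by (simp add: compact_imp_closed frontier_subset_closed le_infI2)
    ultimately obtain N where "\<And>u. u \<in> ?K \<Longrightarrow> qm (gens m g) N (remainder (g i) u)"
      using posdef_hessian_remainder[OF arch S_def conv int conc[OF i], of ?K] pd by blast
    then show ?thesis
      using active_point_in_frontiers[OF S_def conv x0 i conc[OF i]] by blast
  qed
  then obtain N where N: "\<And>i u. i \<in> {1..m} \<Longrightarrow> u \<in> S \<Longrightarrow> g i \<noteq> 0 \<Longrightarrow> peval (g i) u = 0 \<Longrightarrow>
      qm (gens m g) (N i) (remainder (g i) u)" by metis
  define M where "M = (\<Sum>i=1..m. N i)"
  have M: "qm (gens m g) M (remainder (g i) u)"
    if "i \<in> {1..m}" "u \<in> S" "g i \<noteq> 0" "peval (g i) u = 0" for i u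
    using N[OF that] by (rule qm_mono) (use that(1) in \<open>auto simp: M_def intro: member_le_sum\<close>)
  have "qm (gens m g) M (\<lambda>x. a \<bullet> x + b)" if ab: "\<And>x. x \<in> S \<Longrightarrow> a \<bullet> x + b \<ge> 0" for a b
  proof -
    have "S \<noteq> {}" using x0 interior_subset by blast
    moreover have "continuous_on S (\<lambda>x. a \<bullet> x)" by (intro continuous_intros)
    ultimately obtain u where u: "u \<in> S" "\<And>x. x \<in> S \<Longrightarrow> a \<bullet> u \<le> a \<bullet> x"
      using continuous_attains_inf[OF comp] by blast
    define I where "I = {i \<in> {1..m}. g i \<noteq> 0 \<and> peval (g i) u = 0}"
    obtain \<nu> where \<nu>: "\<And>i. i \<in> I \<Longrightarrow> \<nu> i \<ge> 0" "a = (\<Sum>i\<in>I. \<nu> i *\<^sub>R grad (g i) u)"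
      by (rule lagrange_multipliers[OF S_def conv x0 conc u I_def]) blast+
    \<comment> \<open>Since \<open>g i\<close> vanishes at \<open>u\<close> for \<open>i\<close> in
      \<open>I\<close>, the linear term of \<open>g i\<close> is its remainder plus
      \<open>g i\<close>. The multipliers are nonnegative constants and do not affect the bound
      \<open>M\<close>.\<close>
    have eq: "a \<bullet> x + b = (a \<bullet> u + b) + (\<Sum>i\<in>I. \<nu> i * (remainder (g i) u x + peval (g i) x))" for x
    proof -
      have "a \<bullet> (x - u) = (\<Sum>i\<in>I. \<nu> i * (grad (g i) u \<bullet> (x - u)))"
        by (subst \<nu>(2)) (simp add: inner_sum_left)
      also have "\<dots> = (\<Sum>i\<in>I. \<nu> i * (remainder (g i) u x + peval (g i) x))"
        by (intro sum.cong) (auto simp: remainder_def I_def)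
      finally show ?thesis by (simp add: inner_diff_right)
    qed
    have "qm (gens m g) M (\<lambda>x. remainder (g i) u x + peval (g i) x)" if "i \<in> I" for i
      using that u(1) by (intro qm_add[OF qm_gen[OF g_in_gens] M]) (auto simp: I_def)
    then have "qm (gens m g) M (\<lambda>x. \<Sum>i\<in>I. \<nu> i * (remainder (g i) u x + peval (g i) x))"
      using \<nu>(1) by (intro qm_sum qm_scale)
    moreover have "qm (gens m g) M (\<lambda>x. a \<bullet> u + b)"
      by (rule qm_const[OF one_in_gens ab[OF u(1)]])
    ultimately have "qm (gens m g) M (\<lambda>x. (a \<bullet> u + b) + (\<Sum>i\<in>I. \<nu> i * (remainder (g i) u x + peval (g i) x)))"
      by (rule qm_add)
    then show ?thesis by (simp only: eq[symmetric])
  qed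
  then show ?thesis by blast
qed

text \<open>Squares with the same generator are collected into one multiplier. Different indices may
  give the same function in \<open>gens\<close>; any one of them may take the square.\<close>

lemma qm_imp_sos_representation:
  fixes g :: "nat \<Rightarrow> 'n::finite mpoly"
  assumes "qm (gens m g) N f"
  shows "\<exists>\<sigma>. (\<forall>k\<le>m. sos (\<sigma> k) \<and> tdeg (\<sigma> k) \<le> 2 * N) \<and> (\<forall>x. f x = (\<Sum>k\<le>m. peval (\<sigma> k) x * peval (with_one g k) x))"
  using assms
proof (induction rule: qm.induct)
  case zero
  have "sos (0 :: 'n mpoly)" unfolding sos_iff by (rule exI[of _ 0]) simp
  then show ?case by (intro exI[of _ "\<lambda>k. 0"]) simp
next
  case (step f h w)
  then obtain \<sigma> where \<sigma>: "\<And>k. k \<le> m \<Longrightarrow> sos (\<sigma> k)" "\<And>k. k \<le> m \<Longrightarrow> tdeg (\<sigma> k) \<le> 2 * N"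
    "\<And>x. f x = (\<Sum>k\<le>m. peval (\<sigma> k) x * peval (with_one g k) x)" by blast
  obtain j where j: "j \<le> m" "h = peval (with_one g j)" using step.hyps(2) by (auto simp: gens_def)
  obtain p where p: "tdeg p \<le> N" "w = peval p" using step.hyps(3) by (auto simp: polyf_def)
  obtain l :: nat and v where v: "\<sigma> j = (\<Sum>k<l. v k * v k)" using \<sigma>(1)[OF j(1)] unfolding sos_iff by blast
  have "sos (\<sigma> j + p * p)"
    unfolding sos_iff v by (intro exI[of _ "Suc l"] exI[of _ "v(l := p)"]) (auto intro!: sum.cong)
  moreover have "tdeg (\<sigma> j + p * p) \<le> 2 * N"
    using tdeg_mult[of p p] p(1) by (intro tdeg_add \<sigma>(2) j(1)) linarith
  moreover have "f x + (w x)\<^sup>2 * h x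
      = (\<Sum>k\<le>m. peval ((\<sigma>(j := \<sigma> j + p * p)) k) x * peval (with_one g k) x)" for x
  proof -
    have "(\<Sum>k\<le>m. peval ((\<sigma>(j := \<sigma> j + p * p)) k) x * peval (with_one g k) x)
        = (\<Sum>k\<le>m. peval (\<sigma> k) x * peval (with_one g k) x + (if k = j then (w x)\<^sup>2 * h x else 0))"
      by (intro sum.cong) (auto simp: peval_add peval_mult p j power2_eq_square algebra_simps)
    then show ?thesis using j(1) by (simp add: sum.distrib \<sigma>(3))
  qed
  ultimately show ?case
    using \<sigma>(1,2) by (intro exI[of _ "\<sigma>(j := \<sigma> j + p * p)"]) auto
qed

lemma peval_affine_poly: "peval (affine_poly a b) x = a \<bullet> x + b"
  by (simp add: affine_poly_def peval_add peval_sum peval_mult inner_vec_def)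

lemma PP_BDNR_if_qm:
  fixes g :: "nat \<Rightarrow> 'n::finite mpoly"
  assumes "\<And>a b. (\<forall>x\<in>semialg_set m g. a \<bullet> x + b \<ge> 0) \<Longrightarrow> qm (gens m g) N (\<lambda>x. a \<bullet> x + b)"
  shows "PP_BDNR m g"
proof -
  \<comment> \<open>\<open>2 * M\<close> exceeds \<open>2 * N\<close> plus the degree of every
    generator, and the 1 makes \<open>M\<close> positive.\<close>
  define M where "M = N + (\<Sum>k\<le>m. tdeg (with_one g k)) + 1"
  have "\<exists>\<sigma>. (\<forall>k\<le>m. sos (\<sigma> k) \<and> tdeg (\<sigma> k * with_one g k) \<le> 2 * M) \<and>
      affine_poly a b = (\<Sum>k\<le>m. \<sigma> k * with_one g k)"
    if ab: "\<forall>x\<in>semialg_set m g. a \<bullet> x + b \<ge> 0" for a b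
  proof -
    obtain \<sigma> where \<sigma>: "\<And>k. k \<le> m \<Longrightarrow> sos (\<sigma> k)" "\<And>k. k \<le> m \<Longrightarrow> tdeg (\<sigma> k) \<le> 2 * N"
      "\<And>x. a \<bullet> x + b = (\<Sum>k\<le>m. peval (\<sigma> k) x * peval (with_one g k) x)"
      using qm_imp_sos_representation[OF assms[OF ab]] by blast
    have "tdeg (\<sigma> k * with_one g k) \<le> 2 * M" if k: "k \<le> m" for k
    proof -
      have "tdeg (with_one g k) \<le> (\<Sum>k\<le>m. tdeg (with_one g k))"
        using k by (intro member_le_sum) auto
      then show ?thesis using tdeg_mult[of "\<sigma> k" "with_one g k"] \<sigma>(2)[OF k] by (simp add: M_def)
    qed
    moreover have "affine_poly a b = (\<Sum>k\<le>m. \<sigma> k * with_one g k)"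
      by (rule peval_inject) (simp add: peval_affine_poly peval_sum peval_mult \<sigma>(3))
    ultimately show ?thesis using \<sigma>(1) by blast
  qed
  moreover have "M > 0" by (simp add: M_def)
  ultimately show ?thesis unfolding PP_BDNR_def by blast
qed

subsection \<open>Exactness of the lifted linear matrix inequality\<close>

text \<open>The Riesz functional of a truncated moment sequence: it sends the monomial
  \<open>\<alpha>\<close> to \<open>Y \<alpha>\<close> and ignores degrees above
  \<open>2 * N\<close>.\<close>

definition riesz :: "nat \<Rightarrow> ('n::finite monom \<Rightarrow> real) \<Rightarrow> 'n mpoly \<Rightarrow> real" where
  "riesz N Y p = (\<Sum>\<alpha>\<in>monoms_upto (2 * N). Poly_Mapping.lookup p \<alpha> * Y \<alpha>)"

lemma riesz_add: "riesz N Y (p + q) = riesz N Y p + riesz N Y q"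
  by (simp add: riesz_def lookup_add algebra_simps sum.distrib)

lemma riesz_0 [simp]: "riesz N Y 0 = 0"
  by (simp add: riesz_def)

lemma riesz_sum: "riesz N Y (\<Sum>a\<in>A. f a) = (\<Sum>a\<in>A. riesz N Y (f a))"
  by (induction A rule: infinite_finite_induct) (simp_all add: riesz_add)

lemma lookup_Const_mult: "Poly_Mapping.lookup (Const c * p) \<alpha> = c * Poly_Mapping.lookup p \<alpha>"
proof -
  have "Const c * p = Poly_Mapping.map ((*) c) p"
    unfolding Const_def by (simp add: mult_map_scale_conv_mult)
  then show ?thesis by (simp add: Poly_Mapping.map.rep_eq when_def)
qed

lemma riesz_Const_mult: "riesz N Y (Const c * p) = c * riesz N Y p"
  by (simp add: riesz_def lookup_Const_mult sum_distrib_left mult.assoc)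

lemma riesz_xpow: "mdeg \<alpha> \<le> 2 * N \<Longrightarrow> riesz N Y (xpow \<alpha>) = Y \<alpha>"
proof -
  assume "mdeg \<alpha> \<le> 2 * N"
  moreover have "riesz N Y (xpow \<alpha>) = (\<Sum>\<beta>\<in>monoms_upto (2 * N). if \<beta> = \<alpha> then Y \<alpha> else 0)"
    unfolding riesz_def xpow_def by (intro sum.cong) (auto simp: lookup_single when_def)
  moreover from calculation have "\<alpha> \<in> monoms_upto (2 * N)" by (simp add: monoms_upto_def)
  ultimately show ?thesis by simp
qed

lemma monoms_upto_split:
  assumes "N > 0"
  shows "(monoms_upto (2 * N) :: 'n::finite monom set)
    = insert 0 (range (\<lambda>i. Poly_Mapping.single i 1) \<union> lift_indices N)"
proof (intro equalityI subsetI)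
  fix \<alpha> :: "'n monom" assume \<alpha>: "\<alpha> \<in> monoms_upto (2 * N)"
  show "\<alpha> \<in> insert 0 (range (\<lambda>i. Poly_Mapping.single i 1) \<union> lift_indices N)"
  proof (cases "\<alpha> = 0 \<or> 1 < mdeg \<alpha>")
    case True
    then show ?thesis using \<alpha> by (auto simp: monoms_upto_def lift_indices_def)
  next
    case False
    then obtain i \<beta> where "\<alpha> = \<beta> + Poly_Mapping.single i 1" using monom_nonzero_split[of \<alpha>] by blast
    with False have "\<beta> = 0" by (simp add: mdeg_add flip: mdeg_eq_0_iff)
    with \<open>\<alpha> = _\<close> show ?thesis by simp
  qed
qed (use assms in \<open>auto simp: monoms_upto_def lift_indices_def\<close>)

text \<open>The three parts correspond to the constant matrix, the variables \<open>x\<close> and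
  the lifted variables \<open>y\<close>; \<open>N > 0\<close> puts the degree one monomials within
  range.\<close>

lemma riesz_split:
  fixes Y :: "'n::finite monom \<Rightarrow> real"
  assumes "N > 0"
  shows "riesz N Y p = Poly_Mapping.lookup p 0 * Y 0
    + (\<Sum>i\<in>UNIV. Poly_Mapping.lookup p (Poly_Mapping.single i 1) * Y (Poly_Mapping.single i 1))
    + (\<Sum>\<alpha>\<in>lift_indices N. Poly_Mapping.lookup p \<alpha> * Y \<alpha>)"
proof -
  let ?E = "range (\<lambda>i::'n. Poly_Mapping.single i (1::nat))"
  have inj: "inj (\<lambda>i::'n. Poly_Mapping.single i (1::nat))"
  proof (rule injI)
    fix i j :: 'n assume "Poly_Mapping.single i (1::nat) = Poly_Mapping.single j 1"
    then have "Poly_Mapping.lookup (Poly_Mapping.single i (1::nat)) i = Poly_Mapping.lookup (Poly_Mapping.single j 1) i"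
      by simp
    then show "i = j" by (simp add: lookup_single when_def split: if_splits)
  qed
  have "mdeg \<alpha> = 1" if "\<alpha> \<in> ?E" for \<alpha> using that by auto
  then have disj: "0 \<notin> ?E \<union> lift_indices N" "?E \<inter> lift_indices N = {}"
    by (force simp: lift_indices_def)+
  have "riesz N Y p = Poly_Mapping.lookup p 0 * Y 0
      + ((\<Sum>\<alpha>\<in>?E. Poly_Mapping.lookup p \<alpha> * Y \<alpha>) + (\<Sum>\<alpha>\<in>lift_indices N. Poly_Mapping.lookup p \<alpha> * Y \<alpha>))"
    unfolding riesz_def monoms_upto_split[OF assms]
    by (subst sum.insert, simp, rule disj, subst sum.union_disjoint) (use disj(2) in auto)
  then show ?thesis by (simp only: sum.reindex[OF inj] o_def add.assoc)
qed

text \<open>Evaluates the localizing matrix of \<open>p\<close> at the coefficient vector of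
  \<open>w\<close>; when \<open>p\<close> is one of the constraints, the linear matrix inequality
  makes this nonnegative.\<close>

lemma riesz_square_mult:
  assumes "tdeg w \<le> e"
  shows "riesz N Y (w * w * p) = (\<Sum>\<beta>\<in>monoms_upto e. \<Sum>\<gamma>\<in>monoms_upto e.
    Poly_Mapping.lookup w \<beta> * riesz N Y (p * xpow \<beta> * xpow \<gamma>) * Poly_Mapping.lookup w \<gamma>)"
proof -
  have w: "w = (\<Sum>\<beta>\<in>monoms_upto e. Const (Poly_Mapping.lookup w \<beta>) * xpow \<beta>)"
    by (rule poly_eq_sum_xpow) (simp_all add: keys_subset_monoms assms)
  define c where "c = Poly_Mapping.lookup w"
  have "w * w * p = (\<Sum>\<beta>\<in>monoms_upto e. \<Sum>\<gamma>\<in>monoms_upto e.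
      (Const (c \<beta>) * xpow \<beta>) * (Const (c \<gamma>) * xpow \<gamma>)) * p"
    using arg_cong2[OF w w, of "(*)"] by (simp only: sum_product c_def)
  also have "\<dots> = (\<Sum>\<beta>\<in>monoms_upto e. \<Sum>\<gamma>\<in>monoms_upto e.
      Const (c \<beta>) * (Const (c \<gamma>) * (p * xpow \<beta> * xpow \<gamma>)))"
    unfolding sum_distrib_right by (intro sum.cong refl) (simp only: mult_ac)
  finally have "riesz N Y (w * w * p) = (\<Sum>\<beta>\<in>monoms_upto e. \<Sum>\<gamma>\<in>monoms_upto e.
      c \<beta> * (c \<gamma> * riesz N Y (p * xpow \<beta> * xpow \<gamma>)))"
    by (simp only: riesz_sum riesz_Const_mult)
  then show ?thesis by (simp add: c_def mult_ac)
qed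

text \<open>A point of the set is lifted by its own monomial values. Each matrix is then a
  nonnegative number times the rank one matrix of products of monomials.\<close>

lemma lifted_set_project_supset:
  fixes g :: "nat \<Rightarrow> 'n::finite mpoly"
  assumes N: "N > 0" "\<And>k. k \<le> m \<Longrightarrow> half_deg g k \<le> N" and x: "x \<in> semialg_set m g"
  shows "x \<in> fst ` lifted_set m g N"
proof -
  \<comment> \<open>\<open>restrict\<close> supplies the value \<open>undefined\<close> off the
    index set that the extensional function space requires.\<close>
  define y where "y = restrict (\<lambda>\<alpha>. mval \<alpha> x) (lift_indices N)"
  have entry: "lmi_coeff g k 0 \<beta> \<gamma>
        + (\<Sum>i\<in>UNIV. lmi_coeff g k (Poly_Mapping.single i 1) \<beta> \<gamma> * x $ i)
        + (\<Sum>\<alpha>\<in>lift_indices N. lmi_coeff g k \<alpha> \<beta> \<gamma> * y \<alpha>)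
      = peval (with_one g k) x * (mval \<beta> x * mval \<gamma> x)"
    if k: "k \<le> m" and \<beta>: "\<beta> \<in> monoms_upto (N - half_deg g k)" and \<gamma>: "\<gamma> \<in> monoms_upto (N - half_deg g k)"
    for k \<beta> \<gamma>
  proof -
    let ?p = "with_one g k * xpow \<beta> * xpow \<gamma>"
    have "peval ?p x = (\<Sum>\<alpha>\<in>monoms_upto (2 * N). lmi_coeff g k \<alpha> \<beta> \<gamma> * mval \<alpha> x)"
      by (subst lmi_coeff_expansion[OF N(2)[OF k] \<beta> \<gamma>]) (simp add: peval_sum peval_mult peval_xpow)
    also have "\<dots> = riesz N (\<lambda>\<alpha>. mval \<alpha> x) ?p" by (simp add: riesz_def lmi_coeff_def)
    also have "\<dots> = lmi_coeff g k 0 \<beta> \<gamma>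
        + (\<Sum>i\<in>UNIV. lmi_coeff g k (Poly_Mapping.single i 1) \<beta> \<gamma> * x $ i)
        + (\<Sum>\<alpha>\<in>lift_indices N. lmi_coeff g k \<alpha> \<beta> \<gamma> * y \<alpha>)"
      using riesz_split[OF N(1), of "\<lambda>\<alpha>. mval \<alpha> x" ?p] by (simp add: lmi_coeff_def mval_single y_def)
    finally show ?thesis by (simp add: peval_mult peval_xpow mult.assoc)
  qed
  have "pos_semidef_on (monoms_upto (N - half_deg g k)) (\<lambda>\<beta> \<gamma>. lmi_coeff g k 0 \<beta> \<gamma>
        + (\<Sum>i\<in>UNIV. lmi_coeff g k (Poly_Mapping.single i 1) \<beta> \<gamma> * x $ i)
        + (\<Sum>\<alpha>\<in>lift_indices N. lmi_coeff g k \<alpha> \<beta> \<gamma> * y \<alpha>))" if k: "k \<le> m" for k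
    unfolding pos_semidef_on_def
  proof (intro conjI ballI allI)
    let ?I = "monoms_upto (N - half_deg g k) :: 'n monom set"
    fix v
    have "(\<Sum>\<beta>\<in>?I. \<Sum>\<gamma>\<in>?I. v \<beta> * (peval (with_one g k) x * (mval \<beta> x * mval \<gamma> x)) * v \<gamma>)
        = peval (with_one g k) x * (\<Sum>\<beta>\<in>?I. v \<beta> * mval \<beta> x)\<^sup>2"
      by (simp add: power2_eq_square sum_product sum_distrib_left mult_ac)
    moreover have "peval (with_one g k) x \<ge> 0"
      using x k by (auto simp: with_one_def semialg_set_def)
    ultimately show "(\<Sum>\<beta>\<in>?I. \<Sum>\<gamma>\<in>?I. v \<beta> * (lmi_coeff g k 0 \<beta> \<gamma>
        + (\<Sum>i\<in>UNIV. lmi_coeff g k (Poly_Mapping.single i 1) \<beta> \<gamma> * x $ i)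
        + (\<Sum>\<alpha>\<in>lift_indices N. lmi_coeff g k \<alpha> \<beta> \<gamma> * y \<alpha>)) * v \<gamma>) \<ge> 0"
      by (simp only: entry[OF k] zero_le_mult_iff zero_le_power2 simp_thms cong: sum.cong)
  qed (simp only: entry[OF k], simp only: mult.commute)
  then have "(x, y) \<in> lifted_set m g N" by (simp add: lifted_set_def y_def)
  then show ?thesis by force
qed

text \<open>Each weighted square contributes a nonnegative value of a localizing form. The bound on
  \<open>N\<close> ensures that its root has degree at most \<open>N - half_deg g k\<close>, so that
  its coefficients are indexed by the rows of the matrix.\<close>

lemma riesz_nonneg_on_qm:
  fixes g :: "nat \<Rightarrow> 'n::finite mpoly"
  assumes "qm (gens m g) N0 f" and N: "N > 0" "\<And>k. k \<le> m \<Longrightarrow> N0 + half_deg g k \<le> N"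
    and xy: "(x, y) \<in> lifted_set m g N"
    and Y: "Y 0 = 1" "\<And>i. Y (Poly_Mapping.single i 1) = x $ i" "\<And>\<alpha>. \<alpha> \<in> lift_indices N \<Longrightarrow> Y \<alpha> = y \<alpha>"
  shows "\<exists>P. f = peval P \<and> riesz N Y P \<ge> 0"
  using assms(1)
proof (induction rule: qm.induct)
  case zero
  show ?case by (rule exI[of _ 0]) auto
next
  case (step f h w)
  then obtain P where P: "f = peval P" "riesz N Y P \<ge> 0" by blast
  obtain k where k: "k \<le> m" "h = peval (with_one g k)" using step.hyps(2) by (auto simp: gens_def)
  obtain p where p: "tdeg p \<le> N0" "w = peval p" using step.hyps(3) by (auto simp: polyf_def)
  let ?I = "monoms_upto (N - half_deg g k) :: 'n monom set"
  have e: "tdeg p \<le> N - half_deg g k" using p(1) N(2)[OF k(1)] by linarith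
  have entry: "riesz N Y (with_one g k * xpow \<beta> * xpow \<gamma>) = lmi_coeff g k 0 \<beta> \<gamma>
        + (\<Sum>i\<in>UNIV. lmi_coeff g k (Poly_Mapping.single i 1) \<beta> \<gamma> * x $ i)
        + (\<Sum>\<alpha>\<in>lift_indices N. lmi_coeff g k \<alpha> \<beta> \<gamma> * y \<alpha>)" for \<beta> \<gamma>
    unfolding riesz_split[OF N(1)] lmi_coeff_def Y(1,2) by (simp add: Y(3))
  have "riesz N Y (p * p * with_one g k) \<ge> 0"
    using xy k(1) unfolding riesz_square_mult[OF e] entry lifted_set_def pos_semidef_on_def by blast
  then have "riesz N Y (P + p * p * with_one g k) \<ge> 0" using P(2) by (simp add: riesz_add)
  moreover have "(\<lambda>x. f x + (w x)\<^sup>2 * h x) = peval (P + p * p * with_one g k)"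
    by (simp add: fun_eq_iff peval_add peval_mult P k p power2_eq_square)
  ultimately show ?case by blast
qed

lemma lifted_set_project_subset:
  fixes g :: "nat \<Rightarrow> 'n::finite mpoly"
  assumes S: "closed (semialg_set m g)" "convex (semialg_set m g)"
    and rep: "\<And>a b. (\<forall>x\<in>semialg_set m g. a \<bullet> x + b \<ge> 0) \<Longrightarrow> qm (gens m g) N0 (\<lambda>x. a \<bullet> x + b)"
    and N: "N > 0" "\<And>k. k \<le> m \<Longrightarrow> N0 + half_deg g k \<le> N"
    and xy: "(x, y) \<in> lifted_set m g N"
  shows "x \<in> semialg_set m g"
proof (rule ccontr)
  assume "x \<notin> semialg_set m g"
  then obtain a b where ab: "a \<bullet> x < b" "\<And>z. z \<in> semialg_set m g \<Longrightarrow> b < a \<bullet> z"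
    using separating_hyperplane_closed_point[OF S(2,1)] by blast
  \<comment> \<open>Completes \<open>y\<close> by the entries that the inequality prescribes: 1 for
    the constant monomial and the coordinates of \<open>x\<close> in degree one.\<close>
  define Y where "Y \<alpha> = (if mdeg \<alpha> \<le> 1 then mval \<alpha> x else y \<alpha>)" for \<alpha>
  have Y: "Y 0 = 1" "\<And>i. Y (Poly_Mapping.single i 1) = x $ i" "\<And>\<alpha>. \<alpha> \<in> lift_indices N \<Longrightarrow> Y \<alpha> = y \<alpha>"
    by (auto simp: Y_def mval_single lift_indices_def)
  have "qm (gens m g) N0 (\<lambda>z. a \<bullet> z + (- b))" using ab(2) by (intro rep) (force intro: less_imp_le)
  from riesz_nonneg_on_qm[OF this N xy Y] obtain P where
    P: "(\<lambda>z. a \<bullet> z + (- b)) = peval P" "riesz N Y P \<ge> 0" by blast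
  \<comment> \<open>The functional acts on formal polynomials, so \<open>P\<close> itself must be
    identified and not only its values.\<close>
  have "P = affine_poly a (- b)"
    by (rule peval_inject) (simp only: peval_affine_poly P(1)[symmetric])
  moreover have "riesz N Y (affine_poly a (- b)) = a \<bullet> x + (- b)"
  proof -
    have "riesz N Y (Const (- b)) = riesz N Y (Const (- b) * xpow 0)" by (simp add: xpow_def)
    also have "\<dots> = - b" by (simp only: riesz_Const_mult) (simp add: riesz_xpow Y)
    finally have c: "riesz N Y (Const (- b)) = - b" .
    have v: "riesz N Y (Var i) = x $ i" for i
      unfolding Var_def by (subst riesz_xpow) (use N(1) Y(2)[of i] in simp_all)
    show ?thesis
      unfolding affine_poly_def riesz_add riesz_sum riesz_Const_mult c v by (simp add: inner_vec_def)
  qed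
  ultimately show False using P(2) ab(1) by simp
qed

theorem theorem6:
  fixes m :: nat and g :: "nat \<Rightarrow> 'n::finite mpoly" and S :: "(real^'n) set"
  assumes S_def: "S = semialg_set m g"
    and "compact S" and "convex S" and "interior S \<noteq> {}"
    and "\<forall>i\<in>{1..m}. concave_on S (peval (g i))"
    and "archimedean m g"
    and "\<forall>i\<in>{1..m}. sos_matrix (- hessian (g i)) \<or>
           (\<forall>u \<in> frontier (nonneg_set (g i)) \<inter> frontier S. pos_def (- meval (hessian (g i)) u))"
  shows "PP_BDNR m g \<and>
         (\<exists>N::nat. N > 0 \<and> (\<forall>k\<le>m. half_deg g k \<le> N) \<and> S = fst ` lifted_set m g N)"
proof -
  obtain N0 where N0: "\<And>a b. (\<forall>x\<in>semialg_set m g. a \<bullet> x + b \<ge> 0) \<Longrightarrow> qm (gens m g) N0 (\<lambda>x. a \<bullet> x + b)"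
    using affine_in_qm[OF assms(1-4) _ assms(6)] assms(5,7) S_def by blast
  \<comment> \<open>Large enough both for the representations of bounded degree and for
    \<open>N - half_deg g k\<close> not to truncate; the 1 makes it positive.\<close>
  define N where "N = N0 + (\<Sum>k\<le>m. half_deg g k) + 1"
  have N: "N0 + half_deg g k \<le> N" if "k \<le> m" for k
    using member_le_sum[of k "{..m}" "half_deg g"] that by (simp add: N_def)
  have "N > 0" by (simp add: N_def)
  moreover have hN: "half_deg g k \<le> N" if "k \<le> m" for k using N[OF that] by simp
  moreover have "S = fst ` lifted_set m g N"
  proof (intro equalityI subsetI)
    fix x assume "x \<in> S"
    then show "x \<in> fst ` lifted_set m g N"
      using lifted_set_project_supset[OF \<open>N > 0\<close> hN] S_def by blast
  next
    fix x assume "x \<in> fst ` lifted_set m g N"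
    then obtain y where "(x, y) \<in> lifted_set m g N" by force
    then show "x \<in> S"
      using lifted_set_project_subset[OF _ _ N0 \<open>N > 0\<close> N] assms(2,3) S_def compact_imp_closed by blast
  qed
  ultimately show ?thesis using PP_BDNR_if_qm[OF N0] by blast
qed

end
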